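(* Let $\boldsymbol{X}^n$ be the occupancy process of the JSQ$(d_n)$ system described in the context, where $d_n\in\{1,\dots,n\}$, $d_n\to\infty$, $\lambda_n\to\lambda$, and $\boldsymbol{X}^n(0)=\boldsymbol{x}^n$ with deterministic $\boldsymbol{x}^n,\boldsymbol{x}\in\boldsymbol{\ell}_1^\downarrow$, $n x^n_i\in\mathbb{N}_0$ for all $i$, $\|\boldsymbol{x}^n-\boldsymbol{x}\|_1\to0$. Suppose $\lambda=1$ and $x_1=1$. Fix $\varepsilon>0$ and, for $T\in(0,\infty)$, let $$G^n_\varepsilon=\{\|\boldsymbol{X}^n(t)\|_1>\|\boldsymbol{x}^n\|_1+\varepsilon\text{ for some }t\in[0,T]\},\qquad F^n_\varepsilon=\{\|\boldsymbol{X}^n(t)\|_1\ge\|\boldsymbol{x}^n\|_1+\varepsilon\text{ for some }t\in[0,T]\}.$$ Then, for every $T\in(0,\infty)$, $$\lim_{n\to\infty}\frac1n\log\mathbb{P}(G^n_\varepsilon)=\lim_{n\to\infty}\frac1n\log\mathbb{P}(F^n_\varepsilon)=-T\,\ell\!\left(\frac{\frac{\varepsilon}{T}+\sqrt{4+(\frac{\varepsilon}{T})^2}}{2}\right)-T\,\ell\!\left(\frac{-\frac{\varepsilon}{T}+\sqrt{4+(\frac{\varepsilon}{T})^2}}{2}\right),$$ and $$\lim_{T\to\infty}\lim_{n\to\infty}\frac Tn\log\mathbb{P}(G^n_\varepsilon)=\lim_{T\to\infty}\lim_{n\to\infty}\frac Tn\log\mathbb{P}(F^n_\varepsilon)=-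\frac{\varepsilon^2}{4}.$$
   Context: JSQ$(d_n)$ system: $n$ parallel single-server queues; jobs arrive according to a Poisson process of rate $n\lambda_n$; service times are i.i.d. exponential with mean 1, independent of the arrivals, FIFO at each server; each arriving job samples $d_n$ of the $n$ queues uniformly at random without replacement and joins the shortest of them (ties broken uniformly at random). For $i\ge1$, $X^n_i(t)$ is the proportion of the $n$ queues that have length at least $i$ at time $t$, and $\boldsymbol{X}^n(t)=(X^n_i(t))_{i\ge1}$, so that $n\|\boldsymbol{X}^n(t)\|_1=n\sum_{i\ge1}X^n_i(t)$ is the total number of jobs in the system. $\boldsymbol{\ell}_1$ is the space of real sequences $\boldsymbol{x}=(x_1,x_2,\dots)$ with $\|\boldsymbol{x}\|_1=\sum_i|x_i|<\infty$, and $\boldsymbol{\ell}_1^\downarrow=\{\boldsymbol{x}\in\boldsymbol{\ell}_1:x_i\ge x_{i+1},\ x_i\in[0,1]\ \forall i\}$. $\ell(z)=z\log z-z+1$ for $z\ge0$. *)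

theory Defs
  imports "HOL-Probability.Probability" "HOL-Combinatorics.Multiset_Permutations"
begin

text \<open>Sequences \<open>(x\<^sub>1, x\<^sub>2, \<dots>)\<close> are functions \<^typ>\<open>nat \<Rightarrow> real\<close> whose value at \<open>0\<close> is ignored.\<close>

definition l1_norm :: "(nat \<Rightarrow> real) \<Rightarrow> real" where
  "l1_norm x = (\<Sum>\<^sub>\<infinity>i\<in>{1..}. \<bar>x i\<bar>)"

definition l1_space :: "(nat \<Rightarrow> real) set" where
  "l1_space = {x. (\<lambda>i. \<bar>x i\<bar>) summable_on {1..}}"

definition l1_down :: "(nat \<Rightarrow> real) set" where
  "l1_down = {x \<in> l1_space. \<forall>i\<ge>1. x (Suc i) \<le> x i \<and> x i \<in> {0..1}}"

definition ell :: "real \<Rightarrow> real" where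
  "ell z = z * ln z - z + 1"

text \<open>
  One realisation of the primitive data of the system. Servers are numbered \<open>0, \<dots>, n - 1\<close>,
  arriving jobs \<open>0, 1, \<dots>\<close>.
  \<^item> \<open>init\<close>: the list of the \<open>n\<close> initial queue lengths;
  \<^item> \<open>gap k\<close>: the time between the arrivals of jobs \<open>k - 1\<close> and \<open>k\<close> (from time \<open>0\<close> if \<open>k = 0\<close>);
  \<^item> \<open>service q m\<close>: the service time of the \<open>m\<close>-th job served by \<open>q\<close>, the \<open>init ! q\<close> jobs
    initially present being served first;
  \<^item> \<open>sample k\<close>: the set of queues sampled by job \<open>k\<close>;
  \<^item> \<open>priority k\<close>: an ordering of the servers by which job \<open>k\<close> breaks ties. As the ordering is
    uniform and independent of everything else, its first element in a given nonempty set of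
    tied queues is uniformly distributed on that set.
\<close>

record jsq_data =
  init :: "nat list"
  gap :: "nat \<Rightarrow> real"
  service :: "nat \<Rightarrow> nat \<Rightarrow> real"
  sample :: "nat \<Rightarrow> nat set"
  priority :: "nat \<Rightarrow> nat list"

definition arrival_time :: "jsq_data \<Rightarrow> nat \<Rightarrow> real" where
  "arrival_time w k = (\<Sum>j\<le>k. gap w j)"

definition arrivals :: "jsq_data \<Rightarrow> real \<Rightarrow> nat" where
  "arrivals w t = card {k. arrival_time w k \<le> t}"

text \<open>
  A list of departure times, of all jobs so far assigned to a server, determines the queue
  length (including the job in service) as long as no further job is assigned.
\<close>

definition num_present :: "real list \<Rightarrow> real \<Rightarrow> nat" where
  "num_present ds t = length (filter (\<lambda>u. t < u) ds)"

definition shortest :: "(nat \<Rightarrow> real list) \<Rightarrow> real \<Rightarrow> nat set \<Rightarrow> nat set" where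
  "shortest D t A = {q \<in> A. \<forall>q'\<in>A. num_present (D q) t \<le> num_present (D q') t}"

text \<open>
  \<open>departures w k q\<close> lists the departure times of all jobs at server \<open>q\<close> among the initial jobs
  and the first \<open>k\<close> arrivals. By FIFO, the service of a job begins at its arrival or at
  the departure of the last of its predecessors at that server, whichever is later.
\<close>

primrec departures :: "jsq_data \<Rightarrow> nat \<Rightarrow> nat \<Rightarrow> real list" where
  "departures w 0 =
     (\<lambda>q. map (\<lambda>m. \<Sum>j\<le>m. service w q j) [0..<init w ! q])"
| "departures w (Suc k) =
     (let D = departures w k;
          t = arrival_time w k;
          q = hd (filter (\<lambda>q. q \<in> shortest D t (sample w k)) (priority w k));
          start = Max (insert t (set (D q)))
      in D(q := D q @ [start + service w q (length (D q))]))"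

definition queue_length :: "jsq_data \<Rightarrow> nat \<Rightarrow> real \<Rightarrow> nat" where
  "queue_length w q t = num_present (departures w (arrivals w t) q) t"

definition occupancy :: "nat \<Rightarrow> jsq_data \<Rightarrow> real \<Rightarrow> nat \<Rightarrow> real" where
  "occupancy n w t i = real (card {q. q < n \<and> i \<le> queue_length w q t}) / real n"

text \<open>The primitive random variables have different types, so their independence is stated for
  the \<open>\<sigma>\<close>-algebras they generate.\<close>

datatype source = Init | Gap nat | Service nat nat | Sample nat | Priority nat

definition sources :: "nat \<Rightarrow> source set" where
  "sources n = {Init} \<union> range Gap \<union> {Service q m | q m. q < n} \<union> range Sample \<union> range Priority"

definition source_events :: "'a measure \<Rightarrow> ('a \<Rightarrow> jsq_data) \<Rightarrow> source \<Rightarrow> 'a set set" where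
  "source_events M W s = (case s of
       Init \<Rightarrow> sets (vimage_algebra (space M) (\<lambda>\<omega>. init (W \<omega>)) (count_space UNIV))
     | Gap k \<Rightarrow> sets (vimage_algebra (space M) (\<lambda>\<omega>. gap (W \<omega>) k) borel)
     | Service q m \<Rightarrow> sets (vimage_algebra (space M) (\<lambda>\<omega>. service (W \<omega>) q m) borel)
     | Sample k \<Rightarrow> sets (vimage_algebra (space M) (\<lambda>\<omega>. sample (W \<omega>) k) (count_space UNIV))
     | Priority k \<Rightarrow> sets (vimage_algebra (space M) (\<lambda>\<omega>. priority (W \<omega>) k) (count_space UNIV)))"

definition uniform_rv :: "'a measure \<Rightarrow> ('a \<Rightarrow> 'b) \<Rightarrow> 'b set \<Rightarrow> bool" where
  "uniform_rv M Y A \<longleftrightarrow>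
     Y \<in> measurable M (count_space A) \<and> distr M (count_space A) Y = uniform_count_measure A"

text \<open>
  The JSQ(\<open>d\<close>) system with \<open>n\<close> servers and arrival rate \<open>n * lam\<close>; the Poisson arrival process is
  given by its i.i.d. exponential interarrival times. The initial queue lengths may be random but
  are independent of all else. The service in progress at time \<open>0\<close> has a residual duration that is
  exponential with mean 1, as for a complete service.
\<close>

definition jsq_system ::
  "'a measure \<Rightarrow> nat \<Rightarrow> real \<Rightarrow> nat \<Rightarrow> ('a \<Rightarrow> jsq_data) \<Rightarrow> bool" where
  "jsq_system M n lam d W \<longleftrightarrow>
     prob_space M \<and>
     (\<lambda>\<omega>. init (W \<omega>)) \<in> measurable M (count_space {qs. length qs = n}) \<and>
     (\<forall>k. distributed M lborel (\<lambda>\<omega>. gap (W \<omega>) k) (exponential_density (real n * lam))) \<and>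
     (\<forall>q<n. \<forall>m. distributed M lborel (\<lambda>\<omega>. service (W \<omega>) q m) (exponential_density 1)) \<and>
     (\<forall>k. uniform_rv M (\<lambda>\<omega>. sample (W \<omega>) k) {A. A \<subseteq> {..<n} \<and> card A = d}) \<and>
     (\<forall>k. uniform_rv M (\<lambda>\<omega>. priority (W \<omega>) k) (permutations_of_set {..<n})) \<and>
     prob_space.indep_sets M (source_events M W) (sources n)"

definition G_event ::
  "'a measure \<Rightarrow> nat \<Rightarrow> ('a \<Rightarrow> jsq_data) \<Rightarrow> (nat \<Rightarrow> real) \<Rightarrow> real \<Rightarrow> real \<Rightarrow> 'a set" where
  "G_event M n W x0 eps T =
     {\<omega> \<in> space M. \<exists>t\<in>{0..T}. l1_norm (occupancy n (W \<omega>) t) > l1_norm x0 + eps}"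

definition F_event ::
  "'a measure \<Rightarrow> nat \<Rightarrow> ('a \<Rightarrow> jsq_data) \<Rightarrow> (nat \<Rightarrow> real) \<Rightarrow> real \<Rightarrow> real \<Rightarrow> 'a set" where
  "F_event M n W x0 eps T =
     {\<omega> \<in> space M. \<exists>t\<in>{0..T}. l1_norm (occupancy n (W \<omega>) t) \<ge> l1_norm x0 + eps}"

text \<open>
  Negative interarrival times and accumulating arrivals are excluded only almost surely. On the
  exceptional null set the events above, which quantify over uncountably many times, need not be
  measurable; they are therefore measured in the completion.

  Since \<^term>\<open>ln (0::real) = 0\<close>, a vanishing probability makes \<open>log_prob\<close> equal to \<open>0\<close> and not
  \<open>-\<infinity>\<close>. Convergence of \<open>log_prob / n\<close> to a negative limit still forces the probabilities to be
  eventually positive.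
\<close>

definition log_prob :: "'a measure \<Rightarrow> 'a set \<Rightarrow> real" where
  "log_prob M A = ln (measure (completion M) A)"

end

theory Submission
  imports Defs "HOL-Real_Asymp.Real_Asymp"
begin

text \<open>
  Lower bound, for every \<open>d\<close>: a server completes by time \<open>t\<close> at most as many jobs as the renewal
  process of its service times counts, so the number of jobs exceeds its initial value by at least
  the difference of two independent Poisson variables with means \<open>n \<lambda>\<^sub>n T\<close> and \<open>n T\<close>. That this
  difference is about \<open>n \<epsilon>\<close> has the stated exponential rate, attained at \<open>T e\<^sup>\<theta>\<close> arrivals
  and \<open>T e\<^sup>-\<^sup>\<theta>\<close> services per server with \<open>T (e\<^sup>\<theta> - e\<^sup>-\<^sup>\<theta>) = \<epsilon>\<close>.

  Upper bound: exponential services are memoryless, hence after each arrival or departure the system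
  starts afresh from its new queue lengths. This gives a maximal inequality for every function of
  the queue lengths with a one-step drift condition. It is applied to \<open>exp (\<theta> V)\<close>, where \<open>V\<close> is
  the number of jobs plus a correction that is constant while at most \<open>\<delta> n\<close> servers are idle. With
  more idle servers the correction grows with their number, which compensates the missing
  departures; it drops at the next arrivals because a sample of \<open>d\<^sub>n \<rightarrow> \<infinity>\<close> queues contains an idle
  one with probability tending to 1. The drift of \<open>exp (\<theta> V)\<close> is then at most
  \<open>n (e\<^sup>\<theta> + e\<^sup>-\<^sup>\<theta> - 2 + o(1))\<close>, as for the free random walk.
\<close>

section \<open>Restarting the system at its first event\<close>

text \<open>The system is given pathwise by departure times, so its Markov property has to be
  proved: conditioning on the first event must return a system of the same kind with independent
  sources of the same laws. Hence restarting is a map on the product space of all sources, and level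
  crossings are described by a recursion over events rather than by times. The constant \<theta> is
  Chernoff's: a walk with unit jumps up and down, each at rate n, rises by n \<epsilon> within time
  T with probability at most exp (n (T (e^\<theta> + e^-\<theta> - 2) - \<theta> \<epsilon>)), which
  is least where T (e^\<theta> - e^-\<theta>) = \<epsilon>. The obstacle to using exp (\<theta>
  times the number of jobs) is idleness: each idle server takes away departure rate 1 and so raises
  the relative drift by 1 - e^-\<theta>; a positive proportion of them would spoil the bound. The
  lower bound does not meet this obstacle, since idleness only keeps more jobs in the system.
  Convergence of the initial states with x_1 = 1 leaves o(n) servers idle at time 0, so that V
  starts at the number of jobs.\<close>

text \<open>
  A canonical realisation assigns a real number to every source. Queue length vectors, sampled sets
  and priorities are coded by numbers, so that a single product of real distributions suffices.
\<close>

definition dec_list :: "real \<Rightarrow> nat list" where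
  "dec_list r = from_nat (nat \<lfloor>r\<rfloor>)"

definition enc_list :: "nat list \<Rightarrow> real" where
  "enc_list xs = real (to_nat xs)"

lemma dec_enc_list [simp]: "dec_list (enc_list xs) = xs"
  by (simp add: dec_list_def enc_list_def)

text \<open>The competing exponential times: the next arrival and, at each busy server, the residual
  service in progress, which \<open>advance\<close> always keeps at index 0.\<close>

definition clocks :: "nat list \<Rightarrow> source set" where
  "clocks c = insert (Gap 0) ((\<lambda>q. Service q 0) ` {q. q < length c \<and> 0 < c ! q})"

text \<open>After the first event \<open>i\<close>, the restarted system reads its source \<open>x\<close> off the source
  \<open>advance i x\<close> of the original one.\<close>

fun advance :: "source \<Rightarrow> source \<Rightarrow> source" where
  "advance (Gap _) (Gap k) = Gap (Suc k)"
| "advance (Gap _) (Sample k) = Sample (Suc k)"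
| "advance (Gap _) (Priority k) = Priority (Suc k)"
| "advance (Service q _) (Service q' m) = Service q' (if q = q' then Suc m else m)"
| "advance _ x = x"

definition choice :: "nat list \<Rightarrow> nat set \<Rightarrow> nat list \<Rightarrow> nat" where
  "choice c S p = hd (filter (\<lambda>q. q \<in> S \<and> (\<forall>q'\<in>S. c ! q \<le> c ! q')) p)"

definition join :: "nat list \<Rightarrow> real \<Rightarrow> real \<Rightarrow> nat list" where
  "join c a b = (let q = choice c (set (dec_list a)) (dec_list b) in c[q := Suc (c ! q)])"

fun step :: "nat list \<Rightarrow> source \<Rightarrow> (source \<Rightarrow> real) \<Rightarrow> nat list" where
  "step c (Gap _) z = join c (z (Sample 0)) (z (Priority 0))"
| "step c (Service q _) z = c[q := c ! q - 1]"
| "step c _ z = c"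

text \<open>The elapsed time \<open>s\<close> is a separate argument although it equals
  \<open>z i\<close> on every path: for constant \<open>s\<close> the law of the shifted sources is
  computable, and Fubini integrates over \<open>s\<close> afterwards. The restriction to
  \<open>sources\<close> keeps the result in the product space.\<close>

definition shift :: "nat list \<Rightarrow> source \<Rightarrow> real \<Rightarrow> (source \<Rightarrow> real) \<Rightarrow> source \<Rightarrow> real" where
  "shift c i s z = (\<lambda>x\<in>sources (length c).
     z (advance i x) - (if advance i x \<in> clocks c then s else 0))"

text \<open>Strict minimality makes the first clock unique and leaves a positive time on all the
  others.\<close>

definition first_clock :: "nat list \<Rightarrow> (source \<Rightarrow> real) \<Rightarrow> source \<Rightarrow> bool" where
  "first_clock c z i \<longleftrightarrow> i \<in> clocks c \<and> (\<forall>j\<in>clocks c - {i}. z i < z j)"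

text \<open>\<open>P\<close> holds at time \<open>0\<close> or just after one of the first \<open>k\<close> events, the latter not after
  time \<open>T\<close>. After a tie of two clocks there is no first clock and the recursion stops.\<close>

primrec reach ::
  "(nat list \<Rightarrow> (source \<Rightarrow> real) \<Rightarrow> bool) \<Rightarrow> nat \<Rightarrow> nat list \<Rightarrow> (source \<Rightarrow> real) \<Rightarrow> real \<Rightarrow> bool" where
  "reach P 0 c z T \<longleftrightarrow> P c z"
| "reach P (Suc k) c z T \<longleftrightarrow> P c z \<or>
     (\<exists>i. first_clock c z i \<and> z i \<le> T \<and> reach P k (step c i z) (shift c i (z i) z) (T - z i))"

definition tie :: "nat list \<Rightarrow> (source \<Rightarrow> real) \<Rightarrow> bool" where
  "tie c z \<longleftrightarrow> (\<exists>i\<in>clocks c. \<exists>j\<in>clocks c. i \<noteq> j \<and> z i = z j)"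

definition dat :: "nat list \<Rightarrow> (source \<Rightarrow> real) \<Rightarrow> jsq_data" where
  "dat c z = \<lparr>init = c, gap = (\<lambda>k. z (Gap k)), service = (\<lambda>q m. z (Service q m)),
     sample = (\<lambda>k. set (dec_list (z (Sample k)))), priority = (\<lambda>k. dec_list (z (Priority k)))\<rparr>"

text \<open>The almost sure properties used by the pathwise arguments. Finiteness of the arrivals up
  to each time is among them because \<open>arrivals\<close> is a cardinality, which is 0 for an
  infinite set.\<close>

definition regular :: "nat \<Rightarrow> (source \<Rightarrow> real) \<Rightarrow> bool" where
  "regular n z \<longleftrightarrow> (\<forall>k. 0 < z (Gap k)) \<and> (\<forall>q<n. \<forall>m. 0 < z (Service q m)) \<and>
     (\<forall>k. dec_list (z (Sample k)) \<noteq> [] \<and> set (dec_list (z (Sample k))) \<subseteq> {..<n}) \<and>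
     (\<forall>k. set (dec_list (z (Priority k))) = {..<n}) \<and>
     (\<forall>t. finite {k. (\<Sum>j\<le>k. z (Gap j)) \<le> t})"

lemma dat_simps [simp]:
  "init (dat c z) = c" "gap (dat c z) k = z (Gap k)" "service (dat c z) q m = z (Service q m)"
  "sample (dat c z) k = set (dec_list (z (Sample k)))" "priority (dat c z) k = dec_list (z (Priority k))"
  by (simp_all add: dat_def)

lemma sources_simps [simp]:
  "Init \<in> sources n" "Gap k \<in> sources n" "Sample k \<in> sources n" "Priority k \<in> sources n"
  "Service q m \<in> sources n \<longleftrightarrow> q < n"
  by (auto simp: sources_def)

lemma clocks_simps [simp]:
  "Init \<notin> clocks c" "Gap k \<in> clocks c \<longleftrightarrow> k = 0" "Sample k \<notin> clocks c" "Priority k \<notin> clocks c"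
  "Service q m \<in> clocks c \<longleftrightarrow> q < length c \<and> 0 < c ! q \<and> m = 0"
  by (auto simp: clocks_def)

lemma clocks_cases:
  assumes "i \<in> clocks c"
  obtains "i = Gap 0" | q where "i = Service q 0" "q < length c" "0 < c ! q"
  using assms by (auto simp: clocks_def)

lemma finite_clocks [simp]: "finite (clocks c)"
  by (simp add: clocks_def)

lemma num_present_map [simp]: "num_present (map ((+) s) ds) (s + t) = num_present ds t"
  by (simp add: num_present_def filter_map comp_def)

lemma num_present_all: "(\<And>u. u \<in> set ds \<Longrightarrow> t < u) \<Longrightarrow> num_present ds t = length ds"
  by (simp add: num_present_def)

lemma Max_insert_translate:
  fixes s t :: real
  shows "finite A \<Longrightarrow> Max (insert (s + t) ((+) s ` A)) = s + Max (insert t A)"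
  using hom_Max_commute[of "(+) s" "insert t A"] by (simp add: image_insert max_add_distrib_right)

lemma choice_eq:
  assumes "\<And>q. q \<in> S \<Longrightarrow> num_present (D q) t = c ! q"
  shows "hd (filter (\<lambda>q. q \<in> shortest D t S) p) = choice c S p"
  using assms unfolding choice_def shortest_def
  by (intro arg_cong[where f = hd] filter_cong) auto

lemma hd_filter_in: "\<exists>x\<in>set xs. P x \<Longrightarrow> P (hd (filter P xs)) \<and> hd (filter P xs) \<in> set xs"
  by (induction xs) auto

lemma shortest_ne: "finite S \<Longrightarrow> S \<noteq> {} \<Longrightarrow> \<exists>q\<in>S. q \<in> shortest D t S"
  using ex_is_arg_min_if_finite[of S "\<lambda>q. num_present (D q) t"]
  by (auto simp: shortest_def is_arg_min_linorder)

lemma target_in: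
  assumes "regular n z"
  shows "hd (filter (\<lambda>q. q \<in> shortest D t (set (dec_list (z (Sample k))))) (dec_list (z (Priority k))))
         \<in> set (dec_list (z (Sample k)))" (is "hd (filter ?P ?p) \<in> ?S")
    and "hd (filter (\<lambda>q. q \<in> shortest D t (set (dec_list (z (Sample k))))) (dec_list (z (Priority k)))) < n"
proof -
  have "?S \<noteq> {}" "?S \<subseteq> set ?p" "set ?p = {..<n}"
    using assms by (auto simp: regular_def)
  then obtain q where "q \<in> ?S" "?P q" "q \<in> set ?p"
    using shortest_ne[of ?S D t] by auto
  then show "hd (filter ?P ?p) \<in> ?S" "hd (filter ?P ?p) < n"
    using hd_filter_in[of ?p ?P] \<open>set ?p = {..<n}\<close> by (auto simp: shortest_def)
qed

text \<open>Later applied to a realisation and its coded copy, which share the services only of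
  servers \<open>q < n\<close>. Every job is sent below \<open>n\<close>, so the other servers
  cannot influence these.\<close>

lemma departures_cong:
  assumes "init w = init w'" "gap w = gap w'" "sample w = sample w'" "priority w = priority w'"
    and "\<And>q m. q < n \<Longrightarrow> service w q m = service w' q m"
    and S: "\<And>k. sample w' k \<noteq> {}" "\<And>k. sample w' k \<subseteq> {..<n}" "\<And>k. set (priority w' k) = {..<n}"
  shows "q < n \<Longrightarrow> departures w k q = departures w' k q"
proof (induction k arbitrary: q)
  case 0
  then show ?case by (simp add: assms(1,5))
next
  case (Suc k)
  let ?S = "sample w' k" and ?t = "arrival_time w' k" and ?p = "priority w' k"
  have t: "arrival_time w k = ?t" by (simp add: arrival_time_def assms(2))
  have sh: "shortest (departures w k) ?t ?S = shortest (departures w' k) ?t ?S"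
  proof -
    have "departures w k q = departures w' k q" if "q \<in> ?S" for q
      using that S(2)[of k] by (intro Suc.IH) blast
    then show ?thesis by (simp add: shortest_def cong: conj_cong)
  qed
  define r where "r = hd (filter (\<lambda>q. q \<in> shortest (departures w' k) ?t ?S) ?p)"
  have "finite ?S" by (rule finite_subset[OF S(2)]) simp
  then obtain q0 where "q0 \<in> ?S" "q0 \<in> shortest (departures w' k) ?t ?S"
    using shortest_ne[OF _ S(1)] by blast
  then have "r < n"
    using S(2,3)[of k] hd_filter_in[of ?p "\<lambda>q. q \<in> shortest (departures w' k) ?t ?S"]
    unfolding r_def by auto
  have "departures w (Suc k) = (departures w k)(r := departures w k r @
      [Max (insert ?t (set (departures w k r))) + service w r (length (departures w k r))])"
    unfolding departures.simps Let_def t assms(3,4) sh r_def ..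
  moreover have "departures w' (Suc k) = (departures w' k)(r := departures w' k r @
      [Max (insert ?t (set (departures w' k r))) + service w' r (length (departures w' k r))])"
    unfolding departures.simps Let_def r_def ..
  ultimately show ?case
    using Suc.IH[OF \<open>r < n\<close>] Suc.IH[OF Suc.prems] assms(5)[OF \<open>r < n\<close>]
    by (cases "q = r") (simp_all del: departures.simps)
qed

section \<open>Departure times after the first event\<close>

lemma departures_Suc:
  "departures w (Suc k) =
     (let r = hd (filter (\<lambda>q. q \<in> shortest (departures w k) (arrival_time w k) (sample w k)) (priority w k))
      in (departures w k)(r := departures w k r @
        [Max (insert (arrival_time w k) (set (departures w k r))) + service w r (length (departures w k r))]))"
  by (simp add: Let_def)

lemma length_departures: "q < length (init w) \<Longrightarrow> init w ! q \<le> length (departures w k q)"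
  by (induction k) (auto simp: departures_Suc Let_def le_SucI simp del: departures.simps(2))

text \<open>After the first event the departure times at every server are those of the restarted
  system, translated by \<open>s\<close>, behind the departures \<open>pre q\<close> that have already occurred.\<close>

lemma departures_translate:
  assumes at: "\<And>k. arrival_time w (k0 + k) = s + arrival_time w' k"
    and at_ge: "\<And>k q. pre q = [s] \<Longrightarrow> 0 < arrival_time w' k"
    and same: "\<And>k. sample w (k0 + k) = sample w' k" "\<And>k. priority w (k0 + k) = priority w' k"
    and sub: "\<And>k. sample w' k \<subseteq> {..<n}"
    and target: "\<And>D t k. hd (filter (\<lambda>q. q \<in> shortest D t (sample w' k)) (priority w' k)) < n"
    and pre: "\<And>q. pre q = [] \<or> pre q = [s]"
    and srv: "\<And>q l. q < n \<Longrightarrow> init w' ! q \<le> l \<Longrightarrow> service w' q l = service w q (length (pre q) + l)"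
    and init: "length (init w') = n"
    and base: "\<And>q. q < n \<Longrightarrow> departures w k0 q = pre q @ map ((+) s) (departures w' 0 q)"
  shows "q < n \<Longrightarrow> departures w (k0 + k) q = pre q @ map ((+) s) (departures w' k q)"
proof (induction k arbitrary: q)
  case 0
  then show ?case using base by simp
next
  case (Suc k)
  let ?S = "sample w' k" and ?t = "arrival_time w' k" and ?p = "priority w' k"
  have np: "num_present (departures w (k0 + k) q) (s + ?t) = num_present (departures w' k q) ?t" if "q < n" for q
    using Suc.IH[OF that] pre[of q] at_ge[of q k] num_present_map[of s "departures w' k q" ?t]
    by (auto simp: num_present_def simp del: num_present_map)
  have sh: "shortest (departures w (k0 + k)) (s + ?t) ?S = shortest (departures w' k) ?t ?S"
    using np sub[of k] by (auto simp: shortest_def subset_iff simp del: departures.simps)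
  define r where "r = hd (filter (\<lambda>q. q \<in> shortest (departures w' k) ?t ?S) ?p)"
  have r: "r < n" unfolding r_def by (rule target)
  have dw: "departures w (Suc (k0 + k)) = (departures w (k0 + k))(r := departures w (k0 + k) r @
      [Max (insert (s + ?t) (set (departures w (k0 + k) r))) + service w r (length (departures w (k0 + k) r))])"
    unfolding departures_Suc[of w "k0 + k"] at same sh r_def Let_def ..
  have dw': "departures w' (Suc k) = (departures w' k)(r := departures w' k r @
      [Max (insert ?t (set (departures w' k r))) + service w' r (length (departures w' k r))])"
    unfolding departures_Suc[of w' k] r_def Let_def ..
  note D = Suc.IH[OF r]
  \<comment> \<open>The new job follows all initial jobs of the restarted system, so it reads a
    service from which no elapsed time was subtracted.\<close>
  have "service w' r (length (departures w' k r)) = service w r (length (departures w (k0 + k) r))"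
    using srv[OF r] length_departures[of r w' k] r init by (simp add: D)
  moreover have "Max (insert (s + ?t) (set (departures w (k0 + k) r))) = s + Max (insert ?t (set (departures w' k r)))"
  proof -
    let ?A = "set (departures w' k r)"
    \<comment> \<open>A departure that has already happened, at time \<open>s\<close>, lies below
      the arrival time and cannot delay the new job.\<close>
    have "Max (insert s (insert (s + ?t) ((+) s ` ?A))) = Max (insert (s + ?t) ((+) s ` ?A))" if "s < s + ?t"
      using that by (subst Max_insert) (auto simp: max_def not_le intro: order.trans[OF less_imp_le Max_ge])
    moreover have "insert (s + ?t) (set (departures w (k0 + k) r)) =
        (if pre r = [s] then insert s (insert (s + ?t) ((+) s ` ?A)) else insert (s + ?t) ((+) s ` ?A))"
      unfolding D using pre[of r] by auto
    ultimately show ?thesis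
      using Max_insert_translate[of ?A s ?t] at_ge[of r k] by auto
  qed
  ultimately have new: "departures w (Suc (k0 + k)) r = pre r @ map ((+) s) (departures w' (Suc k) r)"
    unfolding dw dw' fun_upd_same by (simp only: D map_append list.map append_assoc add.assoc)
  show ?case
  proof (cases "q = r")
    case False
    then show ?thesis unfolding add_Suc_right dw dw' fun_upd_other[OF False] by (intro Suc.IH Suc.prems)
  qed (use new in \<open>simp only: add_Suc_right\<close>)
qed

text \<open>The first arriving job is appended by the recursion in the original system, but is an
  initial job of the restarted one, where departures are partial sums of services. The two agree
  because the chosen server either is idle or has all its departures after \<open>s\<close>.\<close>

lemma arrival_departures:
  fixes c z
  defines "n \<equiv> length c" and "w \<equiv> dat c z" and "s \<equiv> z (Gap 0)"
  defines "w' \<equiv> dat (step c (Gap 0) z) (shift c (Gap 0) s z)"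
  assumes reg: "regular n z" and first: "first_clock c z (Gap 0)"
  shows "q < n \<Longrightarrow> departures w (Suc k) q = map ((+) s) (departures w' k q)"
proof -
  define r where "r = choice c (set (dec_list (z (Sample 0)))) (dec_list (z (Priority 0)))"
  have s_less: "s < z (Service q 0)" if "q < n" "0 < c ! q" for q
    using first that by (auto simp: first_clock_def s_def n_def)
  have pos: "0 < z (Service q m)" if "q < n" for q m
    using reg that by (simp add: regular_def)
  have partial_ge: "z (Service q 0) \<le> (\<Sum>j\<le>m. z (Service q j))" if "q < n" for q m
    using pos[OF that] by (intro member_le_sum) (auto simp: less_imp_le)
  have np: "num_present (departures w 0 q) s = c ! q" if "q < n" for q
  proof -
    have "num_present (departures w 0 q) s = length (departures w 0 q)"
      using that partial_ge[OF that] s_less[OF that]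
      by (intro num_present_all) (auto simp: w_def intro: less_le_trans)
    then show ?thesis by (simp add: w_def)
  qed
  have sub: "set (dec_list (z (Sample k))) \<subseteq> {..<n}" for k
    using reg by (simp add: regular_def)
  have at0: "arrival_time w 0 = s" by (simp add: arrival_time_def w_def s_def)
  have r_eq: "hd (filter (\<lambda>q. q \<in> shortest (departures w 0) s (set (dec_list (z (Sample 0)))))
                (dec_list (z (Priority 0)))) = r"
    unfolding r_def by (intro choice_eq np) (use sub in auto)
  have rn: "r < n" using target_in(2)[OF reg] r_eq by metis
  have init': "init w' = c[r := Suc (c ! r)]"
    by (simp add: w'_def join_def Let_def r_def)
  have serv': "service w' q m = z (Service q m) - (if 0 < c ! q \<and> m = 0 then s else 0)" if "q < n" for q m
    using that by (auto simp: w'_def shift_def n_def)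
  have psum': "(\<Sum>j\<le>m. service w' q j) = (\<Sum>j\<le>m. z (Service q j)) - (if 0 < c ! q then s else 0)"
    if "q < n" for q m
    using that by (auto simp: serv' sum_subtractf)
  have at': "arrival_time w (Suc k) = s + arrival_time w' k" for k
    by (simp add: arrival_time_def w_def w'_def s_def shift_def sum.atMost_Suc_shift del: sum.atMost_Suc)
  have base: "departures w (Suc 0) q = [] @ map ((+) s) (departures w' 0 q)" if "q < n" for q
  proof -
    have 1: "departures w (Suc 0) = (departures w 0)(r := departures w 0 r @
        [Max (insert s (set (departures w 0 r))) + z (Service r (length (departures w 0 r)))])"
      using r_eq at0 by (simp add: departures_Suc Let_def w_def del: departures.simps)
    have d': "departures w' 0 q = map (\<lambda>m. (\<Sum>j\<le>m. z (Service q j)) - (if 0 < c ! q then s else 0))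
        [0..<init w' ! q]" if "q < n" for q
      using psum'[OF that] by simp
    show ?thesis
    proof (cases "q = r")
      case False
      then have "departures w (Suc 0) q = departures w 0 q" by (simp only: 1) simp
      then show ?thesis
        using False that by (simp only: d') (auto simp: w_def init')
    next
      case True
      note qr = this
      show ?thesis
      proof (cases "c ! r = 0")
        case True
        \<comment> \<open>An idle server: \<open>Service r 0\<close> is not a clock of
          \<open>c\<close>, so it enters the restarted system undiminished, and the service starts
          at \<open>s\<close>.\<close>
        have "departures w (Suc 0) r = [s + z (Service r 0)]"
          unfolding 1 using True by (simp add: w_def)
        moreover have "departures w' 0 r = [z (Service r 0)]"
          unfolding d'[OF rn] init' using True rn by (simp add: n_def)
        ultimately show ?thesis using qr by simp
      next
        case False
        then obtain l where l: "c ! r = Suc l" by (cases "c ! r") auto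
        have mono: "(\<Sum>j\<le>m. z (Service r j)) \<le> (\<Sum>j\<le>l. z (Service r j))" if "m \<le> l" for m
          using that pos[OF rn] by (intro sum_mono2) (auto simp: less_imp_le)
        have "s \<le> (\<Sum>j\<le>l. z (Service r j))"
          using s_less[OF rn] partial_ge[OF rn, of l] False by simp
        \<comment> \<open>A busy server: the new job starts at the last initial departure, which is
          not before \<open>s\<close>.\<close>
        then have "Max (insert s (set (departures w 0 r))) = (\<Sum>j\<le>l. z (Service r j))"
          using mono by (intro Max_eqI) (auto simp: w_def l)
        then have "departures w (Suc 0) r = departures w 0 r @ [(\<Sum>j\<le>Suc l. z (Service r j))]"
          unfolding 1 by (simp add: w_def l)
        also have "\<dots> = map ((+) s) (departures w' 0 r)"
          unfolding d'[OF rn] init' using rn False by (simp add: n_def w_def l)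
        finally show ?thesis using qr by simp
      qed
    qed
  qed
  assume q: "q < n"
  have "departures w (Suc 0 + k) q = [] @ map ((+) s) (departures w' k q)"
    using q
  proof (rule departures_translate[where pre = "\<lambda>_. []", rotated -1])
    show "arrival_time w (Suc 0 + k) = s + arrival_time w' k" for k
      using at'[of k] by simp
    show "sample w (Suc 0 + k) = sample w' k" "priority w (Suc 0 + k) = priority w' k" "sample w' k \<subseteq> {..<n}" for k
      using sub[of "Suc k"] by (simp_all add: w_def w'_def shift_def)
    show "hd (filter (\<lambda>q. q \<in> shortest D t (sample w' k)) (priority w' k)) < n" for D t k
      using target_in(2)[OF reg, of D t "Suc k"] by (simp add: w'_def shift_def)
    show "service w' q l = service w q (length [] + l)" if "q < n" "init w' ! q \<le> l" for q l
    proof -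
      have "c ! q \<le> init w' ! q" using that(1) by (cases "q = r") (auto simp: init' n_def)
      then show ?thesis using that by (auto simp: serv' w_def)
    qed
    show "length (init w') = n" by (simp add: init' n_def)
  qed (simp_all only: base not_Cons_self2 simp_thms list.distinct)
  then show "departures w (Suc k) q = map ((+) s) (departures w' k q)" by (simp only: append_Nil add_Suc add_0)
qed

text \<open>No arrival has been used up, so the jobs keep their numbers. At \<open>q0\<close> the
  job that left at time \<open>s\<close> is gone and the service indices move by one.\<close>

lemma departure_departures:
  fixes c z q0
  defines "n \<equiv> length c" and "w \<equiv> dat c z" and "s \<equiv> z (Service q0 0)"
  defines "w' \<equiv> dat (step c (Service q0 0) z) (shift c (Service q0 0) s z)"
  assumes reg: "regular n z" and first: "first_clock c z (Service q0 0)"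
  shows "q < n \<Longrightarrow> departures w k q = (if q = q0 then [s] else []) @ map ((+) s) (departures w' k q)"
proof -
  have q0: "q0 < n" "0 < c ! q0" using first by (auto simp: first_clock_def n_def)
  have s_gap: "s < z (Gap 0)" using first by (auto simp: first_clock_def s_def)
  have pos: "0 < z (Gap k)" for k
    using reg by (simp add: regular_def)
  have sub: "set (dec_list (z (Sample k))) \<subseteq> {..<n}" for k
    using reg by (simp add: regular_def)
  have init': "init w' = c[q0 := c ! q0 - 1]"
    by (simp add: w'_def)
  have serv0: "service w' q0 m = z (Service q0 (Suc m))" for m
    using q0 by (auto simp: w'_def shift_def n_def)
  have serv': "service w' q m = z (Service q m) - (if 0 < c ! q \<and> m = 0 then s else 0)" if "q < n" "q \<noteq> q0" for q m
    using that by (auto simp: w'_def shift_def n_def)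
  have psum': "(\<Sum>j\<le>m. service w' q j) = (\<Sum>j\<le>m. z (Service q j)) - (if 0 < c ! q then s else 0)"
    if "q < n" "q \<noteq> q0" for q m
    using that by (auto simp: serv' sum_subtractf)
  have psum0: "s + (\<Sum>j\<le>m. service w' q0 j) = (\<Sum>j\<le>Suc m. z (Service q0 j))" for m
    by (simp add: serv0 s_def sum.atMost_Suc_shift del: sum.atMost_Suc)
  have at': "arrival_time w k = s + arrival_time w' k" for k
  proof -
    have "arrival_time w' k = (\<Sum>j\<le>k. z (Gap j) - (if j = 0 then s else 0))"
      by (simp add: arrival_time_def w'_def shift_def)
    then show ?thesis by (simp add: arrival_time_def w_def sum_subtractf)
  qed
  have at_ge: "s < arrival_time w k" for k
  proof -
    have "z (Gap 0) \<le> arrival_time w k"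
      unfolding arrival_time_def w_def using pos less_imp_le by (auto intro!: member_le_sum)
    then show ?thesis using s_gap by simp
  qed
  have base: "departures w 0 q = (if q = q0 then [s] else []) @ map ((+) s) (departures w' 0 q)" if "q < n" for q
  proof -
    show ?thesis
    proof (cases "q = q0")
      case True
      obtain l where l: "c ! q0 = Suc l" using q0 by (cases "c ! q0") auto
      have "departures w 0 q0 = map (\<lambda>m. \<Sum>j\<le>m. z (Service q0 j)) [0..<Suc l]"
        by (simp add: w_def l del: upt_Suc)
      also have "\<dots> = s # map (\<lambda>m. \<Sum>j\<le>Suc m. z (Service q0 j)) [0..<l]"
        unfolding map_upt_Suc by (simp add: s_def)
      also have "\<dots> = s # map ((+) s) (departures w' 0 q0)"
        using q0 by (simp add: init' l n_def psum0[symmetric] del: sum.atMost_Suc)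
      finally show ?thesis using True by simp
    next
      case False
      then show ?thesis using that psum'[OF that False] by (auto simp: w_def init')
    qed
  qed
  assume q: "q < n"
  have "departures w (0 + k) q = (if q = q0 then [s] else []) @ map ((+) s) (departures w' k q)"
    using q
  proof (rule departures_translate[rotated -1])
    show "arrival_time w (0 + k) = s + arrival_time w' k" "0 < arrival_time w' k" for k
      using at'[of k] at_ge[of k] by simp_all
    show "sample w (0 + k) = sample w' k" "priority w (0 + k) = priority w' k" "sample w' k \<subseteq> {..<n}" for k
      using sub[of k] by (simp_all add: w_def w'_def shift_def)
    show "hd (filter (\<lambda>q. q \<in> shortest D t (sample w' k)) (priority w' k)) < n" for D t k
      using target_in(2)[OF reg, of D t k] by (simp add: w'_def shift_def)
    show "service w' q l = service w q (length (if q = q0 then [s] else []) + l)" if "q < n" "init w' ! q \<le> l" for q l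
      using that by (cases "q = q0") (auto simp: serv0 serv' init' w_def)
    show "length (init w') = n" by (simp add: init' n_def)
  qed (simp_all add: base del: departures.simps)
  then show "departures w k q = (if q = q0 then [s] else []) @ map ((+) s) (departures w' k q)" by (simp only: add_0)
qed

section \<open>The event-driven recursion\<close>

lemma length_join [simp]: "length (join c a b) = length c"
  by (simp add: join_def Let_def)

lemma length_step [simp]: "length (step c i z) = length c"
  by (cases "(c, i, z)" rule: step.cases) auto

lemma choice_minimal:
  fixes c :: "nat list"
  assumes "l \<noteq> []" "set l \<subseteq> set p"
  defines "q \<equiv> choice c (set l) p"
  shows "q \<in> set l" "q \<in> set p" "\<forall>q'\<in>set l. c ! q \<le> c ! q'"
proof -
  have "\<exists>q\<in>set p. q \<in> set l \<and> (\<forall>q'\<in>set l. c ! q \<le> c ! q')"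
    using assms ex_is_arg_min_if_finite[of "set l" "(!) c"] by (auto simp: is_arg_min_linorder)
  from hd_filter_in[OF this] show "q \<in> set l" "q \<in> set p" "\<forall>q'\<in>set l. c ! q \<le> c ! q'"
    by (simp_all add: q_def choice_def)
qed

lemma sum_list_join:
  assumes "regular (length c) z"
  shows "sum_list (join c (z (Sample 0)) (z (Priority 0))) = Suc (sum_list c)"
proof -
  have "choice c (set (dec_list (z (Sample 0)))) (dec_list (z (Priority 0))) < length c"
    using assms choice_minimal(2)[of "dec_list (z (Sample 0))" "dec_list (z (Priority 0))" c]
    by (auto simp: regular_def)
  then show ?thesis
    by (simp add: join_def Let_def sum_list_update)
qed

lemma first_clock_pos: "regular (length c) z \<Longrightarrow> first_clock c z i \<Longrightarrow> 0 < z i"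
  unfolding first_clock_def by (auto elim!: clocks_cases simp: regular_def)

text \<open>\<open>advance\<close> never returns the clock that fired, so any clock it returns rings
  strictly later. This keeps the remaining times positive after the subtraction.\<close>

lemma advance_clock_gt:
  assumes "first_clock c z i" "advance i x \<in> clocks c"
  shows "z i < z (advance i x)"
proof -
  have "advance i x \<noteq> i"
    using assms by (cases "(i, x)" rule: advance.cases) (auto simp: first_clock_def split: if_splits)
  then show ?thesis using assms by (auto simp: first_clock_def)
qed

lemma arrival_time_gap:
  "arrival_time (dat c z) 0 = z (Gap 0)"
  "arrival_time (dat c z) (Suc k) = z (Gap 0) +
     arrival_time (dat (step c (Gap 0) z) (shift c (Gap 0) s z)) k"
  by (simp_all add: arrival_time_def shift_def sum.atMost_Suc_shift del: sum.atMost_Suc)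

lemma arrival_time_service:
  "arrival_time (dat c z) k = s + arrival_time (dat (step c (Service q m) z) (shift c (Service q m) s z)) k"
proof -
  have "arrival_time (dat (step c (Service q m) z) (shift c (Service q m) s z)) k =
      (\<Sum>j\<le>k. z (Gap j) - (if j = 0 then s else 0))"
    by (simp add: arrival_time_def shift_def)
  then show ?thesis by (simp add: arrival_time_def sum_subtractf)
qed

lemma finite_arrivals:
  "regular n z \<Longrightarrow> finite {k. arrival_time (dat c z) k \<le> t}"
  by (simp add: regular_def arrival_time_def)

lemma regular_shift:
  assumes "regular (length c) z" "first_clock c z i"
  shows "regular (length c) (shift c i (z i) z)"
proof -
  let ?z' = "shift c i (z i) z"
  have pos: "0 < ?z' x" if "x \<in> sources (length c)" "0 < z (advance i x)" for x
    using that advance_clock_gt[OF assms(2), of x] by (auto simp: shift_def)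
  have i: "i \<in> clocks c" using assms by (simp add: first_clock_def)
  have fin: "finite {k. arrival_time (dat (step c i z) ?z') k \<le> t}" for t
    using i
  proof (cases rule: clocks_cases)
    case 1
    have "Suc ` {k. arrival_time (dat (step c i z) ?z') k \<le> t} \<subseteq> {k. arrival_time (dat c z) k \<le> z (Gap 0) + t}"
      using arrival_time_gap(2)[of c z _ "z (Gap 0)"] 1 by auto
    then have "finite (Suc ` {k. arrival_time (dat (step c i z) ?z') k \<le> t})"
      using finite_arrivals[OF assms(1)] finite_subset by blast
    then show ?thesis by (simp add: finite_image_iff)
  next
    case (2 q)
    have "{k. arrival_time (dat (step c i z) ?z') k \<le> t} = {k. arrival_time (dat c z) k \<le> z i + t}"
      using arrival_time_service[of c z _ "z i" q 0] 2 by auto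
    then show ?thesis using finite_arrivals[OF assms(1)] by simp
  qed
  show ?thesis
    using i
  proof (cases rule: clocks_cases)
    case 1
    then show ?thesis
      using assms(1) fin unfolding regular_def
      by (intro conjI allI impI pos) (auto simp: shift_def arrival_time_def)
  next
    case (2 q)
    then show ?thesis
      using assms(1) fin unfolding regular_def
      by (intro conjI allI impI pos) (auto simp: shift_def arrival_time_def)
  qed
qed

context
  fixes c z i s
  assumes reg: "regular (length c) z" and first: "first_clock c z i"
    and s_def: "s = z i"
begin

lemma arrivals_restart:
  assumes "0 \<le> t"
  shows "arrivals (dat c z) (s + t) = (if i = Gap 0 then Suc else id) (arrivals (dat (step c i z) (shift c i s z)) t)"
proof -
  have "i \<in> clocks c" using first by (simp add: first_clock_def)
  then show ?thesis
  proof (cases rule: clocks_cases)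
    case 1
    have fin: "finite {k. arrival_time (dat (step c i z) (shift c i s z)) k \<le> t}"
      using finite_arrivals[OF regular_shift[OF reg first]] s_def by simp
    have "{k. arrival_time (dat c z) k \<le> s + t} = insert 0 (Suc ` {k. arrival_time (dat (step c i z) (shift c i s z)) k \<le> t})"
    proof (rule set_eqI)
      fix k show "k \<in> {k. arrival_time (dat c z) k \<le> s + t} \<longleftrightarrow> k \<in> insert 0 (Suc ` {k. arrival_time (dat (step c i z) (shift c i s z)) k \<le> t})"
        using assms 1 s_def by (cases k) (auto simp: arrival_time_gap(1) arrival_time_gap(2)[of c z _ s])
    qed
    then show ?thesis
      using 1 fin by (simp add: arrivals_def card_insert_if card_image)
  next
    case (2 q)
    then show ?thesis
      using arrival_time_service[of c z _ s q 0] by (simp add: arrivals_def)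
  qed
qed

lemma queue_length_restart:
  assumes "0 \<le> t" "q < length c"
  shows "queue_length (dat c z) q (s + t) = queue_length (dat (step c i z) (shift c i s z)) q t"
proof -
  have "i \<in> clocks c" using first by (simp add: first_clock_def)
  then show ?thesis
  proof (cases rule: clocks_cases)
    case 1
    then have "departures (dat c z) (Suc k) q = map ((+) s) (departures (dat (step c i z) (shift c i s z)) k q)" for k
      using arrival_departures[OF reg, of q k] assms(2) first s_def by simp
    then show ?thesis
      using 1 by (simp add: queue_length_def arrivals_restart[OF assms(1)] del: departures.simps)
  next
    case (2 q0)
    then have "departures (dat c z) k q = (if q = q0 then [s] else []) @ map ((+) s) (departures (dat (step c i z) (shift c i s z)) k q)" for k
      using departure_departures[OF reg, of q0 q k] assms(2) first s_def by simp
    then show ?thesis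
      using 2 assms(1) num_present_map[of s _ t]
      by (simp add: queue_length_def arrivals_restart[OF assms(1)] num_present_def del: departures.simps)
  qed
qed

lemma before_first_clock:
  assumes "t < s" "q < length c"
  shows "arrivals (dat c z) t = 0" "queue_length (dat c z) q t = c ! q"
proof -
  have le: "s \<le> z j" if "j \<in> clocks c" for j
    using first that s_def by (cases "j = i") (auto simp: first_clock_def less_imp_le)
  have "z (Gap 0) \<le> arrival_time (dat c z) k" for k
    using reg unfolding arrival_time_def by (auto simp: regular_def less_imp_le intro!: member_le_sum)
  then have "t < arrival_time (dat c z) k" for k
    using assms(1) le[of "Gap 0"] by (smt (verit) clocks_simps(2))
  then have "{k. arrival_time (dat c z) k \<le> t} = {}" by (auto simp: not_le)
  then show *: "arrivals (dat c z) t = 0" by (simp add: arrivals_def)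
  have "t < (\<Sum>j\<le>m. z (Service q j))" if "0 < c ! q" for m
  proof -
    have "z (Service q 0) \<le> (\<Sum>j\<le>m. z (Service q j))"
      using reg assms(2) by (intro member_le_sum) (auto simp: regular_def less_imp_le)
    then show ?thesis using assms le[of "Service q 0"] that by simp
  qed
  then have "num_present (departures (dat c z) 0 q) t = length (departures (dat c z) 0 q)"
    by (intro num_present_all) auto
  then show "queue_length (dat c z) q t = c ! q"
    by (simp add: queue_length_def *)
qed

text \<open>One is added on both sides so that a departure needs no truncated subtraction.\<close>

lemma sum_list_step:
  "sum_list (step c i z) + 1 = (if i = Gap 0 then sum_list c + 2 else sum_list c)"
proof -
  have "i \<in> clocks c" using first by (simp add: first_clock_def)
  then show ?thesis
  proof (cases rule: clocks_cases)
    case 1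
    then show ?thesis using sum_list_join[OF reg] by simp
  next
    case (2 q)
    then have "c ! q \<le> sum_list c" by (simp add: elem_le_sum_list)
    with 2 show ?thesis by (simp add: sum_list_update)
  qed
qed

end

lemma ex_first_clock:
  assumes "\<not> tie c z"
  shows "\<exists>i. first_clock c z i"
proof -
  have "clocks c \<noteq> {}" by (auto simp: clocks_def)
  then obtain i where "is_arg_min z (\<lambda>x. x \<in> clocks c) i"
    using ex_is_arg_min_if_finite[of "clocks c" z] by auto
  then have "first_clock c z i"
    using assms unfolding first_clock_def tie_def is_arg_min_linorder by (metis DiffE less_eq_real_def singletonI)
  then show ?thesis ..
qed

section \<open>Level crossings of the number of jobs and the recursion\<close>

abbreviation hit :: "nat \<Rightarrow> nat list \<Rightarrow> (source \<Rightarrow> real) \<Rightarrow> bool" where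
  "hit K \<equiv> \<lambda>c z. K \<le> sum_list c"

definition total_jobs :: "nat \<Rightarrow> jsq_data \<Rightarrow> real \<Rightarrow> nat" where
  "total_jobs n w t = (\<Sum>q<n. queue_length w q t)"

lemma total_jobs_initially:
  assumes "regular (length c) z" "first_clock c z i" "t < z i"
  shows "total_jobs (length c) (dat c z) t = sum_list c"
  using before_first_clock(2)[OF assms(1,2) refl assms(3)]
  by (simp add: total_jobs_def sum_list_sum_nth atLeast0LessThan)

text \<open>The absence of ties supplies a first clock in every state visited, and until it rings
  the queue lengths are those of the state.\<close>

lemma reach_imp_total:
  assumes "reach (hit K) k c z T" "regular (length c) z" "0 \<le> T" "\<And>k. \<not> reach tie k c z T"
  shows "\<exists>t\<in>{0..T}. K \<le> total_jobs (length c) (dat c z) t"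
  using assms
proof (induction k arbitrary: c z T)
  case 0
  obtain i where "first_clock c z i" using ex_first_clock 0(4)[of 0] by auto
  then show ?case
    using total_jobs_initially[OF 0(2)] first_clock_pos[OF 0(2)] 0(1,3) by (intro bexI[of _ 0]) auto
next
  case (Suc k)
  show ?case
  proof (cases "hit K c z")
    case True
    obtain i where "first_clock c z i" using ex_first_clock Suc.prems(4)[of 0] by auto
    then show ?thesis
      using total_jobs_initially[OF Suc.prems(2)] first_clock_pos[OF Suc.prems(2)] Suc.prems(3) True
      by (intro bexI[of _ 0]) auto
  next
    case False
    then obtain i where i: "first_clock c z i" "z i \<le> T"
      "reach (hit K) k (step c i z) (shift c i (z i) z) (T - z i)"
      using Suc.prems(1) by auto
    have "\<not> reach tie k (step c i z) (shift c i (z i) z) (T - z i)" for k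
      using Suc.prems(4)[of "Suc k"] i by auto
    then obtain t where "t \<in> {0..T - z i}"
      "K \<le> total_jobs (length c) (dat (step c i z) (shift c i (z i) z)) t"
      using Suc.IH[OF i(3)] regular_shift[OF Suc.prems(2) i(1)] i(2) by auto
    moreover from this have "total_jobs (length c) (dat c z) (z i + t) =
        total_jobs (length c) (dat (step c i z) (shift c i (z i) z)) t"
      using queue_length_restart[OF Suc.prems(2) i(1) refl] by (simp add: total_jobs_def)
    ultimately show ?thesis
      using first_clock_pos[OF Suc.prems(2) i(1)] by (intro bexI[of _ "z i + t"]) auto
  qed
qed

lemma total_imp_reach:
  assumes "K \<le> total_jobs (length c) (dat c z) t" "regular (length c) z" "0 \<le> t" "t \<le> T"
    "\<And>k. \<not> reach tie k c z T"
  shows "\<exists>k. reach (hit K) k c z T"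
  using assms
\<comment> \<open>This measure decreases at each event: an arrival adds one job but uses up one of
  the arrivals, which count twice; a departure removes a job.\<close>
proof (induction "sum_list c + 2 * arrivals (dat c z) t" arbitrary: c z T t rule: less_induct)
  case less
  note reg = less.prems(2)
  have "\<not> tie c z" using less.prems(5)[of 0] by simp
  then obtain i where i: "first_clock c z i" using ex_first_clock by blast
  show ?case
  proof (cases "t < z i")
    case True
    then have "total_jobs (length c) (dat c z) t = sum_list c"
      by (rule total_jobs_initially[OF reg i])
    then show ?thesis using less.prems(1) by (intro exI[of _ 0]) simp
  next
    case False
    let ?c' = "step c i z" and ?z' = "shift c i (z i) z" and ?t' = "t - z i"
    have tot: "total_jobs (length c) (dat ?c' ?z') ?t' = total_jobs (length c) (dat c z) t"
      using queue_length_restart[OF reg i refl, of ?t'] False by (simp add: total_jobs_def)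
    have "\<exists>k. reach (hit K) k ?c' ?z' (T - z i)"
    proof (rule less.hyps)
      show "sum_list ?c' + 2 * arrivals (dat ?c' ?z') ?t' < sum_list c + 2 * arrivals (dat c z) t"
        using sum_list_step[OF reg i refl] arrivals_restart[OF reg i refl, of ?t'] False
        by (auto split: if_splits)
      show "\<not> reach tie k ?c' ?z' (T - z i)" for k
        using less.prems(4) less.prems(5)[of "Suc k"] i False by auto
    qed (use less.prems tot False regular_shift[OF reg i] in auto)
    then obtain k where "reach (hit K) k ?c' ?z' (T - z i)" ..
    then have "reach (hit K) (Suc k) c z T"
      using i False less.prems(4) by auto
    then show ?thesis ..
  qed
qed

section \<open>Memorylessness and the maximal inequality\<close>

lemma exponential_shift:
  fixes l s :: real
  assumes l: "0 < l" and s: "0 \<le> s" and [measurable]: "A \<in> sets borel"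
  shows "emeasure (density lborel (exponential_density l)) {y. s < y \<and> y - s \<in> A} =
    ennreal (exp (- l * s)) * emeasure (density lborel (exponential_density l)) A"
proof -
  have "emeasure (density lborel (exponential_density l)) {y. s < y \<and> y - s \<in> A} =
      (\<integral>\<^sup>+y. ennreal (exponential_density l y) * indicator {y. s < y \<and> y - s \<in> A} y \<partial>lborel)"
    by (rule emeasure_density) auto
  also have "\<dots> = (\<integral>\<^sup>+y. ennreal (exponential_density l (s + 1 * y)) * indicator {y. s < y \<and> y - s \<in> A} (s + 1 * y) \<partial>lborel)"
    by (subst nn_integral_real_affine[where c = 1 and t = s]) auto
  also have "\<dots> = (\<integral>\<^sup>+y. ennreal (exp (- l * s)) * (ennreal (exponential_density l y) * indicator A y) \<partial>lborel)"
  proof (rule nn_integral_cong_AE)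
    \<comment> \<open>At \<open>y = 0\<close> the strict inequality on the left fails while the
      density on the right is \<open>l\<close>; this null point is left out.\<close>
    have "ennreal (exponential_density l (s + 1 * y)) * indicator {y. s < y \<and> y - s \<in> A} (s + 1 * y) =
        ennreal (exp (- l * s)) * (ennreal (exponential_density l y) * indicator A y)" if "y \<noteq> 0" for y
      using that s l
      by (auto simp: exponential_density_def indicator_def ennreal_mult[symmetric] exp_add[symmetric] algebra_simps)
    then show "AE y in lborel. ennreal (exponential_density l (s + 1 * y)) * indicator {y. s < y \<and> y - s \<in> A} (s + 1 * y) =
        ennreal (exp (- l * s)) * (ennreal (exponential_density l y) * indicator A y)"
      by (rule AE_mp[OF AE_lborel_singleton[of "0::real"] AE_I2, OF impI])
  qed
  also have "\<dots> = ennreal (exp (- l * s)) * emeasure (density lborel (exponential_density l)) A"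
    by (subst nn_integral_cmult) (auto simp: emeasure_density)
  finally show ?thesis .
qed

text \<open>As a map of coordinates, \<open>advance i\<close> is injective and omits
  \<open>i\<close>: the restarted system reads distinct, hence independent, sources, and never the
  clock that fired. Clocks still running stay in place.\<close>

lemma advance_in_clocks:
  assumes "i \<in> clocks c"
  shows "advance i x \<in> clocks c \<longleftrightarrow> x \<in> clocks c - {i}"
    and "x \<in> clocks c - {i} \<Longrightarrow> advance i x = x"
    and "advance i x \<noteq> i"
    and "x \<in> sources n \<Longrightarrow> advance i x \<in> sources n"
    and "inj (advance i)"
proof -
  have *: "advance i x = advance i y \<Longrightarrow> x = y" for x y
    using assms by (rule clocks_cases; cases x; cases y; auto split: if_splits)
  then show "inj (advance i)" by (rule injI)
qed (use assms in \<open>(rule clocks_cases; cases x; auto)+\<close>)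

fun rate :: "real \<Rightarrow> source \<Rightarrow> real" where
  "rate R (Gap k) = R"
| "rate R _ = 1"

text \<open>What restarting requires: exponential clocks, and laws of samples and priorities that do
  not depend on the job, so that dropping the first job preserves them.\<close>

locale jsq_law =
  fixes n :: nat and R :: real and \<nu> :: "source \<Rightarrow> real measure"
  assumes R_pos: "0 < R"
    and law_gap: "\<nu> (Gap k) = density lborel (exponential_density R)"
    and law_service: "\<nu> (Service q m) = density lborel (exponential_density 1)"
    and law_sample: "\<nu> (Sample k) = \<nu> (Sample 0)"
    and law_priority: "\<nu> (Priority k) = \<nu> (Priority 0)"
    and law_prob: "prob_space (\<nu> x)"
    and law_sets [measurable_cong]: "sets (\<nu> x) = sets borel"
begin

definition \<mu> :: "(source \<Rightarrow> real) measure" where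
  "\<mu> = PiM (sources n) \<nu>"

sublocale P: product_prob_space \<nu> "sources n"
  by (intro product_prob_spaceI law_prob)

lemma prob_space_mu: "prob_space \<mu>"
  unfolding \<mu>_def by (rule prob_space_PiM) (rule law_prob)

lemma sets_mu [measurable_cong]: "sets \<mu> = sets (PiM (sources n) (\<lambda>_. borel))"
  unfolding \<mu>_def by (intro sets_PiM_cong law_sets refl)

lemma space_nu [simp]: "space (\<nu> x) = UNIV"
  using law_sets[THEN sets_eq_imp_space_eq] by simp

lemma space_mu: "space \<mu> = extensional (sources n)"
  by (simp add: \<mu>_def space_PiM PiE_UNIV_domain PiE_def Pi_def)

lemma component_measurable: "x \<in> sources n \<Longrightarrow> (\<lambda>z. z x) \<in> borel_measurable \<mu>"
  by (subst measurable_cong_sets[OF sets_mu refl]) (rule measurable_component_singleton)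

lemma law_advance: "\<nu> (advance i x) = \<nu> x"
proof -
  have "\<nu> (Sample (Suc k)) = \<nu> (Sample k)" "\<nu> (Priority (Suc k)) = \<nu> (Priority k)" for k
    by (metis law_sample, metis law_priority)
  then show ?thesis
    by (cases "(i, x)" rule: advance.cases) (simp_all add: law_gap law_service)
qed

lemma law_clock: "i \<in> clocks c \<Longrightarrow> \<nu> i = density lborel (exponential_density (rate R i))"
  by (erule clocks_cases) (auto simp: law_gap law_service)

lemma rate_pos: "0 < rate R x"
  using R_pos by (cases x) auto

lemma shift_measurable [measurable]:
  assumes "length c = n" "i \<in> clocks c"
  shows "(\<lambda>(s, z). shift c i s z) \<in> measurable (borel \<Otimes>\<^sub>M \<mu>) \<mu>"
proof -
  have [measurable]: "(\<lambda>z. z (advance i x)) \<in> borel_measurable \<mu>" if "x \<in> sources n" for x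
    using advance_in_clocks(4)[OF assms(2) that] by measurable
  have "(\<lambda>(s, z). shift c i s z) \<in> measurable (borel \<Otimes>\<^sub>M \<mu>) (PiM (sources n) (\<lambda>_. borel))"
    unfolding shift_def assms(1) split_beta' by (intro measurable_restrict) measurable
  also have "measurable (borel \<Otimes>\<^sub>M \<mu>) (PiM (sources n) (\<lambda>_. borel)) = measurable (borel \<Otimes>\<^sub>M \<mu>) \<mu>"
    by (intro measurable_cong_sets) (auto simp: sets_mu)
  finally show ?thesis .
qed

text \<open>Overwriting one coordinate by an independent value of its own law preserves the product
  measure. It serves as Fubini's theorem for one coordinate of an infinite product: in the inner
  integral that coordinate is the constant \<open>y\<close>.\<close>

lemma resample:
  assumes "x \<in> sources n" and F: "F \<in> borel_measurable \<mu>"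
  shows "(\<integral>\<^sup>+z. F z \<partial>\<mu>) = (\<integral>\<^sup>+y. (\<integral>\<^sup>+z. F (fun_upd z x y) \<partial>\<mu>) \<partial>\<nu> x)"
proof -
  have ins: "insert x (sources n) = sources n" using assms by auto
  interpret mu: prob_space \<mu> by (rule prob_space_mu)
  have meas: "(\<lambda>(y, z). fun_upd z x y) \<in> measurable (\<nu> x \<Otimes>\<^sub>M \<mu>) \<mu>"
    unfolding \<mu>_def split_beta'
    by (rule measurable_fun_upd[where J = "sources n"]) (use assms in auto)
  have "\<mu> = distr (\<nu> x \<Otimes>\<^sub>M \<mu>) \<mu> (\<lambda>(y, z). fun_upd z x y)"
    using distr_pair_PiM_eq_PiM[of "sources n" \<nu> x] law_prob by (simp add: \<mu>_def ins)
  then have "(\<integral>\<^sup>+z. F z \<partial>\<mu>) = (\<integral>\<^sup>+z. F z \<partial>distr (\<nu> x \<Otimes>\<^sub>M \<mu>) \<mu> (\<lambda>(y, z). fun_upd z x y))"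
    by simp
  also have "\<dots> = (\<integral>\<^sup>+p. F (fun_upd (snd p) x (fst p)) \<partial>(\<nu> x \<Otimes>\<^sub>M \<mu>))"
    by (subst nn_integral_distr) (use meas F in \<open>auto simp: split_beta'\<close>)
  also have "\<dots> = (\<integral>\<^sup>+y. (\<integral>\<^sup>+z. F (fun_upd z x y) \<partial>\<mu>) \<partial>\<nu> x)"
    by (subst mu.nn_integral_fst[symmetric])
       (use measurable_compose[OF meas F] in \<open>auto simp: split_beta'\<close>)
  finally show ?thesis .
qed

text \<open>Memorylessness for all sources at once. Both sides integrate \<open>f\<close> against a
  finite measure, so it suffices to compare these measures on cylinders. There the restarted system
  reads different coordinates of the original one; each clock still running contributes the factor
  exp (- s rate), and every other source keeps its law.\<close>

lemma restart_law:
  assumes len: "length c = n" and i: "i \<in> clocks c" and s: "0 \<le> s"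
    and f: "f \<in> borel_measurable \<mu>"
  shows "(\<integral>\<^sup>+z. (if \<forall>j\<in>clocks c - {i}. s < z j then f (shift c i s z) else 0) \<partial>\<mu>) =
    ennreal (exp (- s * (\<Sum>j\<in>clocks c - {i}. rate R j))) * (\<integral>\<^sup>+z. f z \<partial>\<mu>)"
proof -
  define C where "C = clocks c - {i}"
  define I where "I = sources n"
  define K where "K = ennreal (exp (- s * (\<Sum>j\<in>C. rate R j)))"
  define E where "E = {z \<in> space \<mu>. \<forall>j\<in>C. s < z j}"
  have clocks_I: "clocks c \<subseteq> I" using len by (auto simp: clocks_def I_def)
  have finC: "finite C" and CI: "C \<subseteq> I" using clocks_I by (auto simp: C_def)
  have [measurable]: "(\<lambda>z. z j) \<in> borel_measurable \<mu>" if "j \<in> C" for j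
    using CI that by (intro component_measurable) (auto simp: I_def)
  have E[measurable]: "E \<in> sets \<mu>"
    unfolding E_def using finC by measurable
  note [measurable] = shift_measurable[OF len i]
  have sh[measurable]: "shift c i s \<in> measurable \<mu> \<mu>" 
    using measurable_compose[OF measurable_Pair1'[of s borel \<mu>] shift_measurable[OF len i]] by simp
  define Q where "Q = distr (density \<mu> (indicator E)) \<mu> (shift c i s)"
  have "scale_measure K \<mu> = Q"
  proof (rule measure_eqI_PiM_infinite)
    show "sets (scale_measure K \<mu>) = PiM I \<nu>" "sets Q = PiM I \<nu>"
      by (simp_all add: Q_def \<mu>_def I_def)
    show "finite_measure (scale_measure K \<mu>)"
      using prob_space.emeasure_space_1[OF prob_space_mu]
      by (intro finite_measureI) (simp add: K_def space_scale_measure)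
    fix A J assume J: "finite J" "J \<subseteq> I" and A: "\<And>x. x \<in> J \<Longrightarrow> A x \<in> sets (\<nu> x)"
    define X where "X = prod_emb I \<nu> J (Pi\<^sub>E J A)"
    \<comment> \<open>The cylinder is enlarged by unrestricted factors over \<open>C\<close>, so
      that survival of these clocks beyond \<open>s\<close> also becomes a condition on its
      coordinates.\<close>
    define J' where "J' = J \<union> C"
    define A' where "A' = (\<lambda>x. if x \<in> J then A x else UNIV)"
    have A'_sets: "A' x \<in> sets (\<nu> x)" for x
      using A law_sets by (auto simp: A'_def)
    have J': "finite J'" "J' \<subseteq> I" using J finC CI by (auto simp: J'_def)
    have X_eq: "X = prod_emb I \<nu> J' (Pi\<^sub>E J' A')"
      using J by (auto simp: X_def prod_emb_def A'_def J'_def PiE_def Pi_def extensional_def restrict_def)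
    \<comment> \<open>The preimage of the cylinder is again a cylinder, over the image of
      \<open>advance i\<close>; its side at the source \<open>y\<close> is found through the inverse
      of \<open>advance i\<close>.\<close>
    define B where "B = (\<lambda>y. {r. r - (if y \<in> clocks c then s else 0) \<in> A' (inv (advance i) y) \<and>
        (y \<in> clocks c \<longrightarrow> s < r)})"
    note adv = advance_in_clocks[OF i]
    have inv: "inv (advance i) (advance i x) = x" for x
      by (rule inv_f_f[OF adv(5)])
    have B_eq: "B (advance i x) = (if x \<in> C then {r. s < r \<and> r - s \<in> A' x} else A' x)" for x
      using adv(1)[of x] by (auto simp: B_def inv C_def)
    have X_sets: "X \<in> sets \<mu>"
      unfolding X_def \<mu>_def I_def[symmetric] using J A by (intro sets_PiM_I) auto
    have "shift c i s -` X \<inter> space \<mu> \<inter> E = prod_emb I \<nu> (advance i ` J') (Pi\<^sub>E (advance i ` J') B)"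
    proof (intro set_eqI)
      fix z
      have "z \<in> shift c i s -` X \<inter> space \<mu> \<inter> E \<longleftrightarrow>
          z \<in> space \<mu> \<and> (\<forall>x\<in>J'. shift c i s z x \<in> A' x) \<and> (\<forall>j\<in>C. s < z j)"
        using J' by (auto simp: X_eq prod_emb_def E_def PiE_iff shift_def len I_def)
      also have "\<dots> \<longleftrightarrow> z \<in> space \<mu> \<and> (\<forall>x\<in>J'. z (advance i x) \<in> B (advance i x))"
      proof -
        have "shift c i s z x = z (advance i x) - (if x \<in> C then s else 0)" if "x \<in> J'" for x
          using that J' adv(1)[of x] by (auto simp: shift_def len I_def C_def)
        moreover have "x \<in> C \<Longrightarrow> advance i x = x" for x using adv(2) by (simp add: C_def)
        moreover have "C \<subseteq> J'" by (auto simp: J'_def)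
        ultimately show ?thesis by (auto simp: B_eq subset_iff split: if_splits)
      qed
      also have "\<dots> \<longleftrightarrow> z \<in> prod_emb I \<nu> (advance i ` J') (Pi\<^sub>E (advance i ` J') B)"
        using J' adv(4) by (auto simp: prod_emb_def PiE_iff space_mu I_def)
      finally show "z \<in> shift c i s -` X \<inter> space \<mu> \<inter> E \<longleftrightarrow>
          z \<in> prod_emb I \<nu> (advance i ` J') (Pi\<^sub>E (advance i ` J') B)" .
    qed
    moreover have "Q X = emeasure \<mu> (shift c i s -` X \<inter> space \<mu> \<inter> E)"
    proof -
      have S: "shift c i s -` X \<inter> space \<mu> \<in> sets \<mu>"
        using measurable_sets[OF sh X_sets] .
      have "Q X = emeasure (density \<mu> (indicator E)) (shift c i s -` X \<inter> space \<mu>)"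
        unfolding Q_def using X_sets sh by (subst emeasure_distr) auto
      also have "\<dots> = (\<integral>\<^sup>+z. indicator (shift c i s -` X \<inter> space \<mu> \<inter> E) z \<partial>\<mu>)"
        by (subst emeasure_density[OF borel_measurable_indicator[OF E] S],
            rule nn_integral_cong) (auto simp: indicator_def)
      also have "\<dots> = emeasure \<mu> (shift c i s -` X \<inter> space \<mu> \<inter> E)"
        using S E by (intro nn_integral_indicator) auto
      finally show ?thesis .
    qed
    ultimately have "Q X = emeasure \<mu> (prod_emb I \<nu> (advance i ` J') (Pi\<^sub>E (advance i ` J') B))"
      by simp
    also have "\<dots> = (\<Prod>y\<in>advance i ` J'. emeasure (\<nu> y) (B y))"
      unfolding \<mu>_def I_def
    proof (rule emeasure_PiM_emb)
      show "advance i ` J' \<subseteq> sources n" using J' adv(4) by (auto simp: I_def)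
      fix y assume "y \<in> advance i ` J'"
      then obtain x where "x \<in> J'" "y = advance i x" by auto
      then show "B y \<in> sets (\<nu> y)"
        using A'_sets[of x] by (simp add: B_eq law_sets)
    qed (use J' law_prob in auto)
    also have "\<dots> = (\<Prod>x\<in>J'. emeasure (\<nu> (advance i x)) (B (advance i x)))"
      using adv(5) by (subst prod.reindex) (auto intro: inj_on_subset)
    also have "\<dots> = (\<Prod>x\<in>J'. (if x \<in> C then ennreal (exp (- rate R x * s)) else 1) * emeasure (\<nu> x) (A' x))"
    proof (rule prod.cong[OF refl])
      fix x assume "x \<in> J'"
      show "emeasure (\<nu> (advance i x)) (B (advance i x)) =
        (if x \<in> C then ennreal (exp (- rate R x * s)) else 1) * emeasure (\<nu> x) (A' x)"
        using exponential_shift[OF rate_pos s, of "A' x" x] A'_sets[of x] law_clock[of x c]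
        by (auto simp: B_eq law_advance C_def law_sets)
    qed
    also have "\<dots> = (\<Prod>x\<in>J'. if x \<in> C then ennreal (exp (- rate R x * s)) else 1) * (\<Prod>x\<in>J'. emeasure (\<nu> x) (A' x))"
      by (rule prod.distrib)
    also have "(\<Prod>x\<in>J'. if x \<in> C then ennreal (exp (- rate R x * s)) else 1) = (\<Prod>x\<in>C. ennreal (exp (- rate R x * s)))"
      using J' by (subst prod.inter_restrict[symmetric]) (auto simp: J'_def intro!: prod.cong)
    also have "\<dots> = K"
      using finC by (simp add: K_def prod_ennreal exp_sum[symmetric] sum_distrib_left sum_negf mult.commute)
    also have "(\<Prod>x\<in>J'. emeasure (\<nu> x) (A' x)) = emeasure \<mu> X"
      unfolding X_eq \<mu>_def I_def using J' A'_sets law_prob by (intro emeasure_PiM_emb[symmetric]) (auto simp: I_def)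
    finally show "scale_measure K \<mu> (prod_emb I \<nu> J (Pi\<^sub>E J A)) = Q (prod_emb I \<nu> J (Pi\<^sub>E J A))"
      by (simp add: X_def)
  qed
  then have "K * (\<integral>\<^sup>+z. f z \<partial>\<mu>) = (\<integral>\<^sup>+z. f z \<partial>Q)"
    using f by (metis nn_integral_scale_measure)
  also have "\<dots> = (\<integral>\<^sup>+z. indicator E z * f (shift c i s z) \<partial>\<mu>)"
    unfolding Q_def using f sh E
    by (subst nn_integral_distr) (auto intro!: nn_integral_density)
  also have "\<dots> = (\<integral>\<^sup>+z. (if \<forall>j\<in>clocks c - {i}. s < z j then f (shift c i s z) else 0) \<partial>\<mu>)"
    by (intro nn_integral_cong) (auto simp: E_def C_def)
  finally show ?thesis by (simp add: K_def C_def)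
qed

end

section \<open>Measurability of the recursion\<close>

lemma pred_conj: "Measurable.pred M P \<Longrightarrow> Measurable.pred M Q \<Longrightarrow> Measurable.pred M (\<lambda>x. P x \<and> Q x)"
  by measurable

lemma pred_disj: "Measurable.pred M P \<Longrightarrow> Measurable.pred M Q \<Longrightarrow> Measurable.pred M (\<lambda>x. P x \<or> Q x)"
  by measurable

lemma pred_finite_ball:
  "finite I \<Longrightarrow> (\<And>i. i \<in> I \<Longrightarrow> Measurable.pred M (P i)) \<Longrightarrow> Measurable.pred M (\<lambda>x. \<forall>i\<in>I. P i x)"
  by measurable

lemma pred_finite_bex:
  "finite I \<Longrightarrow> (\<And>i. i \<in> I \<Longrightarrow> Measurable.pred M (P i)) \<Longrightarrow> Measurable.pred M (\<lambda>x. \<exists>i\<in>I. P i x)"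
  by measurable

lemma pred_less:
  fixes f g :: "'a \<Rightarrow> real"
  shows "f \<in> borel_measurable M \<Longrightarrow> g \<in> borel_measurable M \<Longrightarrow> Measurable.pred M (\<lambda>x. f x < g x)"
  by measurable

lemma dec_list_measurable [measurable]: "dec_list \<in> measurable borel (count_space UNIV)"
proof -
  have "(\<lambda>r::real. \<lfloor>r\<rfloor>) \<in> measurable borel (count_space UNIV)" by measurable
  from measurable_compose[OF this, of "\<lambda>z. from_nat (nat z)" "count_space UNIV"]
  show ?thesis by (simp add: dec_list_def[abs_def])
qed

lemma join_measurable [measurable (raw)]:
  assumes [measurable]: "a \<in> borel_measurable M" "b \<in> borel_measurable M"
  shows "(\<lambda>x. join c (a x) (b x)) \<in> measurable M (count_space UNIV)"
proof -
  have "(\<lambda>x. let q = choice c (set (dec_list (a x))) (dec_list (b x)) in c[q := Suc (c ! q)])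
      \<in> measurable M (count_space UNIV)"
    by (rule measurable_compose_countable[where g = "\<lambda>x. dec_list (a x)"],
        rule measurable_compose_countable[where g = "\<lambda>x. dec_list (b x)"]) measurable
  then show ?thesis by (simp add: join_def)
qed

lemma exponential_integral_le:
  assumes "0 < L"
  shows "ennreal L * (\<integral>\<^sup>+y. indicator {0..T} y * ennreal (exp (- L * y)) \<partial>lborel) \<le> 1"
proof -
  have "ennreal L * (\<integral>\<^sup>+y. indicator {0..T} y * ennreal (exp (- L * y)) \<partial>lborel) =
      (\<integral>\<^sup>+y. ennreal L * (indicator {0..T} y * ennreal (exp (- L * y))) \<partial>lborel)"
    by (rule nn_integral_cmult[symmetric]) measurable
  also have "\<dots> \<le> (\<integral>\<^sup>+y. ennreal (exponential_density L y) \<partial>lborel)"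
    using assms by (intro nn_integral_mono)
      (auto simp: exponential_density_def indicator_def ennreal_mult[symmetric] mult.commute)
  also have "\<dots> = emeasure (density lborel (exponential_density L)) UNIV"
    by (subst emeasure_density) auto
  also have "\<dots> = 1"
    using prob_space.emeasure_space_1[OF prob_space_exponential_density[OF assms]] by simp
  finally show ?thesis .
qed

context jsq_law
begin

abbreviation join_mean :: "(nat list \<Rightarrow> ennreal) \<Rightarrow> nat list \<Rightarrow> ennreal" where
  "join_mean f c \<equiv> (\<integral>\<^sup>+a. (\<integral>\<^sup>+b. f (join c a b) \<partial>\<nu> (Priority 0)) \<partial>\<nu> (Sample 0))"

lemma clocks_in_sources: "length c = n \<Longrightarrow> i \<in> clocks c \<Longrightarrow> i \<in> sources n"
  by (auto elim!: clocks_cases)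

lemma step_measurable:
  assumes "i \<in> clocks c"
  shows "(\<lambda>z. step c i z) \<in> measurable \<mu> (count_space UNIV)"
  using assms by (cases rule: clocks_cases) simp_all

text \<open>The next state is an arbitrary function \<open>st\<close>, so that the lemma serves both
  for \<open>step\<close> and for a state held fixed under an integral. Measurability is joint in
  the sources and the time, because the time left after an event is random. The random state takes
  countably many values and can be split off.\<close>

lemma branch_measurable:
  assumes len: "length c = n" and i: "i \<in> clocks c"
    and st: "st \<in> measurable \<mu> (count_space UNIV)" "\<And>z. length (st z) = n"
    and reach: "\<And>c. length c = n \<Longrightarrow> Measurable.pred (\<mu> \<Otimes>\<^sub>M borel) (\<lambda>p. reach P k c (fst p) (snd p))"
  shows "Measurable.pred (\<mu> \<Otimes>\<^sub>M borel) (\<lambda>p. first_clock c (fst p) i \<and> fst p i \<le> snd p \<and>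
      reach P k (st (fst p)) (shift c i (fst p i) (fst p)) (snd p - fst p i))"
proof -
  have comp: "(\<lambda>z. z j) \<in> borel_measurable \<mu>" if "j \<in> clocks c" for j
    using component_measurable[OF clocks_in_sources[OF len that]] .
  have "Measurable.pred \<mu> (\<lambda>z. \<forall>j\<in>clocks c - {i}. z i < z j)"
    by (intro pred_finite_ball pred_less comp i) auto
  then have fc: "Measurable.pred \<mu> (\<lambda>z. first_clock c z i)"
    unfolding first_clock_def using i by simp
  have st': "(\<lambda>p. st (fst p)) \<in> measurable (\<mu> \<Otimes>\<^sub>M borel) (count_space {c'. length c' = n})"
  proof (subst measurable_count_space_eq_countable, simp, intro conjI ballI)
    show "(\<lambda>p. st (fst p)) -` {c'} \<inter> space (\<mu> \<Otimes>\<^sub>M borel) \<in> sets (\<mu> \<Otimes>\<^sub>M borel)" for c'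
      by (rule measurable_sets[OF measurable_compose[OF measurable_fst st(1)]]) simp
  qed (use st(2) in auto)
  have "(\<lambda>p. (fst p i, fst p)) \<in> measurable (\<mu> \<Otimes>\<^sub>M borel) (borel \<Otimes>\<^sub>M \<mu>)"
    by (intro measurable_Pair measurable_compose[OF measurable_fst comp[OF i]] measurable_fst)
  from measurable_compose[OF this shift_measurable[OF len i]]
  have sh: "(\<lambda>p. shift c i (fst p i) (fst p)) \<in> measurable (\<mu> \<Otimes>\<^sub>M borel) \<mu>"
    by (simp only: prod.case)
  have "Measurable.pred (\<mu> \<Otimes>\<^sub>M borel)
      (\<lambda>p. reach P k (st (fst p)) (shift c i (fst p i) (fst p)) (snd p - fst p i))"
  proof (rule measurable_compose_countable'[OF _ st'])
    fix c' :: "nat list" assume "c' \<in> {c'. length c' = n}"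
    then have A: "Measurable.pred (\<mu> \<Otimes>\<^sub>M borel) (\<lambda>p. reach P k c' (fst p) (snd p))"
      by (intro reach) simp
    have B: "(\<lambda>p. (shift c i (fst p i) (fst p), snd p - fst p i)) \<in> measurable (\<mu> \<Otimes>\<^sub>M borel) (\<mu> \<Otimes>\<^sub>M borel)"
      by (intro measurable_Pair sh borel_measurable_diff measurable_snd measurable_compose[OF measurable_fst comp[OF i]])
    from measurable_compose[OF B A] show "Measurable.pred (\<mu> \<Otimes>\<^sub>M borel)
        (\<lambda>p. reach P k c' (shift c i (fst p i) (fst p)) (snd p - fst p i))"
      by (simp only: fst_conv snd_conv)
  qed (rule countable_subset[OF subset_UNIV], simp)
  moreover have "Measurable.pred (\<mu> \<Otimes>\<^sub>M borel) (\<lambda>p. first_clock c (fst p) i)"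
    by (rule measurable_compose[OF measurable_fst fc])
  moreover have "Measurable.pred (\<mu> \<Otimes>\<^sub>M borel) (\<lambda>p. fst p i \<le> snd p)"
    unfolding pred_def by (rule borel_measurable_le[OF measurable_compose[OF measurable_fst comp[OF i]] measurable_snd])
  ultimately show ?thesis by (intro pred_conj)
qed

lemma reach_measurable:
  assumes P: "\<And>c. length c = n \<Longrightarrow> Measurable.pred \<mu> (P c)"
  shows "length c = n \<Longrightarrow> Measurable.pred (\<mu> \<Otimes>\<^sub>M borel) (\<lambda>p. reach P k c (fst p) (snd p))"
proof (induction k arbitrary: c)
  case 0
  then show ?case using measurable_compose[OF measurable_fst P[OF 0]] by (simp only: reach.simps)
next
  case (Suc k)
  have "length (step c i z) = n" for i z using Suc.prems by simp
  note main = branch_measurable[OF Suc.prems _ step_measurable this Suc.IH]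
  have "reach P (Suc k) c (fst p) (snd p) \<longleftrightarrow> P c (fst p) \<or> (\<exists>i\<in>clocks c. first_clock c (fst p) i \<and> fst p i \<le> snd p \<and>
      reach P k (step c i (fst p)) (shift c i (fst p i) (fst p)) (snd p - fst p i))" for p
    by (auto simp: first_clock_def)
  then show ?case
    by (simp only:) (intro pred_disj pred_finite_bex finite_clocks main measurable_compose[OF measurable_fst P[OF Suc.prems]])
qed

lemma branch_integrand:
  assumes P: "\<And>c. length c = n \<Longrightarrow> Measurable.pred \<mu> (P c)"
    and len: "length c = n" and i: "i \<in> clocks c"
    and st: "st \<in> measurable \<mu> (count_space UNIV)" "\<And>z. length (st z) = n"
  shows "(\<lambda>z. if first_clock c z i \<and> z i \<le> T \<and> reach P k (st z) (shift c i (z i) z) (T - z i)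
    then 1 else 0 :: ennreal) \<in> borel_measurable \<mu>"
  using measurable_compose[OF measurable_Pair2'[of T borel \<mu>]
      branch_measurable[where P = P and k = k, OF len i st reach_measurable[OF P]]]
  by (intro measurable_If) (auto simp: pred_def)

text \<open>The contribution of paths whose first event is clock \<open>i\<close> and leads to
  \<open>c'\<close>. If it rings at \<open>y\<close>, the other clocks survive with probability exp
  (- y S) and the hypothesis bounds the restarted system over the time T - y; its factor exp (C (T -
  y)) adds \<open>C\<close> to the total rate in the exponent.\<close>

lemma clock_integral:
  assumes P: "\<And>c. length c = n \<Longrightarrow> Measurable.pred \<mu> (P c)"
    and len: "length c = n" "length c' = n" and i: "i \<in> clocks c"
    and g: "\<And>T. 0 \<le> T \<Longrightarrow> emeasure \<mu> {z \<in> space \<mu>. reach P k c' z T} \<le> g * ennreal (exp (C * T))"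
  shows "(\<integral>\<^sup>+z. (if first_clock c z i \<and> z i \<le> T \<and> reach P k c' (shift c i (z i) z) (T - z i)
            then 1 else 0) \<partial>\<mu>)
    \<le> ennreal (rate R i) * g * ennreal (exp (C * T)) *
        (\<integral>\<^sup>+y. indicator {0..T} y * ennreal (exp (- ((\<Sum>j\<in>clocks c. rate R j) + C) * y)) \<partial>lborel)"
    (is "?L \<le> _")
proof -
  define S where "S = (\<Sum>j\<in>clocks c - {i}. rate R j)"
  have S: "(\<Sum>j\<in>clocks c. rate R j) = rate R i + S"
    using i by (simp add: S_def sum.remove)
  have iI: "i \<in> sources n" using clocks_in_sources[OF len(1) i] .
  have Fm: "(\<lambda>z. if first_clock c z i \<and> z i \<le> T \<and>
      reach P k c' (shift c i (z i) z) (T - z i) then 1 else 0 :: ennreal) \<in> borel_measurable \<mu>"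
    by (rule branch_integrand[where st = "\<lambda>_. c'", OF P len(1) i]) (simp_all add: len)
  \<comment> \<open>The clock that fired is not read again, so fixing its value leaves the restart
    unchanged.\<close>
  have upd: "shift c i y (fun_upd z i y) = shift c i y z" for y z
    using advance_in_clocks(3)[OF i] by (auto simp: shift_def)
  have pos: "AE y in \<nu> i. 0 \<le> y"
    unfolding law_clock[OF i] by (subst AE_density) (auto simp: exponential_density_def)
  have meas: "(\<lambda>y::real. indicator {..T} y * (ennreal (exp (- (y * S))) * (g * ennreal (exp (C * (T - y))))))
      \<in> borel_measurable borel"
    by measurable
  have meas2: "(\<lambda>y::real. indicator {0..T} y * ennreal (exp (- (((\<Sum>j\<in>clocks c. rate R j) + C) * y))))
      \<in> borel_measurable borel"
    by measurable
  have "?L = (\<integral>\<^sup>+y. (\<integral>\<^sup>+z. (if first_clock c (fun_upd z i y) i \<and> y \<le> T \<and>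
      reach P k c' (shift c i y (fun_upd z i y)) (T - y) then 1 else 0) \<partial>\<mu>) \<partial>\<nu> i)"
    unfolding fun_upd_same
    using resample[OF iI Fm] by simp
  also have "\<dots> \<le> (\<integral>\<^sup>+y. indicator {..T} y * (ennreal (exp (- y * S)) * (g * ennreal (exp (C * (T - y))))) \<partial>\<nu> i)"
  proof (rule nn_integral_mono_AE, use pos in eventually_elim)
    case (elim y)
    show ?case
    proof (cases "y \<le> T")
      case True
      have r1: "Measurable.pred \<mu> (\<lambda>z. reach P k c' z (T - y))"
        using measurable_compose[OF measurable_Pair2'[of "T - y" borel \<mu>] reach_measurable[OF P len(2), where k = k]]
        by simp
      have "(\<integral>\<^sup>+z. (if first_clock c (fun_upd z i y) i \<and> y \<le> T \<and>
            reach P k c' (shift c i y (fun_upd z i y)) (T - y) then 1 else 0) \<partial>\<mu>)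
          = (\<integral>\<^sup>+z. (if \<forall>j\<in>clocks c - {i}. y < z j then
              (\<lambda>z. if reach P k c' z (T - y) then 1 else 0) (shift c i y z) else 0) \<partial>\<mu>)"
        using i True by (intro nn_integral_cong) (auto simp: upd first_clock_def)
      also have "\<dots> = ennreal (exp (- y * S)) * (\<integral>\<^sup>+z. (if reach P k c' z (T - y) then 1 else 0) \<partial>\<mu>)"
        unfolding S_def by (rule restart_law[OF len(1) i elim]) (use r1 in measurable)
      finally have eq: "(\<integral>\<^sup>+z. (if first_clock c (fun_upd z i y) i \<and> y \<le> T \<and>
            reach P k c' (shift c i y (fun_upd z i y)) (T - y) then 1 else 0) \<partial>\<mu>)
          = ennreal (exp (- y * S)) * (\<integral>\<^sup>+z. (if reach P k c' z (T - y) then 1 else 0) \<partial>\<mu>)" .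
      have "(\<integral>\<^sup>+z. (if reach P k c' z (T - y) then 1 else 0) \<partial>\<mu>) =
          (\<integral>\<^sup>+z. indicator {z \<in> space \<mu>. reach P k c' z (T - y)} z \<partial>\<mu>)"
        by (intro nn_integral_cong) auto
      also have "\<dots> = emeasure \<mu> {z \<in> space \<mu>. reach P k c' z (T - y)}"
        using r1 by (intro nn_integral_indicator) (simp add: pred_def)
      also have "\<dots> \<le> g * ennreal (exp (C * (T - y)))"
        using True by (intro g) simp
      finally have *: "(\<integral>\<^sup>+z. (if first_clock c (fun_upd z i y) i \<and> y \<le> T \<and>
            reach P k c' (shift c i y (fun_upd z i y)) (T - y) then 1 else 0) \<partial>\<mu>)
          \<le> ennreal (exp (- y * S)) * (g * ennreal (exp (C * (T - y))))"
        unfolding eq by (intro mult_left_mono) simp_all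
      have "indicator {..T} y = (1 :: ennreal)" using True by simp
      with * show ?thesis by (simp only: mult_1)
    qed simp
  qed
  also have "\<dots> = (\<integral>\<^sup>+y. ennreal (exponential_density (rate R i) y) *
      (indicator {..T} y * (ennreal (exp (- y * S)) * (g * ennreal (exp (C * (T - y)))))) \<partial>lborel)"
    unfolding law_clock[OF i] by (rule nn_integral_density) (simp_all add: meas)
  also have "\<dots> = (\<integral>\<^sup>+y. ennreal (rate R i) * g * ennreal (exp (C * T)) *
      (indicator {0..T} y * ennreal (exp (- ((\<Sum>j\<in>clocks c. rate R j) + C) * y))) \<partial>lborel)"
  proof (rule nn_integral_cong)
    fix y :: real
    have "ennreal (rate R i * exp (- y * rate R i)) * (ennreal (exp (- y * S)) * (g * ennreal (exp (C * (T - y))))) =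
      g * ennreal (rate R i * exp (- y * rate R i) * exp (- y * S) * exp (C * (T - y)))"
      using rate_pos[of i] by (simp add: ennreal_mult ac_simps)
    also have "rate R i * exp (- y * rate R i) * exp (- y * S) * exp (C * (T - y)) =
       rate R i * exp (C * T) * exp (- ((\<Sum>j\<in>clocks c. rate R j) + C) * y)"
      by (simp add: S exp_add[symmetric] algebra_simps)
    finally have *: "ennreal (rate R i * exp (- y * rate R i)) * (ennreal (exp (- y * S)) * (g * ennreal (exp (C * (T - y))))) =
       ennreal (rate R i) * g * ennreal (exp (C * T)) * ennreal (exp (- ((\<Sum>j\<in>clocks c. rate R j) + C) * y))"
      using rate_pos[of i] by (simp add: ennreal_mult ac_simps)
    show "ennreal (exponential_density (rate R i) y) *
      (indicator {..T} y * (ennreal (exp (- y * S)) * (g * ennreal (exp (C * (T - y)))))) =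
      ennreal (rate R i) * g * ennreal (exp (C * T)) *
      (indicator {0..T} y * ennreal (exp (- ((\<Sum>j\<in>clocks c. rate R j) + C) * y)))"
      using * by (auto simp: exponential_density_def indicator_def)
  qed
  also have "\<dots> = ennreal (rate R i) * g * ennreal (exp (C * T)) *
      (\<integral>\<^sup>+y. indicator {0..T} y * ennreal (exp (- ((\<Sum>j\<in>clocks c. rate R j) + C) * y)) \<partial>lborel)"
    by (rule nn_integral_cmult) (simp add: meas2)
  finally show ?thesis .
qed

lemma sum_clocks:
  "(\<Sum>i\<in>clocks c. F i) = F (Gap 0) + (\<Sum>q\<in>{q. q < length c \<and> 0 < c ! q}. F (Service q 0))"
proof -
  have "(\<Sum>i\<in>(\<lambda>q. Service q 0) ` {q. q < length c \<and> 0 < c ! q}. F i) = (\<Sum>q\<in>{q. q < length c \<and> 0 < c ! q}. F (Service q 0))"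
    by (subst sum.reindex) (auto simp: inj_on_def)
  then show ?thesis
    unfolding clocks_def by (subst sum.insert) auto
qed

text \<open>A maximal inequality by induction on the number of events, in place of a supermartingale
  argument: \<open>drift\<close> says that the generator of the jump process maps \<open>f\<close>
  to at most \<open>C\<close> times \<open>f\<close>. Decomposing at the first event leaves the
  integral of an exponential density with rate the total rate plus \<open>C\<close>, which is at
  most 1. The alternative in \<open>start\<close> lets \<open>f\<close> vanish wherever
  \<open>P\<close> fails almost surely.\<close>

theorem reach_bound:
  fixes f :: "nat list \<Rightarrow> ennreal"
  assumes P: "\<And>c. length c = n \<Longrightarrow> Measurable.pred \<mu> (P c)"
    and C: "0 \<le> C"
    and start: "\<And>c. length c = n \<Longrightarrow> 1 \<le> f c \<or> (AE z in \<mu>. \<not> P c z)"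
    and drift: "\<And>c. length c = n \<Longrightarrow>
      ennreal R * join_mean f c +
        (\<Sum>q\<in>{q. q < n \<and> 0 < c ! q}. f (c[q := c ! q - 1]))
      \<le> ennreal (R + card {q. q < n \<and> 0 < c ! q} + C) * f c"
  shows "length c = n \<Longrightarrow> 0 \<le> T \<Longrightarrow>
    emeasure \<mu> {z \<in> space \<mu>. reach P k c z T} \<le> f c * ennreal (exp (C * T))"
proof (induction k arbitrary: c T)
  case 0
  interpret mu: prob_space \<mu> by (rule prob_space_mu)
  show ?case
    using start[OF 0(1)]
  proof
    assume "1 \<le> f c"
    then have "1 * 1 \<le> f c * ennreal (exp (C * T))"
      using C 0 by (intro mult_mono) auto
    then show ?thesis by (intro order_trans[OF mu.emeasure_le_1]) simp
  next
    assume "AE z in \<mu>. \<not> P c z"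
    then have "emeasure \<mu> {z \<in> space \<mu>. P c z} = 0"
      using P[OF 0(1)] by (subst (asm) AE_iff_measurable[OF _ refl]) (auto simp: pred_def)
    then show ?thesis by simp
  qed
next
  case (Suc k)
  interpret mu: prob_space \<mu> by (rule prob_space_mu)
  note len = \<open>length c = n\<close>
  show ?case
    using start[OF len]
  proof
    assume "1 \<le> f c"
    then have "1 * 1 \<le> f c * ennreal (exp (C * T))"
      using C Suc.prems by (intro mult_mono) auto
    then show ?thesis by (intro order_trans[OF mu.emeasure_le_1]) simp
  next
    assume ae: "AE z in \<mu>. \<not> P c z"
    define L where "L = (\<Sum>j\<in>clocks c. rate R j) + C"
    define Z where "Z = (\<integral>\<^sup>+y. indicator {0..T} y * ennreal (exp (- L * y)) \<partial>lborel)"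
    define E where "E = ennreal (exp (C * T))"
    define A where "A = (\<lambda>i z. if first_clock c z i \<and> z i \<le> T \<and>
        reach P k (step c i z) (shift c i (z i) z) (T - z i) then 1 else 0 :: ennreal)"
    have A_meas: "A i \<in> borel_measurable \<mu>" if "i \<in> clocks c" for i
      unfolding A_def by (rule branch_integrand[OF P len that step_measurable[OF that]]) (simp_all add: len)
    have clock: "(\<integral>\<^sup>+z. (if first_clock c z i \<and> z i \<le> T \<and> reach P k c' (shift c i (z i) z) (T - z i)
            then 1 else 0) \<partial>\<mu>) \<le> ennreal (rate R i) * f c' * E * Z"
      if "length c' = n" "i \<in> clocks c" for c' i
      unfolding E_def Z_def L_def
      by (rule clock_integral[OF P len that]) (use Suc.IH[OF that(1)] in auto)
    have service: "(\<integral>\<^sup>+z. A (Service q 0) z \<partial>\<mu>) \<le> f (c[q := c ! q - 1]) * E * Z"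
      if "q < n" "0 < c ! q" for q
      using clock[of "c[q := c ! q - 1]" "Service q 0"] that len by (simp add: A_def)
    have gap: "(\<integral>\<^sup>+z. A (Gap 0) z \<partial>\<mu>) \<le> ennreal R *
        join_mean f c * E * Z"
    proof -
      have g: "Gap 0 \<in> clocks c" by simp
      \<comment> \<open>An arrival reads \<open>Sample 0\<close> and \<open>Priority 0\<close> only
        to find the new state, and the restart reads later ones. Resampling both therefore averages
        over \<open>join\<close> with all else fixed.\<close>
      have upd: "A (Gap 0) (fun_upd (fun_upd z (Priority 0) b) (Sample 0) a) =
          (if first_clock c z (Gap 0) \<and> z (Gap 0) \<le> T \<and>
            reach P k (join c a b) (shift c (Gap 0) (z (Gap 0)) z) (T - z (Gap 0)) then 1 else 0)" for z a b
      proof -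
        have "shift c (Gap 0) s (fun_upd (fun_upd z (Priority 0) b) (Sample 0) a) = shift c (Gap 0) s z" for s
        proof -
          have "advance (Gap 0) x \<noteq> Priority 0" "advance (Gap 0) x \<noteq> Sample 0" for x
            by (cases x; simp)+
          then show ?thesis by (auto simp: shift_def)
        qed
        moreover have "first_clock c (fun_upd (fun_upd z (Priority 0) b) (Sample 0) a) (Gap 0) \<longleftrightarrow> first_clock c z (Gap 0)"
          unfolding first_clock_def by (auto elim!: clocks_cases)
        ultimately show ?thesis by (simp add: A_def)
      qed
      have fu: "(\<lambda>z. fun_upd z x a) \<in> measurable \<mu> \<mu>" if "x \<in> sources n" for x a
        unfolding \<mu>_def by (rule measurable_fun_upd[where J = "sources n"]) (use that in auto)
      have "(\<integral>\<^sup>+z. A (Gap 0) z \<partial>\<mu>) =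
          (\<integral>\<^sup>+a. (\<integral>\<^sup>+z. A (Gap 0) (fun_upd z (Sample 0) a) \<partial>\<mu>) \<partial>\<nu> (Sample 0))"
        by (rule resample) (auto simp: A_meas)
      also have "\<dots> = (\<integral>\<^sup>+a. (\<integral>\<^sup>+b. (\<integral>\<^sup>+z. A (Gap 0) (fun_upd (fun_upd z (Priority 0) b) (Sample 0) a) \<partial>\<mu>)
          \<partial>\<nu> (Priority 0)) \<partial>\<nu> (Sample 0))"
        by (intro nn_integral_cong resample) (auto intro: measurable_compose[OF fu A_meas])
      also have "\<dots> \<le> (\<integral>\<^sup>+a. (\<integral>\<^sup>+b. ennreal R * f (join c a b) * E * Z \<partial>\<nu> (Priority 0)) \<partial>\<nu> (Sample 0))"
        unfolding upd by (intro nn_integral_mono order_trans[OF clock[OF _ g]]) (simp_all add: len)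
      also have "\<dots> = ennreal R * join_mean f c * E * Z"
      proof -
        have fj: "(\<lambda>(a, b). f (join c a b)) \<in> borel_measurable (\<nu> (Sample 0) \<Otimes>\<^sub>M \<nu> (Priority 0))"
        proof -
          have "(\<lambda>p. join c (fst p) (snd p)) \<in> measurable (\<nu> (Sample 0) \<Otimes>\<^sub>M \<nu> (Priority 0)) (count_space UNIV)"
            by measurable
          from measurable_compose[OF this, of f borel] show ?thesis by (simp add: split_beta')
        qed
        have fj2: "(\<lambda>b. f (join c a b)) \<in> borel_measurable (\<nu> (Priority 0))" for a
          using measurable_Pair2[OF fj, of a] by simp
        have fj1: "(\<lambda>a. \<integral>\<^sup>+b. f (join c a b) \<partial>\<nu> (Priority 0)) \<in> borel_measurable (\<nu> (Sample 0))"
          by (rule sigma_finite_measure.borel_measurable_nn_integral[OF prob_space_imp_sigma_finite[OF law_prob] fj])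
        have "(\<integral>\<^sup>+b. ennreal R * f (join c a b) * E * Z \<partial>\<nu> (Priority 0)) =
            (ennreal R * E * Z) * (\<integral>\<^sup>+b. f (join c a b) \<partial>\<nu> (Priority 0))" for a
          by (subst nn_integral_cmult[symmetric, OF fj2]) (simp add: ac_simps)
        then show ?thesis
          by (simp add: nn_integral_cmult[OF fj1]) (simp add: ac_simps)
      qed
      finally show ?thesis .
    qed
    have "emeasure \<mu> {z \<in> space \<mu>. reach P (Suc k) c z T} = (\<integral>\<^sup>+z. indicator {z \<in> space \<mu>. reach P (Suc k) c z T} z \<partial>\<mu>)"
    proof (rule nn_integral_indicator[symmetric])
      have "Measurable.pred \<mu> (\<lambda>z. reach P (Suc k) c z T)"
        using measurable_compose[OF measurable_Pair2'[of T borel \<mu>] reach_measurable[OF P len, where k = "Suc k"]]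
        by simp
      then show "{z \<in> space \<mu>. reach P (Suc k) c z T} \<in> sets \<mu>" by (simp add: pred_def)
    qed
    also have "\<dots> \<le> (\<integral>\<^sup>+z. (\<Sum>i\<in>clocks c. A i z) \<partial>\<mu>)"
    proof (rule nn_integral_mono_AE, use ae in eventually_elim)
      case (elim z)
      show ?case
      proof (cases "reach P (Suc k) c z T")
        case True
        then obtain i where i: "first_clock c z i" "A i z = 1"
          using elim by (auto simp: A_def)
        then have "A i z \<le> (\<Sum>i\<in>clocks c. A i z)"
          by (intro member_le_sum) (auto simp: first_clock_def)
        then show ?thesis using i by (auto simp: indicator_def)
      qed simp
    qed
    also have "\<dots> = (\<Sum>i\<in>clocks c. \<integral>\<^sup>+z. A i z \<partial>\<mu>)"
      by (rule nn_integral_sum) (rule A_meas)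
    also have "\<dots> \<le> (ennreal R * join_mean f c +
        (\<Sum>q\<in>{q. q < n \<and> 0 < c ! q}. f (c[q := c ! q - 1]))) * E * Z"
      unfolding sum_clocks len distrib_right sum_distrib_right
      by (intro add_mono gap sum_mono service) auto
    also have "\<dots> \<le> (ennreal (R + card {q. q < n \<and> 0 < c ! q} + C) * f c) * E * Z"
      by (intro mult_right_mono drift len) auto
    \<comment> \<open>The factor supplied by \<open>drift\<close> is exactly the normalisation of
      the exponential density in \<open>Z\<close>.\<close>
    also have "\<dots> = (ennreal L * Z) * (f c * E)"
      by (simp add: L_def sum_clocks len ac_simps)
    also have "\<dots> \<le> 1 * (f c * E)"
      unfolding Z_def using C R_pos sum_pos[of "clocks c" "rate R"] rate_pos
      by (intro mult_right_mono exponential_integral_le) (auto simp: L_def clocks_def intro!: add_pos_nonneg sum_pos)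
    finally show ?thesis by (simp add: E_def)
  qed
qed

end

lemma reach_mono: "reach P k c z T \<Longrightarrow> reach P (Suc k) c z T"
proof (induction k arbitrary: c z T)
  case (Suc k)
  then have "P c z \<or> (\<exists>i. first_clock c z i \<and> z i \<le> T \<and>
      reach P k (step c i z) (shift c i (z i) z) (T - z i))"
    by (simp only: reach.simps)
  with Suc.IH show ?case unfolding reach.simps(2)[of P "Suc k"] by blast
qed simp

lemma shift_fun_upd_Init:
  assumes "i \<in> clocks c"
  shows "shift c i s (fun_upd z Init a) = fun_upd (shift c i s z) Init a"
proof
  fix x
  have "advance i x = Init \<longleftrightarrow> x = Init" "advance i Init = Init"
    using assms by (auto elim!: clocks_cases) (cases x; auto)+
  then show "shift c i s (fun_upd z Init a) x = fun_upd (shift c i s z) Init a x"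
    by (cases "x = Init") (auto simp: shift_def)
qed

text \<open>The recursion takes the queue lengths from its argument and not from the source
  \<open>Init\<close>. One may therefore condition on \<open>Init\<close> and treat them as
  constants.\<close>

lemma reach_fun_upd_Init: "reach (hit K) k c (fun_upd z Init a) T \<longleftrightarrow> reach (hit K) k c z T"
proof (induction k arbitrary: c z T)
  case (Suc k)
  let ?z = "fun_upd z Init a"
  have "(first_clock c ?z i \<and> ?z i \<le> T \<and> reach (hit K) k (step c i ?z) (shift c i (?z i) ?z) (T - ?z i)) \<longleftrightarrow>
    (first_clock c z i \<and> z i \<le> T \<and> reach (hit K) k (step c i z) (shift c i (z i) z) (T - z i))" for i
  proof (cases "i \<in> clocks c")
    case True
    then have "?z i = z i" "step c i ?z = step c i z"
      by (auto elim!: clocks_cases)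
    moreover have "first_clock c ?z i \<longleftrightarrow> first_clock c z i"
      using True by (auto simp: first_clock_def elim!: clocks_cases)
    ultimately show ?thesis by (simp only: shift_fun_upd_Init[OF True] Suc.IH)
  qed (simp add: first_clock_def)
  then show ?case by (simp only: reach.simps(2))
qed simp

section \<open>The canonical system\<close>

locale jsq_canonical = jsq_law +
  assumes sample_ok: "AE a in \<nu> (Sample 0). dec_list a \<noteq> [] \<and> set (dec_list a) \<subseteq> {..<n}"
    and priority_ok: "AE a in \<nu> (Priority 0). set (dec_list a) = {..<n}"
begin

sublocale mu: prob_space \<mu>
  by (rule prob_space_mu)

lemma distr_component: "x \<in> sources n \<Longrightarrow> distr \<mu> borel (\<lambda>z. z x) = \<nu> x"
  using P.PiM_component[of x] distr_cong[OF refl law_sets[of x], of \<mu> "\<lambda>z. z x"] by (simp add: \<mu>_def)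

lemma AE_component: "x \<in> sources n \<Longrightarrow> AE a in \<nu> x. Q a \<Longrightarrow> AE z in \<mu>. Q (z x)"
  unfolding \<mu>_def by (rule P.AE_component)

lemma indep_components: "mu.indep_vars (\<lambda>_. borel) (\<lambda>x z. z x) (sources n)"
proof (subst mu.indep_vars_iff_distr_eq_PiM')
  have "distr \<mu> (PiM (sources n) (\<lambda>_. borel)) (\<lambda>z. \<lambda>x\<in>sources n. z x) = distr \<mu> \<mu> (\<lambda>z. z)"
    by (rule distr_cong) (auto simp: sets_mu space_mu extensional_restrict)
  also have "\<dots> = \<mu>" by simp
  also have "\<mu> = PiM (sources n) (\<lambda>x. distr \<mu> borel (\<lambda>z. z x))"
    using distr_component by (subst (1) \<mu>_def) (intro PiM_cong, auto)
  finally show "distr \<mu> (PiM (sources n) (\<lambda>_. borel)) (\<lambda>z. \<lambda>x\<in>sources n. z x) =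
     PiM (sources n) (\<lambda>x. distr \<mu> borel (\<lambda>z. z x))" .
qed (auto intro: component_measurable sources_simps(1))

lemma prob_partial_sum_le:
  fixes s :: "nat \<Rightarrow> source"
  assumes s: "range s \<subseteq> sources n" "inj s" and l: "0 < l" "0 \<le> t"
    and law: "\<And>j. \<nu> (s j) = density lborel (exponential_density l)"
  shows "mu.prob {z \<in> space \<mu>. (\<Sum>j\<le>k. z (s j)) \<le> t} = erlang_CDF k l t"
proof -
  have "distributed \<mu> lborel (\<lambda>z. z (s j)) (exponential_density l)" for j
  proof -
    have "s j \<in> sources n" using s by auto
    then have "(\<lambda>z. z (s j)) \<in> borel_measurable \<mu>" "distr \<mu> lborel (\<lambda>z. z (s j)) = density lborel (exponential_density l)"
      using component_measurable distr_component[of "s j"] law distr_cong[OF refl sets_lborel, of \<mu> "\<lambda>z. z (s j)"] by auto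
    then show ?thesis by (simp add: distributed_def)
  qed
  moreover have "mu.indep_vars (\<lambda>_. borel) (\<lambda>x z. z x) (s ` {..k})"
    using s by (intro mu.indep_vars_subset[OF indep_components]) auto
  ultimately have "distributed \<mu> lborel (\<lambda>z. \<Sum>x\<in>s ` {..k}. z x) (erlang_density k l)"
    using mu.exponential_distributed_sum[of "s ` {..k}" l "\<lambda>x z. z x"] l s
    by (auto simp: card_image inj_on_subset[OF s(2) subset_UNIV])
  then have "distributed \<mu> lborel (\<lambda>z. \<Sum>j\<le>k. z (s j)) (erlang_density k l)"
    by (simp add: sum.reindex inj_on_subset[OF s(2) subset_UNIV])
  then show ?thesis using mu.erlang_distributed_le[of _ k l t] l by simp
qed

lemma erlang_CDF_tendsto_0:
  assumes "0 < l" "0 \<le> t"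
  shows "(\<lambda>k. erlang_CDF k l t) \<longlonglongrightarrow> 0"
proof -
  have "(\<lambda>k. \<Sum>m\<le>k. (l * t) ^ m / fact m) \<longlonglongrightarrow> exp (l * t)"
    using exp_converges[of "l * t"] by (simp add: sums_def_le divide_inverse mult.commute)
  then have "(\<lambda>k. 1 - exp (- (l * t)) * (\<Sum>m\<le>k. (l * t) ^ m / fact m)) \<longlonglongrightarrow> 1 - exp (- (l * t)) * exp (l * t)"
    by (intro tendsto_intros)
  moreover have "erlang_CDF k l t = 1 - exp (- (l * t)) * (\<Sum>m\<le>k. (l * t) ^ m / fact m)" for k
    using assms by (simp add: erlang_CDF_def sum_distrib_left mult_ac)
  ultimately show ?thesis by (simp add: exp_minus)
qed

text \<open>Renewals do not accumulate: the probability that all partial sums stay below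
  \<open>t\<close> is at most every Erlang distribution function at \<open>t\<close>, and these tend
  to 0 since the exponential series converges. Integer times suffice.\<close>

lemma AE_finite_sums:
  fixes s :: "nat \<Rightarrow> source"
  assumes s: "range s \<subseteq> sources n" "inj s" and l: "0 < l"
    and law: "\<And>j. \<nu> (s j) = density lborel (exponential_density l)"
  shows "AE z in \<mu>. (\<forall>j. 0 < z (s j)) \<and> (\<forall>t. finite {k. (\<Sum>j\<le>k. z (s j)) \<le> t})"
proof -
  have m: "(\<lambda>z. z (s j)) \<in> borel_measurable \<mu>" for j
    using s by (intro component_measurable) auto
  have pos: "AE z in \<mu>. \<forall>j. 0 < z (s j)"
    unfolding AE_all_countable
  proof (intro allI AE_component[where Q = "\<lambda>a. 0 < a"])
    fix j
    have "AE a in lborel. 0 < ennreal (exponential_density l a) \<longrightarrow> 0 < a"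
      using AE_lborel_singleton[of "0::real"] by eventually_elim (auto simp: exponential_density_def)
    then show "AE a in \<nu> (s j). 0 < a" unfolding law by (subst AE_density) auto
  qed (use s in auto)
  have "AE z in \<mu>. \<forall>t::nat. \<exists>k. real t < (\<Sum>j\<le>k. z (s j))"
    unfolding AE_all_countable
  proof
    fix t :: nat
    define B where "B = {z \<in> space \<mu>. \<forall>k. (\<Sum>j\<le>k. z (s j)) \<le> real t}"
    have B: "B \<in> sets \<mu>"
      unfolding B_def using m by (intro sets.sets_Collect_countable_All borel_measurable_le borel_measurable_sum) auto
    have "mu.prob B \<le> erlang_CDF k l t" for k
      unfolding prob_partial_sum_le[OF s l _ law, of "real t", symmetric, simplified]
      using m by (intro mu.finite_measure_mono) (auto simp: B_def intro!: borel_measurable_le borel_measurable_sum)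
    then have "mu.prob B \<le> 0"
      using erlang_CDF_tendsto_0[OF l, of "real t"] by (intro LIMSEQ_le_const[of "\<lambda>k. erlang_CDF k l t"]) auto
    then have "mu.prob B = 0" using measure_nonneg[of \<mu> B] by linarith
    then have "AE z in \<mu>. z \<notin> B" using B by (simp add: mu.prob_eq_0)
    then show "AE z in \<mu>. \<exists>k. real t < (\<Sum>j\<le>k. z (s j))"
      by (rule AE_mp) (auto simp: B_def not_le intro!: AE_I2)
  qed
  with pos show ?thesis
  proof eventually_elim
    case (elim z)
    have "finite {k. (\<Sum>j\<le>k. z (s j)) \<le> t}" for t
    proof -
      obtain t' :: nat where "t \<le> real t'" using real_arch_simple by blast
      obtain k where k: "real t' < (\<Sum>j\<le>k. z (s j))" using elim by blast
      have "i < k" if "(\<Sum>j\<le>i. z (s j)) \<le> t" for i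
      proof (rule ccontr)
        assume "\<not> i < k"
        then have "(\<Sum>j\<le>k. z (s j)) \<le> (\<Sum>j\<le>i. z (s j))"
          using elim by (intro sum_mono2) (auto simp: less_imp_le)
        then show False using that k \<open>t \<le> real t'\<close> by linarith
      qed
      then have "{k. (\<Sum>j\<le>k. z (s j)) \<le> t} \<subseteq> {..<k}" by auto
      then show ?thesis using finite_subset by blast
    qed
    then show ?case using elim by blast
  qed
qed

lemma AE_services:
  "AE z in \<mu>. \<forall>q<n. (\<forall>m. 0 < z (Service q m)) \<and> (\<forall>t. finite {k. (\<Sum>j\<le>k. z (Service q j)) \<le> t})"
proof -
  have "AE z in \<mu>. q < n \<longrightarrow> (\<forall>m. 0 < z (Service q m)) \<and> (\<forall>t. finite {k. (\<Sum>j\<le>k. z (Service q j)) \<le> t})" for q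
  proof (cases "q < n")
    case True
    then show ?thesis
      using AE_finite_sums[of "Service q" 1] by (simp add: inj_def law_service image_subset_iff)
  qed auto
  then show ?thesis by (simp add: AE_all_countable)
qed

lemma AE_regular: "AE z in \<mu>. regular n z"
proof -
  have "AE z in \<mu>. dec_list (z (Sample k)) \<noteq> [] \<and> set (dec_list (z (Sample k))) \<subseteq> {..<n}" for k
    using sample_ok by (intro AE_component[where Q = "\<lambda>a. dec_list a \<noteq> [] \<and> set (dec_list a) \<subseteq> {..<n}"]) (simp_all only: law_sample[of k] sources_simps)
  then have s: "AE z in \<mu>. \<forall>k. dec_list (z (Sample k)) \<noteq> [] \<and> set (dec_list (z (Sample k))) \<subseteq> {..<n}"
    by (simp only: AE_all_countable) simp
  have "AE z in \<mu>. set (dec_list (z (Priority k))) = {..<n}" for k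
    using priority_ok by (intro AE_component[where Q = "\<lambda>a. set (dec_list a) = {..<n}"]) (simp_all only: law_priority[of k] sources_simps)
  then have p: "AE z in \<mu>. \<forall>k. set (dec_list (z (Priority k))) = {..<n}"
    by (simp only: AE_all_countable) simp
  have g: "AE z in \<mu>. (\<forall>j. 0 < z (Gap j)) \<and> (\<forall>t. finite {k. (\<Sum>j\<le>k. z (Gap j)) \<le> t})"
    by (rule AE_finite_sums[of Gap R]) (simp_all add: inj_def law_gap R_pos image_subset_iff)
  show ?thesis
    using s p g AE_services by eventually_elim (auto simp: regular_def)
qed

text \<open>Fubini in the coordinate \<open>i\<close>: for each fixed value \<open>y\<close> of it,
  the other clock has a density and so differs from \<open>y\<close> almost surely.\<close>

lemma AE_not_tie: "length c = n \<Longrightarrow> AE z in \<mu>. \<not> tie c z"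
proof -
  assume len: "length c = n"
  have "AE z in \<mu>. z i \<noteq> z j" if ij: "i \<in> clocks c" "j \<in> clocks c" "i \<noteq> j" for i j
  proof -
    have I: "i \<in> sources n" "j \<in> sources n" using ij clocks_in_sources[OF len] by auto
    note m = component_measurable[OF I(1)] component_measurable[OF I(2)]
    have E: "{z \<in> space \<mu>. z i = z j} \<in> sets \<mu>"
      using m by (rule borel_measurable_eq)
    have "AE a in \<nu> j. a \<noteq> y" for y
      unfolding law_clock[OF ij(2)] using AE_lborel_singleton[of y] by (subst AE_density) auto
    then have ne: "AE z in \<mu>. z j \<noteq> y" for y
      using I by (intro AE_component[where Q = "\<lambda>a. a \<noteq> y"])
    have "emeasure \<mu> {z \<in> space \<mu>. z i = z j} = (\<integral>\<^sup>+z. indicator {z \<in> space \<mu>. z i = z j} z \<partial>\<mu>)"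
      using E by simp
    also have "\<dots> = (\<integral>\<^sup>+y. (\<integral>\<^sup>+z. indicator {z \<in> space \<mu>. z i = z j} (fun_upd z i y) \<partial>\<mu>) \<partial>\<nu> i)"
      using I E by (intro resample) auto
    also have "\<dots> = (\<integral>\<^sup>+y. (\<integral>\<^sup>+z. 0 \<partial>\<mu>) \<partial>\<nu> i)"
    proof (rule nn_integral_cong, rule nn_integral_cong_AE)
      fix y show "AE z in \<mu>. indicator {z \<in> space \<mu>. z i = z j} (fun_upd z i y) = (0 :: ennreal)"
        using ne[of y] by eventually_elim (use ij in auto)
    qed
    finally have "emeasure \<mu> {z \<in> space \<mu>. z i = z j} = 0" by simp
    then show ?thesis using E by (subst AE_iff_measurable[OF E]) auto
  qed
  then have "AE z in \<mu>. \<forall>i\<in>clocks c. \<forall>j\<in>clocks c. i \<noteq> j \<longrightarrow> z i \<noteq> z j"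
    by (intro AE_finite_allI finite_clocks) auto
  then show ?thesis by eventually_elim (auto simp: tie_def)
qed

lemma hit_measurable: "Measurable.pred \<mu> (hit K c)"
  by simp

lemma tie_measurable: "length c = n \<Longrightarrow> Measurable.pred \<mu> (tie c)"
proof -
  assume len: "length c = n"
  have "Measurable.pred \<mu> (\<lambda>z. i \<noteq> j \<and> z i = z j)" if "i \<in> clocks c" "j \<in> clocks c" for i j
    using borel_measurable_eq[OF component_measurable component_measurable, OF that[THEN clocks_in_sources[OF len]]]
    by (cases "i = j") (simp_all add: pred_def)
  then have "Measurable.pred \<mu> (\<lambda>z. \<exists>i\<in>clocks c. \<exists>j\<in>clocks c. i \<noteq> j \<and> z i = z j)"
    by (intro pred_finite_bex finite_clocks)
  then show ?thesis by (simp only: tie_def[abs_def])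
qed

lemma reach_pred:
  assumes "\<And>c. length c = n \<Longrightarrow> Measurable.pred \<mu> (P c)" "length c = n"
  shows "{z \<in> space \<mu>. reach P k c z T} \<in> sets \<mu>"
  using measurable_compose[OF measurable_Pair2'[of T borel \<mu>] reach_measurable[OF assms, where k = k]]
  by (simp add: pred_def)

text \<open>The maximal inequality with \<open>f = 0\<close>: ties are null in every state, and the
  drift condition is trivial.\<close>

lemma AE_not_reach_tie:
  assumes "length c = n" "0 \<le> T"
  shows "AE z in \<mu>. \<forall>k. \<not> reach tie k c z T"
  unfolding AE_all_countable
proof
  fix k
  have "emeasure \<mu> {z \<in> space \<mu>. reach tie k c z T} \<le> (\<lambda>_. 0) c * ennreal (exp (0 * T))"
    using assms AE_not_tie by (intro reach_bound tie_measurable) auto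
  then show "AE z in \<mu>. \<not> reach tie k c z T"
    by (subst AE_iff_measurable[OF reach_pred[OF tie_measurable assms(1)]]) auto
qed

text \<open>A measurable substitute for reaching the level at some time in [0, T]: the union over
  uncountably many times is replaced by one over the number of events.\<close>

definition overload :: "nat \<Rightarrow> real \<Rightarrow> (source \<Rightarrow> real) set" where
  "overload K T = {z \<in> space \<mu>. length (dec_list (z Init)) = n \<and> (\<exists>k. reach (hit K) k (dec_list (z Init)) z T)}"

lemma overload_sets: "overload K T \<in> sets \<mu>"
proof -
  have "overload K T = (\<Union>c\<in>{c. length c = n}. {z \<in> space \<mu>. dec_list (z Init) = c} \<inter>
      (\<Union>k. {z \<in> space \<mu>. reach (hit K) k c z T}))"
    by (auto simp: overload_def)
  also have "\<dots> \<in> sets \<mu>"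
  proof (intro sets.countable_UN' sets.Int sets.countable_UN image_subsetI)
    fix c :: "nat list" assume "c \<in> {c. length c = n}"
    then show "{z \<in> space \<mu>. reach (hit K) k c z T} \<in> sets \<mu>" for k
      by (intro reach_pred hit_measurable) auto
    have "(\<lambda>z. dec_list (z Init)) -` {c} \<inter> space \<mu> \<in> sets \<mu>"
      by (rule measurable_sets[OF measurable_compose[OF component_measurable dec_list_measurable]]) auto
    then show "{z \<in> space \<mu>. dec_list (z Init) = c} \<in> sets \<mu>"
      by (simp add: vimage_def Int_def conj_commute)
  qed (auto intro: countable_subset[OF subset_UNIV])
  finally show ?thesis .
qed

lemma AE_overload_iff:
  assumes "0 \<le> T" "AE z in \<mu>. length (dec_list (z Init)) = n"
  shows "AE z in \<mu>. z \<in> overload K T \<longleftrightarrow> (\<exists>t\<in>{0..T}. K \<le> total_jobs n (dat (dec_list (z Init)) z) t)"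
proof -
  have "AE z in \<mu>. length c = n \<longrightarrow> (\<forall>k. \<not> reach tie k c z T)" for c
    using AE_not_reach_tie[of c T] assms(1) by (cases "length c = n") auto
  \<comment> \<open>The initial state is random, but there are countably many lists, so their null
    sets can be united.\<close>
  then have "AE z in \<mu>. \<forall>c. length c = n \<longrightarrow> (\<forall>k. \<not> reach tie k c z T)"
    by (subst AE_all_countable) auto
  then show ?thesis
    using assms(2) AE_regular AE_space
  proof eventually_elim
    case (elim z)
    then have no: "\<not> reach tie k (dec_list (z Init)) z T" for k by blast
    show ?case
      using elim total_imp_reach[of K "dec_list (z Init)" z _ T, OF _ _ _ _ no]
        reach_imp_total[of K _ "dec_list (z Init)" z T, OF _ _ assms(1) no]
      by (auto simp: overload_def)
  qed
qed

text \<open>Resampling \<open>Init\<close> turns the initial state into a constant. The bound,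
  uniform in the number \<open>k\<close> of events, then passes to the increasing limit in
  \<open>k\<close>.\<close>

lemma overload_bound:
  assumes "0 \<le> T" "AE z in \<mu>. length (dec_list (z Init)) = n \<and> Q (dec_list (z Init))"
    and bound: "\<And>c k. length c = n \<Longrightarrow> Q c \<Longrightarrow> emeasure \<mu> {z \<in> space \<mu>. reach (hit K) k c z T} \<le> B"
  shows "emeasure \<mu> (overload K T) \<le> B"
proof -
  have "AE a in distr \<mu> borel (\<lambda>z. z Init). length (dec_list a) = n \<and> Q (dec_list a)"
  proof (subst AE_distr_iff)
    have "{a. (\<lambda>c. length c = n \<and> Q c) (dec_list a)} \<in> sets borel"
      using measurable_sets[OF dec_list_measurable, of "{c. length c = n \<and> Q c}"] by (simp add: vimage_def)
    then show "{a \<in> space borel. length (dec_list a) = n \<and> Q (dec_list a)} \<in> sets borel" by simp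
  qed (use assms(2) component_measurable in auto)
  then have ae: "AE a in \<nu> Init. length (dec_list a) = n \<and> Q (dec_list a)"
    unfolding distr_component[OF sources_simps(1)] .
  have "emeasure \<mu> (overload K T) = (\<integral>\<^sup>+z. indicator (overload K T) z \<partial>\<mu>)"
    using overload_sets by simp
  also have "\<dots> = (\<integral>\<^sup>+a. (\<integral>\<^sup>+z. indicator (overload K T) (fun_upd z Init a) \<partial>\<mu>) \<partial>\<nu> Init)"
    using overload_sets by (intro resample) auto
  also have "\<dots> \<le> (\<integral>\<^sup>+a. B \<partial>\<nu> Init)"
  proof (rule nn_integral_mono_AE, use ae in eventually_elim)
    case (elim a)
    define A where "A k = {z \<in> space \<mu>. reach (hit K) k (dec_list a) z T}" for k
    have A: "A k \<in> sets \<mu>" for k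
      unfolding A_def using elim by (intro reach_pred hit_measurable) auto
    have "(\<integral>\<^sup>+z. indicator (overload K T) (fun_upd z Init a) \<partial>\<mu>) = (\<integral>\<^sup>+z. indicator (\<Union>k. A k) z \<partial>\<mu>)"
      using elim by (intro nn_integral_cong)
        (auto simp: overload_def A_def reach_fun_upd_Init space_mu indicator_def extensional_def)
    also have "\<dots> = emeasure \<mu> (\<Union>k. A k)"
      using A by (intro nn_integral_indicator) auto
    also have "\<dots> = (SUP k. emeasure \<mu> (A k))"
      using A by (intro SUP_emeasure_incseq[symmetric])
        (auto simp: A_def incseq_Suc_iff intro: reach_mono simp del: reach.simps)
    also have "\<dots> \<le> B"
      using bound elim by (intro SUP_least) (auto simp: A_def)
    finally show ?case .
  qed
  also have "\<dots> = B" using prob_space.emeasure_space_1[OF law_prob] by simp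
  finally show ?thesis .
qed

end

section \<open>Lower bound by Poisson counts\<close>

definition renewals :: "(nat \<Rightarrow> source) \<Rightarrow> (source \<Rightarrow> real) \<Rightarrow> real \<Rightarrow> nat" where
  "renewals s z t = card {k. (\<Sum>j\<le>k. z (s j)) \<le> t}"

lemma arrivals_dat: "arrivals (dat c z) t = renewals Gap z t"
  by (simp add: arrivals_def renewals_def arrival_time_def)

lemma target_dat:
  assumes "regular n z"
  shows "hd (filter (\<lambda>q. q \<in> shortest D t (sample (dat c z) k)) (priority (dat c z) k)) < n"
  using target_in(2)[OF assms] by simp

text \<open>Idleness only delays: each service starts no earlier than the preceding departure at its
  server, so departures come no earlier than with services back to back from time 0.\<close>

lemma departures_ge:
  assumes reg: "regular (length c) z"
  shows "q < length c \<Longrightarrow> m < length (departures (dat c z) k q) \<Longrightarrow>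
    (\<Sum>j\<le>m. z (Service q j)) \<le> departures (dat c z) k q ! m"
proof (induction k arbitrary: q m)
  case (Suc k)
  let ?w = "dat c z"
  define r where "r = hd (filter (\<lambda>q. q \<in> shortest (departures ?w k) (arrival_time ?w k) (sample ?w k)) (priority ?w k))"
  define S where "S = Max (insert (arrival_time ?w k) (set (departures ?w k r)))"
  have r: "r < length c" unfolding r_def by (rule target_dat[OF reg])
  have D: "departures ?w (Suc k) = (departures ?w k)(r := departures ?w k r @ [S + z (Service r (length (departures ?w k r)))])"
    by (simp add: departures_Suc Let_def r_def S_def del: departures.simps)
  show ?case
  proof (cases "q = r \<and> m = length (departures ?w k r)")
    case False
    then have "m < length (departures ?w k q)" "departures ?w (Suc k) q ! m = departures ?w k q ! m"
      using Suc.prems by (auto simp: D nth_append split: if_splits simp del: departures.simps)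
    then show ?thesis using Suc by simp
  next
    case True
    have "(\<Sum>j<m. z (Service r j)) \<le> S"
    proof (cases m)
      case 0
      have "0 \<le> arrival_time ?w k"
        using reg unfolding arrival_time_def by (intro sum_nonneg) (auto simp: regular_def less_imp_le)
      also have "\<dots> \<le> S" unfolding S_def by simp
      finally show ?thesis using 0 by simp
    next
      case (Suc l)
      then have l: "l < length (departures ?w k r)" using True by simp
      have "(\<Sum>j<m. z (Service r j)) = (\<Sum>j\<le>l. z (Service r j))"
        by (simp add: Suc lessThan_Suc_atMost)
      also have "\<dots> \<le> departures ?w k r ! l" by (rule Suc.IH[OF r l])
      also have "\<dots> \<le> S" unfolding S_def using l by (intro Max_ge) auto
      finally show ?thesis .
    qed
    moreover have "departures ?w (Suc k) q ! m = S + z (Service r m)"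
      using True by (simp add: D del: departures.simps)
    ultimately show ?thesis
      using True by (simp add: lessThan_Suc_atMost[symmetric])
  qed
next
  case 0
  then show ?case by simp
qed

lemma sum_length_departures:
  assumes reg: "regular (length c) z"
  shows "(\<Sum>q<length c. length (departures (dat c z) k q)) = sum_list c + k"
proof (induction k)
  case 0
  show ?case by (simp add: sum_list_sum_nth atLeast0LessThan)
next
  case (Suc k)
  let ?w = "dat c z"
  define r where "r = hd (filter (\<lambda>q. q \<in> shortest (departures ?w k) (arrival_time ?w k) (sample ?w k)) (priority ?w k))"
  have r: "r < length c" unfolding r_def by (rule target_dat[OF reg])
  have "length (departures ?w (Suc k) q) = length (departures ?w k q) + (if q = r then 1 else 0)" for q
    unfolding departures_Suc Let_def r_def[symmetric] by (simp del: departures.simps)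
  then show ?case using Suc r by (simp add: sum.distrib del: departures.simps)
qed

text \<open>Conservation of jobs: initial and arrived jobs are either present or gone, and by
  \<open>departures_ge\<close> those gone are at most the renewals.\<close>

lemma total_jobs_ge:
  assumes reg: "regular (length c) z"
    and fin: "\<And>q. q < length c \<Longrightarrow> finite {k. (\<Sum>j\<le>k. z (Service q j)) \<le> t}"
  shows "sum_list c + renewals Gap z t \<le>
    total_jobs (length c) (dat c z) t + (\<Sum>q<length c. renewals (Service q) z t)"
proof -
  let ?D = "departures (dat c z) (renewals Gap z t)"
  have "length (?D q) \<le> num_present (?D q) t + renewals (Service q) z t" if q: "q < length c" for q
  proof -
    have "length (filter (\<lambda>u. u \<le> t) (?D q)) = card {m. m < length (?D q) \<and> ?D q ! m \<le> t}"
      by (rule length_filter_conv_card)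
    also have "\<dots> \<le> renewals (Service q) z t"
      unfolding renewals_def using departures_ge[OF reg q] by (intro card_mono fin[OF q]) fastforce
    finally show ?thesis
      using sum_length_filter_compl[of "\<lambda>u. t < u" "?D q"] by (simp add: num_present_def not_less)
  qed
  then have "(\<Sum>q<length c. length (?D q)) \<le> (\<Sum>q<length c. num_present (?D q) t + renewals (Service q) z t)"
    by (intro sum_mono) simp
  then show ?thesis
    by (simp add: sum_length_departures[OF reg] sum.distrib total_jobs_def queue_length_def arrivals_dat)
qed

section \<open>Poisson laws of the arrival and service counts\<close>

definition poisson_mass :: "real \<Rightarrow> nat \<Rightarrow> real" where
  "poisson_mass x m = exp (- x) * x ^ m / fact m"

lemma poisson_mass_convolution:
  "(\<Sum>j\<le>k. poisson_mass x j * poisson_mass y (k - j)) = poisson_mass (x + y) k"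
proof -
  have "(\<Sum>j\<le>k. poisson_mass x j * poisson_mass y (k - j)) =
      (\<Sum>j\<le>k. exp (- (x + y)) / fact k * (real (k choose j) * x ^ j * y ^ (k - j)))"
  proof (rule sum.cong[OF refl])
    fix j assume "j \<in> {..k}"
    then have b: "real (k choose j) / fact k = 1 / (fact j * fact (k - j))"
      by (simp add: binomial_fact)
    have "exp (- (x + y)) / fact k * (real (k choose j) * x ^ j * y ^ (k - j)) =
        exp (- x) * exp (- y) * x ^ j * y ^ (k - j) * (real (k choose j) / fact k)"
      by (simp add: exp_add[symmetric])
    then show "poisson_mass x j * poisson_mass y (k - j) =
        exp (- (x + y)) / fact k * (real (k choose j) * x ^ j * y ^ (k - j))"
      unfolding b by (simp add: poisson_mass_def)
  qed
  also have "\<dots> = exp (- (x + y)) / fact k * (x + y) ^ k"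
    unfolding sum_distrib_left[symmetric] binomial_ring ..
  finally show ?thesis by (simp add: poisson_mass_def)
qed

text \<open>Positive summands make the index set an initial segment, so its cardinality is its first
  missing index.\<close>

lemma renewals_greater_iff:
  fixes s :: "nat \<Rightarrow> source"
  assumes pos: "\<And>j. 0 < z (s j)" and fin: "finite {k. (\<Sum>j\<le>k. z (s j)) \<le> t}"
  shows "m < renewals s z t \<longleftrightarrow> (\<Sum>j\<le>m. z (s j)) \<le> t"
proof -
  let ?A = "{k. (\<Sum>j\<le>k. z (s j)) \<le> t}"
  have down: "i \<in> ?A" if "k \<in> ?A" "i \<le> k" for i k
  proof -
    have "(\<Sum>j\<le>i. z (s j)) \<le> (\<Sum>j\<le>k. z (s j))"
      using that pos by (intro sum_mono2) (auto simp: less_imp_le)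
    then show ?thesis using that by simp
  qed
  have "?A = {..<card ?A}"
  proof (cases "?A = {}")
    case False
    have "?A \<subseteq> {..Max ?A}" using Max_ge[OF fin] by blast
    moreover have "{..Max ?A} \<subseteq> ?A" using down[OF Max_in[OF fin False]] by blast
    ultimately have eq: "?A = {..Max ?A}" by (rule equalityI)
    have "card ?A = Suc (Max ?A)" by (subst eq) (rule card_atMost)
    then show ?thesis using eq lessThan_Suc_atMost by metis
  next
    case True
    show ?thesis unfolding True by simp
  qed
  then show ?thesis unfolding renewals_def by blast
qed

context jsq_canonical
begin

lemma count_measurable:
  fixes s :: "nat \<Rightarrow> source"
  assumes "range s \<subseteq> B"
  shows "(\<lambda>f. real (renewals s f t)) \<in> borel_measurable (PiM B (\<lambda>_. borel))"
proof -
  have m: "(\<lambda>f. f (s j)) \<in> borel_measurable (PiM B (\<lambda>_. borel :: real measure))" for j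
    using assms by (intro measurable_component_singleton) auto
  have "(\<lambda>f. card {k. (\<Sum>j\<le>k. f (s j)) \<le> t}) \<in> measurable (PiM B (\<lambda>_. borel)) (count_space UNIV)"
    using m by (intro measurable_card) (auto intro!: borel_measurable_le borel_measurable_sum)
  from measurable_compose[OF this, of real borel] show ?thesis
    by (simp add: renewals_def)
qed

lemma count_measurable_mu:
  fixes s :: "nat \<Rightarrow> source"
  assumes "range s \<subseteq> sources n"
  shows "(\<lambda>z. real (renewals s z t)) \<in> borel_measurable \<mu>"
  using count_measurable[OF assms] measurable_cong_sets[OF sets_mu refl] by blast

text \<open>Having exactly \<open>m\<close> renewals is a difference of two Erlang events, whose
  distribution functions differ by a single Poisson term.\<close>

lemma prob_count:
  fixes s :: "nat \<Rightarrow> source"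
  assumes s: "range s \<subseteq> sources n" "inj s" and l: "0 < l" "0 \<le> t"
    and law: "\<And>j. \<nu> (s j) = density lborel (exponential_density l)"
  shows "mu.prob {z \<in> space \<mu>. real (renewals s z t) = real m} = poisson_mass (l * t) m"
proof -
  define S where "S k = {z \<in> space \<mu>. (\<Sum>j\<le>k. z (s j)) \<le> t}" for k
  have S: "S k \<in> sets \<mu>" for k
    unfolding S_def using s by (intro borel_measurable_le borel_measurable_sum component_measurable) auto
  have pS: "mu.prob (S k) = erlang_CDF k l t" for k
    unfolding S_def by (rule prob_partial_sum_le[OF s l law])
  have cm: "{z \<in> space \<mu>. real (renewals s z t) = real m} \<in> sets \<mu>"
    using count_measurable_mu[OF s(1)] by (intro borel_measurable_eq) auto
  have iff: "AE z in \<mu>. \<forall>m. m < renewals s z t \<longleftrightarrow> z \<in> S m"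
    using AE_finite_sums[OF s l(1) law] AE_space
    by eventually_elim (auto simp: S_def renewals_greater_iff)
  show ?thesis
  proof (cases m)
    case 0
    have "mu.prob {z \<in> space \<mu>. real (renewals s z t) = real m} = mu.prob (space \<mu> - S 0)"
    proof (intro mu.finite_measure_eq_AE cm sets.compl_sets S)
      show "AE z in \<mu>. (z \<in> {z \<in> space \<mu>. real (renewals s z t) = real m}) = (z \<in> space \<mu> - S 0)"
        using iff AE_space
      proof eventually_elim
        case (elim z)
        have "0 < renewals s z t \<longleftrightarrow> z \<in> S 0" using elim(1) by blast
        then show ?case using elim(2) 0 by auto
      qed
    qed
    also have "\<dots> = 1 - erlang_CDF 0 l t" by (simp add: mu.prob_compl S pS)
    finally show ?thesis using l 0 by (simp add: erlang_CDF_def poisson_mass_def)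
  next
    case (Suc i)
    have "mu.prob (S (Suc i)) + poisson_mass (l * t) m = mu.prob (S i)"
      using l by (simp add: pS erlang_CDF_def poisson_mass_def Suc mult_ac)
    moreover have "mu.prob {z \<in> space \<mu>. real (renewals s z t) = real m} = mu.prob (S i - S (Suc i))"
    proof (intro mu.finite_measure_eq_AE cm sets.Diff S)
      show "AE z in \<mu>. (z \<in> {z \<in> space \<mu>. real (renewals s z t) = real m}) = (z \<in> S i - S (Suc i))"
        using iff AE_space
      proof eventually_elim
        case (elim z)
        have "renewals s z t = m \<longleftrightarrow> i < renewals s z t \<and> \<not> Suc i < renewals s z t" using Suc by auto
        moreover have "i < renewals s z t \<longleftrightarrow> z \<in> S i" "Suc i < renewals s z t \<longleftrightarrow> z \<in> S (Suc i)"
          using elim(1) by blast+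
        ultimately show ?case using elim(2) by simp
      qed
    qed
    moreover have "mu.prob (S i - S (Suc i)) = mu.prob (S i) - mu.prob (S i \<inter> S (Suc i))"
      using S by (intro mu.finite_measure_Diff') auto
    moreover have "mu.prob (S i \<inter> S (Suc i)) = mu.prob (S (Suc i))"
    proof (intro mu.finite_measure_eq_AE sets.Int S)
      show "AE z in \<mu>. (z \<in> S i \<inter> S (Suc i)) = (z \<in> S (Suc i))"
        using iff
      proof eventually_elim
        case (elim z)
        have "i < renewals s z t \<longleftrightarrow> z \<in> S i" "Suc i < renewals s z t \<longleftrightarrow> z \<in> S (Suc i)"
          using elim by blast+
        then show ?case using Suc_lessD by blast
      qed
    qed
    ultimately show ?thesis by simp
  qed
qed

text \<open>One index set for the arrival stream (\<open>None\<close>) and the services of all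
  servers, so that independence of all counts is a single statement about disjoint blocks of
  sources.\<close>

definition clock_seq :: "nat option \<Rightarrow> nat \<Rightarrow> source" where
  "clock_seq b = (case b of None \<Rightarrow> Gap | Some q \<Rightarrow> Service q)"

lemma indep_counts:
  "mu.indep_vars (\<lambda>_. borel) (\<lambda>b z. real (renewals (clock_seq b) z t)) (insert None (Some ` {..<n}))"
proof -
  let ?L = "insert None (Some ` {..<n})"
  have "mu.indep_vars (\<lambda>b. PiM (range (clock_seq b)) (\<lambda>_. borel))
      (\<lambda>b z. restrict (\<lambda>x. z x) (range (clock_seq b))) ?L"
    by (rule mu.indep_vars_restrict[OF indep_components])
       (auto simp: clock_seq_def disjoint_family_on_def split: option.splits)
  then have "mu.indep_vars (\<lambda>_. borel)
      (\<lambda>b z. (\<lambda>f. real (renewals (clock_seq b) f t)) (restrict (\<lambda>x. z x) (range (clock_seq b)))) ?L"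
    by (rule mu.indep_vars_compose2) (rule count_measurable[OF order_refl])
  then show ?thesis by (simp add: renewals_def)
qed

lemma prob_sum_counts:
  assumes t: "0 \<le> t"
  shows "finite Q \<Longrightarrow> Q \<subseteq> {..<n} \<Longrightarrow>
    mu.prob {z \<in> space \<mu>. (\<Sum>b\<in>Some ` Q. real (renewals (clock_seq b) z t)) = real k} = poisson_mass (real (card Q) * t) k"
proof (induction Q arbitrary: k rule: finite_induct)
  case empty
  then show ?case by (cases k) (auto simp: poisson_mass_def mu.prob_space)
next
  case (insert q Q)
  define X where "X = (\<lambda>z. real (renewals (clock_seq (Some q)) z t))"
  define Y where "Y = (\<lambda>z. \<Sum>b\<in>Some ` Q. real (renewals (clock_seq b) z t))"
  have ind: "mu.indep_var borel X borel Y"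
    unfolding X_def Y_def using insert
    by (intro mu.indep_vars_sum mu.indep_vars_subset[OF indep_counts]) auto
  then have [measurable]: "X \<in> borel_measurable \<mu>" "Y \<in> borel_measurable \<mu>"
    using mu.indep_var_rv1 mu.indep_var_rv2 by blast+
  have pX: "mu.prob {z \<in> space \<mu>. X z = real j} = poisson_mass t j" for j
    using prob_count[of "clock_seq (Some q)" 1 t j] insert.prems t
    by (simp add: X_def clock_seq_def law_service inj_def image_subset_iff)
  have sum: "(\<Sum>b\<in>Some ` insert q Q. real (renewals (clock_seq b) z t)) = X z + Y z" for z
    using insert by (simp add: X_def Y_def image_iff)
  have "X z + Y z = real k \<longleftrightarrow> (\<exists>j\<le>k. X z = real j \<and> Y z = real (k - j))" for z
  proof
    assume "X z + Y z = real k"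
    then have "renewals (clock_seq (Some q)) z t + (\<Sum>b\<in>Some ` Q. renewals (clock_seq b) z t) = k"
      unfolding X_def Y_def by (simp flip: of_nat_sum of_nat_add)
    then show "\<exists>j\<le>k. X z = real j \<and> Y z = real (k - j)"
      by (intro exI[of _ "renewals (clock_seq (Some q)) z t"]) (auto simp: X_def Y_def)
  qed auto
  then have "{z \<in> space \<mu>. (\<Sum>b\<in>Some ` insert q Q. real (renewals (clock_seq b) z t)) = real k} =
      (\<Union>j\<in>{..k}. {z \<in> space \<mu>. X z = real j \<and> Y z = real (k - j)})"
    unfolding sum by auto
  also have "mu.prob \<dots> = (\<Sum>j\<le>k. mu.prob {z \<in> space \<mu>. X z = real j \<and> Y z = real (k - j)})"
    by (intro mu.finite_measure_finite_Union) (auto simp: disjoint_family_on_def)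
  also have "\<dots> = (\<Sum>j\<le>k. poisson_mass t j * poisson_mass (real (card Q) * t) (k - j))"
  proof (rule sum.cong[OF refl])
    fix j
    have "mu.prob {z \<in> space \<mu>. X z \<in> {real j} \<and> Y z \<in> {real (k - j)}} =
        mu.prob {z \<in> space \<mu>. X z \<in> {real j}} * mu.prob {z \<in> space \<mu>. Y z \<in> {real (k - j)}}"
      by (rule mu.prob_indep_random_variable[OF ind]) auto
    then show "mu.prob {z \<in> space \<mu>. X z = real j \<and> Y z = real (k - j)} =
        poisson_mass t j * poisson_mass (real (card Q) * t) (k - j)"
      using insert.IH[of "k - j"] insert.prems by (simp add: pX Y_def)
  qed
  also have "\<dots> = poisson_mass (real (card (insert q Q)) * t) k"
    using insert by (simp add: poisson_mass_convolution distrib_right)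
  finally show ?case .
qed

lemma prob_counts:
  assumes t: "0 \<le> t"
  shows "{z \<in> space \<mu>. renewals Gap z t = a \<and> (\<Sum>q<n. renewals (Service q) z t) = b} \<in> sets \<mu>" (is "?A \<in> _")
    and "mu.prob {z \<in> space \<mu>. renewals Gap z t = a \<and> (\<Sum>q<n. renewals (Service q) z t) = b} =
      poisson_mass (R * t) a * poisson_mass (real n * t) b"
proof -
  define X where "X = (\<lambda>z. real (renewals (clock_seq None) z t))"
  define Y where "Y = (\<lambda>z. \<Sum>b\<in>Some ` {..<n}. real (renewals (clock_seq b) z t))"
  have ind: "mu.indep_var borel X borel Y"
    unfolding X_def Y_def by (intro mu.indep_vars_sum indep_counts) auto
  then have [measurable]: "X \<in> borel_measurable \<mu>" "Y \<in> borel_measurable \<mu>"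
    using mu.indep_var_rv1 mu.indep_var_rv2 by blast+
  have pX: "mu.prob {z \<in> space \<mu>. X z = real a} = poisson_mass (R * t) a"
    using prob_count[of "clock_seq None" R t a] t
    by (simp add: X_def clock_seq_def law_gap inj_def R_pos image_subset_iff)
  have "Y z = real b \<longleftrightarrow> (\<Sum>q<n. renewals (Service q) z t) = b" for z
    unfolding Y_def by (simp add: sum.reindex clock_seq_def flip: of_nat_sum)
  then have eq: "?A = {z \<in> space \<mu>. X z \<in> {real a} \<and> Y z \<in> {real b}}"
    by (auto simp: X_def clock_seq_def)
  show "?A \<in> sets \<mu>" unfolding eq by measurable
  have "mu.prob {z \<in> space \<mu>. X z \<in> {real a} \<and> Y z \<in> {real b}} =
      mu.prob {z \<in> space \<mu>. X z \<in> {real a}} * mu.prob {z \<in> space \<mu>. Y z \<in> {real b}}"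
    by (rule mu.prob_indep_random_variable[OF ind]) auto
  then show "mu.prob ?A = poisson_mass (R * t) a * poisson_mass (real n * t) b"
    unfolding eq using prob_sum_counts[OF t, of "{..<n}" b] by (simp add: pX Y_def)
qed

text \<open>With exactly \<open>a\<close> arrivals and \<open>b\<close> renewals the level is
  reached at time T itself. One pair of counts in the right proportions already carries the
  exponential rate, so no sum over pairs is formed.\<close>

lemma overload_lower:
  assumes T: "0 \<le> T" and N: "AE z in \<mu>. length (dec_list (z Init)) = n \<and> sum_list (dec_list (z Init)) = N"
    and K: "K + b \<le> N + a"
  shows "poisson_mass (R * T) a * poisson_mass (real n * T) b \<le> mu.prob (overload K T)"
proof -
  have "AE z in \<mu>. length (dec_list (z Init)) = n" using N by auto
  from AE_overload_iff[OF T this, of K]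
  have "AE z in \<mu>. z \<in> {z \<in> space \<mu>. renewals Gap z T = a \<and> (\<Sum>q<n. renewals (Service q) z T) = b} \<longrightarrow> z \<in> overload K T"
    using N AE_regular AE_services
  proof eventually_elim
    case (elim z)
    have "N + renewals Gap z T \<le> total_jobs n (dat (dec_list (z Init)) z) T + (\<Sum>q<n. renewals (Service q) z T)"
      using total_jobs_ge[of "dec_list (z Init)" z T] elim by auto
    then show ?case using elim(1) K T by (auto intro!: bexI[of _ T])
  qed
  then show ?thesis
    unfolding prob_counts(2)[OF T, symmetric]
    by (intro mu.finite_measure_mono_AE overload_sets)
qed

end

section \<open>Upper bound by a Lyapunov function\<close>

definition idle :: "nat list \<Rightarrow> nat set" where
  "idle c = {q. q < length c \<and> c ! q = 0}"

lemma finite_idle [simp]: "finite (idle c)"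
  by (simp add: idle_def)

lemma idle_increase:
  "q < length c \<Longrightarrow> idle (c[q := Suc x]) = idle c - {q}"
  by (auto simp: idle_def nth_list_update)

lemma card_busy: "card {q. q < length c \<and> 0 < c ! q} = length c - card (idle c)"
proof -
  have "card {q. q < length c \<and> 0 < c ! q} = card ({..<length c} - idle c)"
    by (rule arg_cong[where f = card]) (auto simp: idle_def)
  then show ?thesis by (simp add: card_Diff_subset idle_def subset_iff)
qed

text \<open>The correction in the Lyapunov function has increments rising linearly from \<open>0\<close> to \<open>1\<close>
  between \<open>b\<close> and \<open>2 b\<close> idle servers. A jump from \<open>0\<close> to \<open>1\<close> would not do: with exactly \<open>b\<close> idle
  servers, arrivals would raise the function while departures left it unchanged.\<close>

definition slope :: "nat \<Rightarrow> nat \<Rightarrow> real" where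
  "slope b j = min 1 (real (j - b) / real b)"

definition lyapunov :: "nat \<Rightarrow> nat list \<Rightarrow> real" where
  "lyapunov b c = real (sum_list c) + (\<Sum>j<card (idle c). slope b j)"

lemma slope_bounds: "0 \<le> slope b j" "slope b j \<le> 1"
  by (auto simp: slope_def)

lemma slope_eq_0: "j \<le> b \<Longrightarrow> slope b j = 0"
  by (simp add: slope_def)

lemma slope_eq_1: "0 < b \<Longrightarrow> 2 * b \<le> j \<Longrightarrow> slope b j = 1"
  by (auto simp: slope_def min_def field_simps of_nat_diff)

text \<open>An arrival that fills an idle server and a departure see neighbouring values of
  \<open>slope\<close>. The mismatch 1 / b is harmless once \<open>b\<close> grows with n.\<close>

lemma slope_diff: "slope b j - slope b (j - 1) \<le> 1 / real b"
proof -
  have "real (j - b) / real b \<le> real (j - 1 - b) / real b + 1 / real b"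
    unfolding add_divide_distrib[symmetric] by (intro divide_right_mono) linarith+
  moreover have "0 \<le> 1 / real b" by simp
  ultimately show ?thesis unfolding slope_def by linarith
qed

lemma lyapunov_eq: "card (idle c) \<le> b \<Longrightarrow> lyapunov b c = real (sum_list c)"
  by (simp add: lyapunov_def slope_eq_0)

lemma lyapunov_ge: "real (sum_list c) \<le> lyapunov b c"
  by (simp add: lyapunov_def sum_nonneg slope_bounds)

lemma lyapunov_arrival:
  assumes "q < length c"
  shows "lyapunov b (c[q := Suc (c ! q)]) =
    lyapunov b c + 1 - (if c ! q = 0 then slope b (card (idle c) - 1) else 0)"
proof (cases "c ! q = 0")
  case True
  then have "q \<in> idle c" using assms by (simp add: idle_def)
  then obtain m where m: "card (idle c) = Suc m"
    by (metis card_gt_0_iff empty_iff finite_idle gr0_implies_Suc)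
  have "card (idle c - {q}) = m" using \<open>q \<in> idle c\<close> m by simp
  then show ?thesis
    using True assms m by (simp add: lyapunov_def idle_increase sum_list_update)
next
  case False
  then have "q \<notin> idle c" by (simp add: idle_def)
  then show ?thesis
    using False assms by (simp add: lyapunov_def idle_increase sum_list_update elem_le_sum_list)
qed

text \<open>A departure that empties its server adds the summand
  \<open>slope b (card (idle c))\<close> to the correction, which gives equality; any other
  departure lowers the function by a full unit.\<close>

lemma lyapunov_departure:
  assumes "q < length c" "0 < c ! q"
  shows "lyapunov b (c[q := c ! q - 1]) \<le> lyapunov b c - (1 - slope b (card (idle c)))"
proof -
  have "sum_list (c[q := c ! q - 1]) + 1 = sum_list c"
    using assms elem_le_sum_list[of q c] by (simp add: sum_list_update)
  then have s: "real (sum_list (c[q := c ! q - 1])) = real (sum_list c) - 1" by linarith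
  show ?thesis
  proof (cases "c ! q = 1")
    case True
    then have "idle (c[q := c ! q - 1]) = insert q (idle c)" "q \<notin> idle c"
      using assms by (auto simp: idle_def nth_list_update)
    then show ?thesis using s by (simp add: lyapunov_def)
  next
    case False
    then have "idle (c[q := c ! q - 1]) = idle c"
      using assms by (auto simp: idle_def nth_list_update split: if_splits)
    then show ?thesis using s slope_bounds by (simp add: lyapunov_def)
  qed
qed

context jsq_canonical
begin

text \<open>What the upper bound uses of the policy: the job joins some server, and an idle one if
  the sample contains any, since the choice minimises the queue length.\<close>

lemma join_law:
  "AE a in \<nu> (Sample 0). AE b in \<nu> (Priority 0). \<forall>c. length c = n \<longrightarrow>
     (\<exists>q<n. join c a b = c[q := Suc (c ! q)] \<and> (set (dec_list a) \<inter> idle c \<noteq> {} \<longrightarrow> c ! q = 0))"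
  using sample_ok
proof eventually_elim
  case S: (elim a)
  show ?case
    using priority_ok
  proof eventually_elim
    case (elim b)
    show ?case
    proof (intro allI impI)
      fix c :: "nat list" assume len: "length c = n"
      let ?S = "set (dec_list a)"
      define q where "q = choice c ?S (dec_list b)"
      note q = choice_minimal[of "dec_list a" "dec_list b" c, folded q_def]
      have "c ! q = 0" if "?S \<inter> idle c \<noteq> {}"
        using that q S elim by (force simp: idle_def)
      moreover have "q < n" using q(2) S elim by auto
      ultimately show "\<exists>q<n. join c a b = c[q := Suc (c ! q)] \<and> (?S \<inter> idle c \<noteq> {} \<longrightarrow> c ! q = 0)"
        by (intro exI[of _ q]) (auto simp: join_def q_def Let_def)
    qed
  qed
qed

text \<open>The parameter \<beta> is the guaranteed decrease of the Lyapunov function at a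
  departure; \<open>drift\<close> for all \<beta> in [0, 1] covers every number of idle servers.
  \<open>p\<close> bounds the probability that a sample misses more than \<open>b\<close> idle
  servers, in which case the function still rises by at most 1.\<close>

lemma overload_upper:
  fixes b K :: nat and \<theta> p C T :: real
  assumes \<theta>: "0 \<le> \<theta>" and b: "0 < b" "2 * b \<le> n" and p: "0 \<le> p" and T: "0 \<le> T" and C: "0 \<le> C"
    and miss: "\<And>A. A \<subseteq> {..<n} \<Longrightarrow> b < card A \<Longrightarrow>
      emeasure (\<nu> (Sample 0)) {a. set (dec_list a) \<inter> A = {}} \<le> ennreal p"
    and drift: "\<And>\<beta>. 0 \<le> \<beta> \<Longrightarrow> \<beta> \<le> 1 \<Longrightarrow>
      R * (exp (\<theta> * (\<beta> + 1 / real b)) - 1) + R * p * exp \<theta> + (real n - 2 * real b) * (exp (- \<theta> * \<beta>) - 1) \<le> C"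
    and len: "length c = n" and c: "card (idle c) \<le> b" "sum_list c = N"
  shows "emeasure \<mu> {z \<in> space \<mu>. reach (hit K) k c z T} \<le> ennreal (exp (\<theta> * (real N - real K) + C * T))"
proof -
  \<comment> \<open>Normalised by \<open>K\<close> so that \<open>v\<close> is at least 1 once the
    level is reached.\<close>
  define v where "v = (\<lambda>c. exp (\<theta> * (lyapunov b c - real K)))"
  have v_nonneg: "0 \<le> v c" for c by (simp add: v_def)
  have "emeasure \<mu> {z \<in> space \<mu>. reach (hit K) k c z T} \<le> ennreal (v c) * ennreal (exp (C * T))"
  proof (rule reach_bound[OF hit_measurable C _ _ len T])
    fix c :: "nat list" assume len: "length c = n"
    have "1 \<le> v c" if "K \<le> sum_list c"
    proof -
      have "real K \<le> lyapunov b c" using that lyapunov_ge[of c b] by linarith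
      then show ?thesis using \<theta> by (simp add: v_def)
    qed
    then show "1 \<le> ennreal (v c) \<or> (AE z in \<mu>. \<not> K \<le> sum_list c)"
      by (cases "K \<le> sum_list c") auto
    define I where "I = card (idle c)"
    define \<beta> where "\<beta> = 1 - slope b I"
    define \<gamma> where "\<gamma> = 1 - slope b (I - 1)"
    have I_le: "I \<le> n"
      unfolding I_def using card_mono[of "{..<n}" "idle c"] len by (auto simp: idle_def)
    have \<beta>: "0 \<le> \<beta>" "\<beta> \<le> 1" using slope_bounds by (simp_all add: \<beta>_def)
    have \<gamma>: "0 \<le> \<gamma>" "\<gamma> \<le> 1" using slope_bounds by (simp_all add: \<gamma>_def)
    have \<gamma>\<beta>: "\<gamma> \<le> \<beta> + 1 / real b" using slope_diff[of b I] by (simp add: \<beta>_def \<gamma>_def)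
    define p' where "p' = (if I \<le> b then 0 else p)"
    \<comment> \<open>The bad samples. With at most \<open>b\<close> idle servers none have to be
      excluded: then \<gamma> = 1, and no arrival raises the function by more than 1.\<close>
    define E where "E = {a. set (dec_list a) \<inter> idle c = {}} \<inter> (if I \<le> b then {} else UNIV)"
    have E_sets: "E \<in> sets (\<nu> (Sample 0))"
      using measurable_sets[OF dec_list_measurable, of "{l. set l \<inter> idle c = {}}"]
      by (auto simp: E_def law_sets vimage_def)
    have E_prob: "emeasure (\<nu> (Sample 0)) E \<le> ennreal p'"
    proof (cases "I \<le> b")
      case False
      have "idle c \<subseteq> {..<n}" using len by (auto simp: idle_def)
      then show ?thesis using miss[of "idle c"] False by (simp add: E_def p'_def I_def)
    qed (simp add: E_def)
    have busy: "(\<Sum>q\<in>{q. q < n \<and> 0 < c ! q}. ennreal (v (c[q := c ! q - 1])))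
        \<le> ennreal ((real n - real I) * exp (- \<theta> * \<beta>) * v c)"
    proof -
      have "v (c[q := c ! q - 1]) \<le> exp (- \<theta> * \<beta>) * v c" if "q < n" "0 < c ! q" for q
      proof -
        have "\<theta> * (lyapunov b (c[q := c ! q - 1]) - real K) \<le> \<theta> * (lyapunov b c - \<beta> - real K)"
          using lyapunov_departure[of q c b] that len \<theta> by (intro mult_left_mono) (auto simp: \<beta>_def I_def)
        also have "\<dots> = - \<theta> * \<beta> + \<theta> * (lyapunov b c - real K)" by (simp add: algebra_simps)
        finally show ?thesis by (simp add: v_def exp_add[symmetric])
      qed
      then have "(\<Sum>q\<in>{q. q < n \<and> 0 < c ! q}. ennreal (v (c[q := c ! q - 1])))
          \<le> (\<Sum>q\<in>{q. q < n \<and> 0 < c ! q}. ennreal (exp (- \<theta> * \<beta>) * v c))"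
        by (intro sum_mono ennreal_leI) auto
      also have "\<dots> = ennreal (real (card {q. q < n \<and> 0 < c ! q}) * (exp (- \<theta> * \<beta>) * v c))"
        using v_nonneg by (simp add: ennreal_mult ennreal_of_nat_eq_real_of_nat)
      also have "real (card {q. q < n \<and> 0 < c ! q}) = real n - real I"
        using card_busy[of c] len I_le by (simp add: I_def of_nat_diff)
      finally show ?thesis by (simp add: mult.assoc)
    qed
    have arrive: "join_mean (\<lambda>c. ennreal (v c)) c
        \<le> ennreal ((exp (\<theta> * \<gamma>) + p' * exp \<theta>) * v c)"
    proof -
      have "join_mean (\<lambda>c. ennreal (v c)) c
          \<le> (\<integral>\<^sup>+a. (\<integral>\<^sup>+b'. (ennreal (exp (\<theta> * \<gamma>) * v c) + ennreal (exp \<theta> * v c) * indicator E a) \<partial>\<nu> (Priority 0)) \<partial>\<nu> (Sample 0))"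
      proof (rule nn_integral_mono_AE, use join_law in eventually_elim, rule nn_integral_mono_AE)
        fix a assume "AE b' in \<nu> (Priority 0). \<forall>c. length c = n \<longrightarrow>
          (\<exists>q<n. join c a b' = c[q := Suc (c ! q)] \<and> (set (dec_list a) \<inter> idle c \<noteq> {} \<longrightarrow> c ! q = 0))"
        then show "AE b' in \<nu> (Priority 0). ennreal (v (join c a b')) \<le>
            ennreal (exp (\<theta> * \<gamma>) * v c) + ennreal (exp \<theta> * v c) * indicator E a"
        proof eventually_elim
          case (elim b')
          then obtain q where q: "q < n" "join c a b' = c[q := Suc (c ! q)]"
            "set (dec_list a) \<inter> idle c \<noteq> {} \<Longrightarrow> c ! q = 0" using len by blast
          have up: "v (join c a b') \<le> exp (\<theta> * d) * v c"
            if "1 - (if c ! q = 0 then slope b (I - 1) else 0) \<le> d" for d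
          proof -
            have "\<theta> * (lyapunov b (join c a b') - real K) \<le> \<theta> * (lyapunov b c + d - real K)"
              using that lyapunov_arrival[of q c b] q len \<theta> by (intro mult_left_mono) (auto simp: I_def)
            also have "\<dots> = \<theta> * d + \<theta> * (lyapunov b c - real K)" by (simp add: algebra_simps)
            finally show ?thesis by (simp add: v_def exp_add[symmetric])
          qed
          show ?case
          proof (cases "a \<in> E")
            case True
            have "v (join c a b') \<le> exp \<theta> * v c" using up[of 1] slope_bounds by simp
            then have "ennreal (v (join c a b')) \<le> ennreal (exp \<theta> * v c)" by (rule ennreal_leI)
            also have "\<dots> \<le> ennreal (exp (\<theta> * \<gamma>) * v c) + ennreal (exp \<theta> * v c)" by simp
            finally show ?thesis using True by simp
          next
            case False
            have "v (join c a b') \<le> exp (\<theta> * \<gamma>) * v c"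
            proof (cases "I \<le> b")
              case True
              then show ?thesis using up[of \<gamma>] by (auto simp: \<gamma>_def slope_eq_0)
            next
              case False
              then show ?thesis using up[of \<gamma>] q(3) \<open>a \<notin> E\<close> by (auto simp: \<gamma>_def E_def)
            qed
            then show ?thesis using False by (simp add: ennreal_leI)
          qed
        qed
      qed
      also have "\<dots> = (\<integral>\<^sup>+a. (ennreal (exp (\<theta> * \<gamma>) * v c) + ennreal (exp \<theta> * v c) * indicator E a) \<partial>\<nu> (Sample 0))"
        using prob_space.emeasure_space_1[OF law_prob] by simp
      also have "\<dots> = ennreal (exp (\<theta> * \<gamma>) * v c) + ennreal (exp \<theta> * v c) * emeasure (\<nu> (Sample 0)) E"
        using prob_space.emeasure_space_1[OF law_prob] E_sets
        by (subst nn_integral_add) (auto simp: nn_integral_cmult_indicator)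
      also have "\<dots> \<le> ennreal (exp (\<theta> * \<gamma>) * v c) + ennreal (exp \<theta> * v c) * ennreal p'"
        by (intro add_left_mono mult_left_mono E_prob) simp
      also have "\<dots> = ennreal ((exp (\<theta> * \<gamma>) + p' * exp \<theta>) * v c)"
        using v_nonneg p by (simp add: p'_def ennreal_mult[symmetric] ennreal_plus[symmetric] algebra_simps del: ennreal_plus)
      finally show ?thesis .
    qed
    have main: "R * (exp (\<theta> * \<gamma>) + p' * exp \<theta>) + (real n - real I) * exp (- \<theta> * \<beta>)
        \<le> R + (real n - real I) + C"
    proof -
      have neg: "exp (- \<theta> * \<beta>) - 1 \<le> 0" using \<theta> \<beta> by simp
      \<comment> \<open>Up to \<open>2 * b\<close> idle servers their number is replaced by
        \<open>2 * b\<close>; beyond that \<beta> = 0 and both sides vanish. Thus the number of idle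
        servers drops out of the drift condition.\<close>
      have "(real n - real I) * (exp (- \<theta> * \<beta>) - 1) \<le> (real n - 2 * real b) * (exp (- \<theta> * \<beta>) - 1)"
      proof (cases "I \<le> 2 * b")
        case True
        then show ?thesis using neg by (intro mult_right_mono_neg) auto
      next
        case False
        then have "\<beta> = 0" using b slope_eq_1[of b I] by (simp add: \<beta>_def)
        then show ?thesis by simp
      qed
      moreover have "R * (exp (\<theta> * \<gamma>) - 1) \<le> R * (exp (\<theta> * (\<beta> + 1 / real b)) - 1)"
        using R_pos \<theta> \<gamma>\<beta> by (intro mult_left_mono) (auto intro: mult_left_mono)
      moreover have "R * (p' * exp \<theta>) \<le> R * p * exp \<theta>"
        using R_pos p by (simp add: p'_def)
      ultimately show ?thesis using drift[OF \<beta>] by (simp add: algebra_simps)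
    qed
    have "ennreal R * join_mean (\<lambda>c. ennreal (v c)) c +
        (\<Sum>q\<in>{q. q < n \<and> 0 < c ! q}. ennreal (v (c[q := c ! q - 1]))) \<le>
        ennreal R * ennreal ((exp (\<theta> * \<gamma>) + p' * exp \<theta>) * v c) + ennreal ((real n - real I) * exp (- \<theta> * \<beta>) * v c)"
      by (intro add_mono mult_left_mono arrive busy) simp
    also have "\<dots> = ennreal ((R * (exp (\<theta> * \<gamma>) + p' * exp \<theta>) + (real n - real I) * exp (- \<theta> * \<beta>)) * v c)"
    proof -
      have "0 \<le> (exp (\<theta> * \<gamma>) + p' * exp \<theta>) * v c" "0 \<le> (real n - real I) * exp (- \<theta> * \<beta>) * v c"
        using v_nonneg[of c] p I_le by (simp_all add: p'_def)
      then show ?thesis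
        using R_pos by (simp add: ennreal_mult[symmetric] ennreal_plus[symmetric] distrib_right mult.assoc del: ennreal_plus)
    qed
    also have "\<dots> \<le> ennreal ((R + (real n - real I) + C) * v c)"
      by (intro ennreal_leI mult_right_mono main v_nonneg)
    also have "\<dots> = ennreal (R + card {q. q < n \<and> 0 < c ! q} + C) * ennreal (v c)"
      using card_busy[of c] len I_le R_pos C v_nonneg by (simp add: I_def of_nat_diff ennreal_mult)
    finally show "ennreal R * join_mean (\<lambda>c. ennreal (v c)) c +
        (\<Sum>q\<in>{q. q < n \<and> 0 < c ! q}. ennreal (v (c[q := c ! q - 1])))
        \<le> ennreal (R + card {q. q < n \<and> 0 < c ! q} + C) * ennreal (v c)" .
  qed
  also have "\<dots> = ennreal (exp (\<theta> * (real N - real K) + C * T))"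
    using lyapunov_eq[OF c(1)] c(2) by (simp add: v_def ennreal_mult[symmetric] exp_add)
  finally show ?thesis .
qed

end

section \<open>Transfer to a given system\<close>

definition enc_set :: "nat set \<Rightarrow> real" where
  "enc_set A = enc_list (sorted_list_of_set A)"

lemma dec_enc_set: "finite A \<Longrightarrow> set (dec_list (enc_set A)) = A"
  by (simp add: enc_set_def)

fun code :: "jsq_data \<Rightarrow> source \<Rightarrow> real" where
  "code w Init = enc_list (init w)"
| "code w (Gap k) = gap w k"
| "code w (Service q m) = service w q m"
| "code w (Sample k) = enc_set (sample w k)"
| "code w (Priority k) = enc_list (priority w k)"

fun law :: "'a measure \<Rightarrow> nat \<Rightarrow> real \<Rightarrow> nat \<Rightarrow> ('a \<Rightarrow> jsq_data) \<Rightarrow> source \<Rightarrow> real measure" where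
  "law M n lam d W Init = distr M borel (\<lambda>\<omega>. enc_list (init (W \<omega>)))"
| "law M n lam d W (Gap k) = density lborel (exponential_density (real n * lam))"
| "law M n lam d W (Service q m) = density lborel (exponential_density 1)"
| "law M n lam d W (Sample k) =
     distr (uniform_count_measure {A. A \<subseteq> {..<n} \<and> card A = d}) borel enc_set"
| "law M n lam d W (Priority k) =
     distr (uniform_count_measure (permutations_of_set {..<n})) borel enc_list"

lemma measurable_uniform_count [measurable]:
  "f \<in> measurable (uniform_count_measure A) borel"
  by (simp add: measurable_def space_uniform_count_measure sets_uniform_count_measure)

text \<open>Sampling without replacement misses a set no more often than sampling with replacement:
  factor by factor, (m - i) / (n - i) is at most m / n.\<close>

lemma choose_ratio:
  assumes "m \<le> n" "d \<le> n" "0 < n"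
  shows "real (m choose d) / real (n choose d) \<le> (real m / real n) ^ d"
proof (cases "d \<le> m")
  case True
  have "real (m choose d) = (\<Prod>i<d. real (m - i) / real (d - i))"
    using binomial_altdef_of_nat[OF True, where 'a = real] by (simp add: atLeast0LessThan)
  also have "\<dots> \<le> (\<Prod>i<d. real m / real n * (real (n - i) / real (d - i)))"
  proof (rule prod_mono)
    fix i assume "i \<in> {..<d}"
    then have i: "i < d" "i \<le> m" "i \<le> n" using True assms by auto
    have "real i * real m \<le> real i * real n" using assms by (intro mult_left_mono) auto
    then have "real (m - i) \<le> real m / real n * real (n - i)"
      using assms i by (simp add: of_nat_diff field_simps)
    then show "0 \<le> real (m - i) / real (d - i) \<and>
        real (m - i) / real (d - i) \<le> real m / real n * (real (n - i) / real (d - i))"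
      using divide_right_mono[of "real (m - i)" "real m / real n * real (n - i)" "real (d - i)"] by simp
  qed
  also have "\<dots> = (real m / real n) ^ d * (\<Prod>i<d. real (n - i) / real (d - i))"
    by (simp only: prod.distrib prod_constant card_lessThan)
  also have "(\<Prod>i<d. real (n - i) / real (d - i)) = real (n choose d)"
    using binomial_altdef_of_nat[OF assms(2), where 'a = real] by (simp add: atLeast0LessThan)
  finally show ?thesis using assms zero_less_binomial[of d n] by (simp add: divide_le_eq)
next
  case False
  then show ?thesis by (simp add: binomial_eq_0)
qed

locale jsq =
  fixes M :: "'a measure" and n :: nat and lam :: real and d :: nat and W :: "'a \<Rightarrow> jsq_data"
  assumes sys: "jsq_system M n lam d W" and n: "1 \<le> n" and lam: "0 < lam" and d: "d \<in> {1..n}"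
begin

sublocale prob_space M
  using sys by (simp add: jsq_system_def)

abbreviation law_of_sources :: "source \<Rightarrow> real measure" (\<open>\<nu>\<close>) where
  "\<nu> \<equiv> law M n lam d W"

abbreviation samples :: "nat set set" where
  "samples \<equiv> {A. A \<subseteq> {..<n} \<and> card A = d}"

lemma finite_samples: "finite samples" (is "finite ?A")
  and samples_ne: "samples \<noteq> {}"
  and card_samples: "card samples = n choose d"
proof -
  show "finite ?A" by (rule finite_subset[of _ "Pow {..<n}"]) auto
  show *: "card ?A = n choose d" using n_subsets[of "{..<n}" d] by simp
  have "0 < n choose d" using d by (intro zero_less_binomial) auto
  then show "?A \<noteq> {}" using * by fastforce
qed

lemma init_measurable: "(\<lambda>\<omega>. init (W \<omega>)) \<in> measurable M (count_space UNIV)"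
  and init_length: "\<omega> \<in> space M \<Longrightarrow> length (init (W \<omega>)) = n"
proof -
  have *: "(\<lambda>\<omega>. init (W \<omega>)) \<in> measurable M (count_space {qs. length qs = n})"
    using sys by (simp add: jsq_system_def)
  show "(\<lambda>\<omega>. init (W \<omega>)) \<in> measurable M (count_space UNIV)"
    using measurable_compose[OF *, of "\<lambda>x. x" "count_space UNIV"] by simp
  show "\<omega> \<in> space M \<Longrightarrow> length (init (W \<omega>)) = n"
    using measurable_space[OF *] by auto
qed

lemma sample_distr:
  "(\<lambda>\<omega>. sample (W \<omega>) k) \<in> measurable M (count_space samples)"
  "distr M (count_space samples) (\<lambda>\<omega>. sample (W \<omega>) k) =
     uniform_count_measure samples"
  using sys by (simp_all add: jsq_system_def uniform_rv_def)

lemma priority_distr: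
  "(\<lambda>\<omega>. priority (W \<omega>) k) \<in> measurable M (count_space (permutations_of_set {..<n}))"
  "distr M (count_space (permutations_of_set {..<n})) (\<lambda>\<omega>. priority (W \<omega>) k) =
     uniform_count_measure (permutations_of_set {..<n})"
  using sys by (simp_all add: jsq_system_def uniform_rv_def)

lemma code_law:
  assumes x: "x \<in> sources n"
  shows "(\<lambda>\<omega>. code (W \<omega>) x) \<in> borel_measurable M" and "distr M borel (\<lambda>\<omega>. code (W \<omega>) x) = \<nu> x"
proof -
  have gen: "(\<lambda>\<omega>. f (Y \<omega>)) \<in> borel_measurable M \<and> distr M borel (\<lambda>\<omega>. f (Y \<omega>)) = distr (uniform_count_measure A) borel f"
    if Y: "Y \<in> measurable M (count_space A)" "distr M (count_space A) Y = uniform_count_measure A" for Y A and f :: "_ \<Rightarrow> real"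
    using Y distr_distr[of f "count_space A" borel Y M] measurable_compose[OF Y(1), of f borel] by (simp add: comp_def)
  have ex: "Y \<in> borel_measurable M \<and> distr M borel Y = density lborel (exponential_density l)"
    if "distributed M lborel Y (exponential_density l)" for Y :: "'a \<Rightarrow> real" and l
    using that distr_cong[OF refl sets_lborel, of M Y Y] by (simp add: distributed_def)
  have "(\<lambda>\<omega>. code (W \<omega>) x) \<in> borel_measurable M \<and> distr M borel (\<lambda>\<omega>. code (W \<omega>) x) = \<nu> x"
  proof (cases x)
    case Init
    then show ?thesis using measurable_compose[OF init_measurable, of enc_list borel] by simp
  next
    case (Gap k)
    have "distributed M lborel (\<lambda>\<omega>. gap (W \<omega>) k) (exponential_density (real n * lam))"
      using sys by (simp add: jsq_system_def)
    from ex[OF this] show ?thesis using Gap by simp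
  next
    case (Service q m)
    have "distributed M lborel (\<lambda>\<omega>. service (W \<omega>) q m) (exponential_density 1)"
      using sys x Service by (simp add: jsq_system_def)
    from ex[OF this] show ?thesis using Service by simp
  next
    case (Sample k)
    then show ?thesis using gen[OF sample_distr] by simp
  next
    case (Priority k)
    then show ?thesis using gen[OF priority_distr] by simp
  qed
  then show "(\<lambda>\<omega>. code (W \<omega>) x) \<in> borel_measurable M" "distr M borel (\<lambda>\<omega>. code (W \<omega>) x) = \<nu> x"
    by auto
qed

lemma law_prob: "prob_space (\<nu> x)"
proof (cases x)
  case Init
  have "(\<lambda>\<omega>. enc_list (init (W \<omega>))) \<in> borel_measurable M"
    using measurable_compose[OF init_measurable, of enc_list borel] by simp
  then show ?thesis using Init prob_space_distr by simp
next
  case (Sample k)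
  then show ?thesis
    using finite_samples samples_ne by (auto intro!: prob_space.prob_space_distr prob_space_uniform_count_measure)
next
  case (Priority k)
  then show ?thesis
    by (auto intro!: prob_space.prob_space_distr prob_space_uniform_count_measure)
qed (use n lam in \<open>auto intro!: prob_space_exponential_density\<close>)

lemma AE_law_iff:
  assumes "f \<in> borel_measurable N"
  shows "(AE a in distr N borel f. Q (dec_list a)) \<longleftrightarrow> (AE x in N. Q (dec_list (f x)))"
proof (rule AE_distr_iff[OF assms])
  show "{x \<in> space borel. Q (dec_list x)} \<in> sets borel"
    using measurable_sets[OF dec_list_measurable, of "{l. Q l}"] by (simp add: vimage_def)
qed

sublocale C: jsq_canonical n "real n * lam" \<nu>
proof (intro jsq_canonical.intro jsq_law.intro jsq_canonical_axioms.intro)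
  show "sets (\<nu> x) = sets borel" for x by (cases x) auto
  have "AE A in uniform_count_measure samples.
      dec_list (enc_set A) \<noteq> [] \<and> set (dec_list (enc_set A)) \<subseteq> {..<n}"
  proof (rule AE_I2)
    fix A assume "A \<in> space (uniform_count_measure samples)"
    then have A: "A \<subseteq> {..<n}" "card A = d" by (auto simp: space_uniform_count_measure)
    then have "set (dec_list (enc_set A)) = A"
      by (intro dec_enc_set) (auto intro: finite_subset)
    moreover have "A \<noteq> {}" using A d by auto
    ultimately show "dec_list (enc_set A) \<noteq> [] \<and> set (dec_list (enc_set A)) \<subseteq> {..<n}"
      using A by auto
  qed
  then show "AE a in \<nu> (Sample 0). dec_list a \<noteq> [] \<and> set (dec_list a) \<subseteq> {..<n}"
    unfolding law.simps
    by (intro AE_law_iff[where Q = "\<lambda>l. l \<noteq> [] \<and> set l \<subseteq> {..<n}", THEN iffD2]) simp_all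
  have "AE p in uniform_count_measure (permutations_of_set {..<n}). set (dec_list (enc_list p)) = {..<n}"
    by (rule AE_I2) (auto simp: space_uniform_count_measure permutations_of_set_def)
  then show "AE a in \<nu> (Priority 0). set (dec_list a) = {..<n}"
    unfolding law.simps
    by (intro AE_law_iff[where Q = "\<lambda>l. set l = {..<n}", THEN iffD2]) simp_all
qed (use n lam law_prob in simp_all)

text \<open>A sample that avoids \<open>A\<close> is a subset of the complement, which gives a ratio
  of binomial coefficients. With \<open>b\<close> proportional to n the bound decays geometrically
  in \<open>d\<close>; here the growth of the sample size takes effect.\<close>

lemma miss_probability:
  assumes "A \<subseteq> {..<n}" "b < card A"
  shows "emeasure (\<nu> (Sample 0)) {a. set (dec_list a) \<inter> A = {}} \<le> ennreal ((1 - real b / real n) ^ d)"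
proof -
  let ?S = "samples"
  have sets: "{a. set (dec_list a) \<inter> A = {}} \<in> sets borel"
    using measurable_sets[OF dec_list_measurable, of "{l. set l \<inter> A = {}}"] by (simp add: vimage_def)
  have dec: "set (dec_list (enc_set B)) = B" if "B \<subseteq> {..<n}" for B
    using finite_subset[OF that] by (intro dec_enc_set) simp
  have "enc_set -` {a. set (dec_list a) \<inter> A = {}} \<inter> ?S = {B. B \<subseteq> {..<n} \<and> card B = d \<and> B \<inter> A = {}}"
  proof (intro set_eqI)
    fix B
    show "B \<in> enc_set -` {a. set (dec_list a) \<inter> A = {}} \<inter> ?S \<longleftrightarrow> B \<in> {B. B \<subseteq> {..<n} \<and> card B = d \<and> B \<inter> A = {}}"
      by (cases "B \<subseteq> {..<n}") (auto simp: dec)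
  qed
  also have "\<dots> = {B. B \<subseteq> {..<n} - A \<and> card B = d}" by blast
  finally have "enc_set -` {a. set (dec_list a) \<inter> A = {}} \<inter> ?S = {B. B \<subseteq> {..<n} - A \<and> card B = d}" .
  then have "emeasure (\<nu> (Sample 0)) {a. set (dec_list a) \<inter> A = {}} =
      emeasure (uniform_count_measure ?S) {B. B \<subseteq> {..<n} - A \<and> card B = d}"
    unfolding law.simps by (subst emeasure_distr) (auto simp: sets space_uniform_count_measure)
  also have "\<dots> = ennreal (real ((n - card A) choose d) / real (n choose d))"
  proof -
    have "card {B. B \<subseteq> {..<n} - A \<and> card B = d} = (n - card A) choose d"
      using n_subsets[of "{..<n} - A" d] assms(1) by (simp add: card_Diff_subset finite_subset)
    then show ?thesis
      using finite_samples samples_ne by (subst emeasure_uniform_count_measure) (auto simp: card_samples)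
  qed
  also have "\<dots> \<le> ennreal ((real (n - card A) / real n) ^ d)"
    using n d by (intro ennreal_leI choose_ratio) auto
  also have "\<dots> \<le> ennreal ((1 - real b / real n) ^ d)"
  proof (intro ennreal_leI power_mono)
    have "card A \<le> n" using card_mono[OF _ assms(1)] by simp
    then show "real (n - card A) / real n \<le> 1 - real b / real n"
      using assms(2) n by (simp add: of_nat_diff field_simps)
  qed simp
  finally show ?thesis .
qed

section \<open>Transfer of laws, events and initial state\<close>

definition coords :: "'a \<Rightarrow> source \<Rightarrow> real" where
  "coords \<omega> = (\<lambda>x\<in>sources n. code (W \<omega>) x)"

text \<open>Independence is given for the generated \<sigma>-algebras. A coded source is a function
  of the source, so its events lie in the \<sigma>-algebra of that source.\<close>

lemma indep_code: "indep_vars (\<lambda>_. borel) (\<lambda>x \<omega>. code (W \<omega>) x) (sources n)"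
  unfolding indep_vars_def2
proof (intro conjI ballI)
  have "indep_sets (source_events M W) (sources n)"
    using sys by (simp add: jsq_system_def)
  then show "indep_sets (\<lambda>x. {(\<lambda>\<omega>. code (W \<omega>) x) -` A \<inter> space M | A. A \<in> sets borel}) (sources n)"
  proof (rule indep_sets_mono_sets)
    fix x assume x: "x \<in> sources n"
    have gen: "{(\<lambda>\<omega>. f (Y \<omega>)) -` A \<inter> space M | A. A \<in> sets borel} \<subseteq> sets (vimage_algebra (space M) Y N)"
      if "f \<in> borel_measurable N" "space N = UNIV" for f :: "_ \<Rightarrow> real" and Y N
    proof safe
      fix A :: "real set" assume "A \<in> sets borel"
      then have "f -` A \<in> sets N" using measurable_sets[OF that(1)] that(2) by simp
      then show "(\<lambda>\<omega>. f (Y \<omega>)) -` A \<inter> space M \<in> sets (vimage_algebra (space M) Y N)"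
        using in_vimage_algebra[of "f -` A" N Y "space M"] by (simp add: vimage_def)
    qed
    show "{(\<lambda>\<omega>. code (W \<omega>) x) -` A \<inter> space M | A. A \<in> sets borel} \<subseteq> source_events M W x"
    proof (cases x)
      case Init
      then show ?thesis using gen[of enc_list "count_space UNIV" "\<lambda>\<omega>. init (W \<omega>)"] by (simp add: source_events_def)
    next
      case (Gap k)
      then show ?thesis using gen[of "\<lambda>x. x" borel "\<lambda>\<omega>. gap (W \<omega>) k"] by (simp add: source_events_def)
    next
      case (Service q m)
      then show ?thesis using gen[of "\<lambda>x. x" borel "\<lambda>\<omega>. service (W \<omega>) q m"] by (simp add: source_events_def)
    next
      case (Sample k)
      then show ?thesis using gen[of enc_set "count_space UNIV" "\<lambda>\<omega>. sample (W \<omega>) k"] by (simp add: source_events_def)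
    next
      case (Priority k)
      then show ?thesis using gen[of enc_list "count_space UNIV" "\<lambda>\<omega>. priority (W \<omega>) k"] by (simp add: source_events_def)
    qed
  qed
qed (rule code_law)

lemma coords_measurable: "coords \<in> measurable M C.\<mu>"
proof -
  have "coords \<in> measurable M (PiM (sources n) (\<lambda>_. borel))"
    unfolding coords_def by (intro measurable_restrict code_law)
  then show ?thesis using measurable_cong_sets[OF refl C.sets_mu] by blast
qed

lemma distr_coords: "distr M C.\<mu> coords = C.\<mu>"
proof -
  have "distr M C.\<mu> coords = distr M (PiM (sources n) (\<lambda>_. borel)) coords"
    by (rule distr_cong) (auto simp: C.sets_mu)
  also have "\<dots> = PiM (sources n) (\<lambda>x. distr M borel (\<lambda>\<omega>. code (W \<omega>) x))"
    using indep_vars_iff_distr_eq_PiM'[where I = "sources n" and M' = "\<lambda>_. borel" and X = "\<lambda>x \<omega>. code (W \<omega>) x"] indep_code code_law(1)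
    by (auto simp: coords_def[abs_def] sources_def)
  also have "\<dots> = C.\<mu>"
    unfolding C.\<mu>_def by (intro PiM_cong refl code_law(2))
  finally show ?thesis .
qed

lemma AE_coords: "AE \<omega> in C.\<mu>. Q \<omega> \<Longrightarrow> AE \<omega> in M. Q (coords \<omega>)"
  by (rule AE_distrD[OF coords_measurable]) (simp only: distr_coords)

lemma queue_length_coords:
  assumes "\<omega> \<in> space M" "regular n (coords \<omega>)" "q < n"
  shows "queue_length (dat (init (W \<omega>)) (coords \<omega>)) q t = queue_length (W \<omega>) q t"
proof -
  let ?w = "dat (init (W \<omega>)) (coords \<omega>)"
  have sample: "set (dec_list (enc_set (sample (W \<omega>) k))) = sample (W \<omega>) k" for k
    using measurable_space[OF sample_distr(1)[of k] assms(1)]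
    by (intro dec_enc_set) (auto intro: finite_subset)
  have eq: "init ?w = init (W \<omega>)" "gap ?w = gap (W \<omega>)" "sample ?w = sample (W \<omega>)" "priority ?w = priority (W \<omega>)"
    "\<And>q m. q < n \<Longrightarrow> service (W \<omega>) q m = service ?w q m"
    by (auto simp: coords_def sample)
  have reg: "sample ?w k \<noteq> {}" "sample ?w k \<subseteq> {..<n}" "set (priority ?w k) = {..<n}" for k
    using assms(2) by (auto simp: regular_def)
  have "departures (W \<omega>) k q = departures ?w k q" for k
    by (rule departures_cong[OF eq(1-4)[symmetric] eq(5) reg assms(3)])
  moreover have "arrivals ?w t = arrivals (W \<omega>) t"
    by (simp add: arrivals_def arrival_time_def eq(2))
  ultimately show ?thesis by (simp add: queue_length_def)
qed

lemma AE_init_coords: "AE \<omega> in C.\<mu>. length (dec_list (\<omega> Init)) = n"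
proof (rule C.AE_component)
  show "AE a in \<nu> Init. length (dec_list a) = n"
    unfolding law.simps
    by (subst AE_law_iff) (auto simp: init_length intro!: AE_I2 measurable_compose[OF init_measurable])
qed simp

text \<open>The event quantifies over uncountably many times but agrees almost surely with the
  preimage of \<open>overload\<close>; hence it belongs to the completion and has the same measure
  there.\<close>

lemma overload_event:
  fixes K :: nat
  assumes "0 \<le> T"
  defines "B \<equiv> {\<omega> \<in> space M. \<exists>t\<in>{0..T}. K \<le> total_jobs n (W \<omega>) t}"
  shows "measure (completion M) B = C.mu.prob (C.overload K T)"
proof -
  define A where "A = coords -` C.overload K T \<inter> space M"
  have A: "A \<in> sets M"
    unfolding A_def by (rule measurable_sets[OF coords_measurable C.overload_sets])
  have ae: "AE \<omega> in M. \<omega> \<in> A \<longleftrightarrow> \<omega> \<in> B"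
    using AE_coords[OF C.AE_overload_iff[OF assms(1) AE_init_coords, of K]] AE_coords[OF C.AE_regular] AE_space
  proof eventually_elim
    case (elim \<omega>)
    have "dec_list (coords \<omega> Init) = init (W \<omega>)" by (simp add: coords_def)
    then have "total_jobs n (dat (dec_list (coords \<omega> Init)) (coords \<omega>)) t = total_jobs n (W \<omega>) t" for t
      using queue_length_coords[OF elim(3,2)] by (simp add: total_jobs_def)
    then show ?case using elim(1,3) by (simp add: A_def B_def)
  qed
  have aec: "AE \<omega> in completion M. \<omega> \<in> A \<longleftrightarrow> \<omega> \<in> B"
    by (rule AE_completion[OF ae])
  have B: "B \<in> sets (completion M)"
    using completion.in_sets_AE[OF aec] A by (auto simp: B_def)
  have "measure (completion M) B = measure (completion M) A"
    unfolding measure_def using aec A B by (intro arg_cong[where f = enn2real] emeasure_eq_AE) auto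
  also have "\<dots> = measure M A" using A by simp
  also have "\<dots> = C.mu.prob (C.overload K T)"
    unfolding A_def using measure_distr[OF coords_measurable, of "C.overload K T"] C.overload_sets
    by (simp add: distr_coords)
  finally show ?thesis .
qed

text \<open>Summation by layers: a queue of length k is counted once for each i = 1, ..., k. Terms
  beyond \<open>m\<close>, the total number of jobs, vanish, so the infinite sum becomes
  finite.\<close>

lemma l1_norm_occupancy: "l1_norm (occupancy n w t) = real (total_jobs n w t) / real n"
proof -
  define m where "m = (\<Sum>q<n. queue_length w q t)"
  have Qm: "queue_length w q t \<le> m" if "q < n" for q
    unfolding m_def using that by (intro member_le_sum) auto
  have occ: "occupancy n w t i = (\<Sum>q<n. of_bool (i \<le> queue_length w q t)) / real n" for i
  proof -
    have "{q. q < n \<and> i \<le> queue_length w q t} = {..<n} \<inter> {q. i \<le> queue_length w q t}" by auto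
    then show ?thesis by (simp add: occupancy_def sum_of_bool_eq)
  qed
  have "l1_norm (occupancy n w t) = infsum (\<lambda>i. \<bar>occupancy n w t i\<bar>) {1..m}"
    unfolding l1_norm_def
  proof (rule infsum_cong_neutral)
    fix i assume "i \<in> {1..} - {1..m}"
    then have "\<not> i \<le> queue_length w q t" if "q < n" for q using Qm[OF that] by auto
    then have "{q. q < n \<and> i \<le> queue_length w q t} = {}" by blast
    then show "\<bar>occupancy n w t i\<bar> = 0" by (simp add: occupancy_def)
  qed auto
  also have "\<dots> = (\<Sum>i\<in>{1..m}. (\<Sum>q<n. of_bool (i \<le> queue_length w q t)) / real n)"
    by (simp add: occ sum_nonneg)
  also have "\<dots> = (\<Sum>q<n. \<Sum>i\<in>{1..m}. of_bool (i \<le> queue_length w q t)) / real n"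
    unfolding sum_divide_distrib[symmetric] by (subst sum.swap) simp
  also have "(\<Sum>q<n. \<Sum>i\<in>{1..m}. of_bool (i \<le> queue_length w q t)) = (\<Sum>q<n. real (queue_length w q t))"
  proof (rule sum.cong[OF refl])
    fix q assume "q \<in> {..<n}"
    then have "{1..m} \<inter> {i. i \<le> queue_length w q t} = {1..queue_length w q t}"
      using Qm[of q] by auto
    then show "(\<Sum>i\<in>{1..m}. of_bool (i \<le> queue_length w q t)) = real (queue_length w q t)"
      by (simp add: sum_of_bool_eq)
  qed
  finally show ?thesis by (simp add: total_jobs_def)
qed

text \<open>The occupancy determines the initial queue lengths only up to a permutation of the
  servers, but this fixes the numbers of jobs and of idle servers, which are all that the two bounds
  need. Almost surely no event occurs at time 0, so the occupancy at that time is that of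
  \<open>init\<close>.\<close>

lemma initial_state:
  assumes "AE \<omega> in M. \<forall>i\<ge>1. occupancy n (W \<omega>) 0 i = x0 i"
  obtains N I where "real N = real n * l1_norm x0" "real I = real n * (1 - x0 1)"
    "AE \<omega> in C.\<mu>. length (dec_list (\<omega> Init)) = n \<and> sum_list (dec_list (\<omega> Init)) = N \<and> card (idle (dec_list (\<omega> Init))) = I"
proof -
  have no_tie: "AE \<omega> in C.\<mu>. length c = n \<longrightarrow> \<not> tie c \<omega>" for c
    using C.AE_not_tie[of c] by (cases "length c = n") auto
  then have no_tie: "AE \<omega> in C.\<mu>. \<forall>c. length c = n \<longrightarrow> \<not> tie c \<omega>"
    by (subst AE_all_countable) auto
  have ae: "AE \<omega> in M. real (sum_list (init (W \<omega>))) = real n * l1_norm x0 \<and>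
      real (card (idle (init (W \<omega>)))) = real n * (1 - x0 1)"
    using assms AE_coords[OF no_tie] AE_coords[OF C.AE_regular] AE_space
  proof eventually_elim
    case (elim \<omega>)
    let ?c = "init (W \<omega>)"
    have len: "length ?c = n" using elim init_length by blast
    then obtain i where i: "first_clock ?c (coords \<omega>) i" using elim ex_first_clock by blast
    have ql: "queue_length (W \<omega>) q 0 = ?c ! q" if "q < n" for q
      using before_first_clock(2)[of ?c "coords \<omega>" i "coords \<omega> i" 0 q] first_clock_pos[of ?c "coords \<omega>" i]
        i elim that len queue_length_coords[OF elim(4,3) that] by simp
    have "l1_norm x0 = l1_norm (occupancy n (W \<omega>) 0)"
      unfolding l1_norm_def using elim(1) by (intro infsum_cong) auto
    also have "\<dots> = real (sum_list ?c) / real n"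
      using ql len by (simp add: l1_norm_occupancy total_jobs_def sum_list_sum_nth atLeast0LessThan)
    finally have 1: "real (sum_list ?c) = real n * l1_norm x0" using n by simp
    have "x0 1 = occupancy n (W \<omega>) 0 1" using elim(1) by simp
    also have "{q. q < n \<and> 1 \<le> queue_length (W \<omega>) q 0} = {q. q < length ?c \<and> 0 < ?c ! q}"
      using ql len by auto
    then have "occupancy n (W \<omega>) 0 1 = real (n - card (idle ?c)) / real n"
      using card_busy[of ?c] len by (simp add: occupancy_def)
    finally have "x0 1 = real (n - card (idle ?c)) / real n" .
    moreover have "card (idle ?c) \<le> n"
      using card_mono[of "{..<n}" "idle ?c"] len by (auto simp: idle_def)
    ultimately have "real (card (idle ?c)) = real n * (1 - x0 1)"
      using n by (simp add: of_nat_diff field_simps)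
    with 1 show ?case by simp
  qed
  \<comment> \<open>That the two real numbers are natural is read off from a single outcome in the
    almost sure event.\<close>
  have "\<exists>\<omega>\<in>space M. real (sum_list (init (W \<omega>))) = real n * l1_norm x0 \<and>
      real (card (idle (init (W \<omega>)))) = real n * (1 - x0 1)"
  proof (rule ccontr)
    assume neg: "\<not> ?thesis"
    have "AE \<omega> in M. False" using ae AE_space by eventually_elim (use neg in blast)
    then show False by simp
  qed
  then obtain N I where NI: "real N = real n * l1_norm x0" "real I = real n * (1 - x0 1)" by blast
  define Q where "Q = (\<lambda>l::nat list. length l = n \<and> sum_list l = N \<and> card (idle l) = I)"
  have "AE \<omega> in M. Q (init (W \<omega>))"
    using ae AE_space
  proof eventually_elim
    case (elim \<omega>)
    then have "real (sum_list (init (W \<omega>))) = real N" "real (card (idle (init (W \<omega>)))) = real I"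
      using NI by simp_all
    then show ?case using elim init_length by (simp add: Q_def)
  qed
  then have "AE a in \<nu> Init. Q (dec_list a)"
    unfolding law.simps
    by (subst AE_law_iff) (auto intro!: measurable_compose[OF init_measurable])
  then have "AE \<omega> in C.\<mu>. Q (dec_list (\<omega> Init))"
    by (intro C.AE_component[where Q = "\<lambda>a. Q (dec_list a)"]) auto
  then show thesis using that[OF NI] by (simp add: Q_def)
qed

end

section \<open>Asymptotics\<close>

text \<open>The upper half of Stirling's formula, with an error of order ln k that is negligible
  after division by n. \<open>Suc k\<close> avoids the logarithm of 0.\<close>

lemma ln_fact_le: "ln (fact (Suc k) :: real) \<le> real (Suc k) * ln (real (Suc k)) - real (Suc k) + ln (real (Suc k)) + 1"
proof (induction k)
  case (Suc k)
  define x where "x = real (Suc k)"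
  have x: "0 < x" by (simp add: x_def)
  have "ln (x / (x + 1)) \<le> x / (x + 1) - 1" using x by (intro ln_le_minus_one) simp
  also have "\<dots> = - (1 / (x + 1))" using x by (simp add: field_simps)
  finally have "1 / (x + 1) \<le> ln (x + 1) - ln x" using x by (simp add: ln_div)
  then have "1 \<le> (x + 1) * (ln (x + 1) - ln x)" using x by (simp add: field_simps)
  moreover have "ln (fact (Suc (Suc k)) :: real) = ln (x + 1) + ln (fact (Suc k))"
  proof -
    have "(fact (Suc (Suc k)) :: real) = (x + 1) * fact (Suc k)"
      unfolding fact_Suc[of "Suc k"] by (simp add: x_def)
    then show ?thesis using x by (simp add: ln_mult del: fact_Suc)
  qed
  ultimately show ?case
    using Suc.IH by (simp only: x_def[symmetric] of_nat_Suc[of "Suc k"]) (simp add: algebra_simps)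
qed simp

lemma poisson_mass_pos: "0 < x \<Longrightarrow> 0 < poisson_mass x k"
  by (simp add: poisson_mass_def)

lemma ln_poisson_mass_ge:
  assumes "0 < x" "0 < k"
  shows "real k * (ln x - ln (real k) + 1) - x - ln (real k) - 1 \<le> ln (poisson_mass x k)"
proof -
  have "ln (poisson_mass x k) = - x + real k * ln x - ln (fact k)"
    using assms by (simp add: poisson_mass_def ln_div ln_mult ln_realpow)
  moreover obtain j where "k = Suc j" using assms by (cases k) auto
  ultimately show ?thesis using ln_fact_le[of j] by (simp add: algebra_simps)
qed

text \<open>The limit is - x' \<open>ell (y / x')\<close>, the Poisson large deviation rate,
  attained here by an explicit minorant \<open>l\<close>; for the lower bound no more is
  required.\<close>

lemma poisson_mass_rate:
  fixes x :: "nat \<Rightarrow> real" and k :: "nat \<Rightarrow> nat"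
  assumes x: "x \<longlonglongrightarrow> x'" "0 < x'" and k: "(\<lambda>n. real (k n) / real n) \<longlonglongrightarrow> y" "0 < y"
  obtains l where "l \<longlonglongrightarrow> y * (ln x' - ln y + 1) - x'"
    "eventually (\<lambda>n. l n \<le> ln (poisson_mass (real n * x n) (k n)) / real n) sequentially"
proof
  define z where "z n = real (k n) / real n" for n
  define l where "l n = z n * (ln (x n) - ln (z n) + 1) - x n - (ln (z n) / real n + ln (real n) / real n + 1 / real n)" for n
  have z: "z \<longlonglongrightarrow> y" using k(1) by (simp add: z_def[abs_def])
  have "(\<lambda>n. ln (real n) / real n) \<longlonglongrightarrow> 0" by real_asymp
  moreover have "(\<lambda>n. ln (z n) * (1 / real n)) \<longlonglongrightarrow> ln y * 0"
    using z k(2) by (intro tendsto_intros lim_1_over_n) auto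
  ultimately have "l \<longlonglongrightarrow> y * (ln x' - ln y + 1) - x' - (0 + 0 + 0)"
    unfolding l_def[abs_def] using z x k(2) by (intro tendsto_intros lim_1_over_n) auto
  then show "l \<longlonglongrightarrow> y * (ln x' - ln y + 1) - x'" by simp
  have "eventually (\<lambda>n. 0 < z n) sequentially" using order_tendstoD(1)[OF z k(2)] .
  moreover have "eventually (\<lambda>n. 0 < x n) sequentially" using order_tendstoD(1)[OF x] .
  ultimately show "eventually (\<lambda>n. l n \<le> ln (poisson_mass (real n * x n) (k n)) / real n) sequentially"
    using eventually_gt_at_top[of "0::nat"]
  proof eventually_elim
    case (elim n)
    then have n: "0 < real n" and kn: "0 < k n" by (auto simp: z_def intro: gr0I)
    have kz: "real (k n) = real n * z n" using n by (simp add: z_def)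
    have "real n * l n = real (k n) * (ln (real n * x n) - ln (real (k n)) + 1) - real n * x n - ln (real (k n)) - 1"
      unfolding kz l_def using elim n by (simp add: ln_mult field_simps)
    also have "\<dots> \<le> ln (poisson_mass (real n * x n) (k n))"
      using elim n kn by (intro ln_poisson_mass_ge) auto
    finally show ?case using n by (simp add: field_simps)
  qed
qed

text \<open>\<theta> is arsinh (u / 2). The two expressions in the theorem are reciprocal, their
  product being ((4 + u^2) - u^2) / 4 = 1.\<close>

lemma exponents:
  fixes u :: real
  assumes "0 < u"
  defines "\<theta> \<equiv> ln ((u + sqrt (4 + u\<^sup>2)) / 2)"
  shows "exp \<theta> = (u + sqrt (4 + u\<^sup>2)) / 2" and "exp (- \<theta>) = (- u + sqrt (4 + u\<^sup>2)) / 2"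
    and "exp \<theta> - exp (- \<theta>) = u" and "0 \<le> \<theta>"
proof -
  have s: "2 \<le> sqrt (4 + u\<^sup>2)" by (rule real_le_rsqrt) simp
  then have pos: "0 < (u + sqrt (4 + u\<^sup>2)) / 2" using assms by simp
  then show 1: "exp \<theta> = (u + sqrt (4 + u\<^sup>2)) / 2" by (simp add: \<theta>_def)
  have "((u + sqrt (4 + u\<^sup>2)) / 2) * ((- u + sqrt (4 + u\<^sup>2)) / 2) = ((sqrt (4 + u\<^sup>2))\<^sup>2 - u\<^sup>2) / 4"
    by (simp add: power2_eq_square field_simps)
  also have "\<dots> = 1" by simp
  finally show 2: "exp (- \<theta>) = (- u + sqrt (4 + u\<^sup>2)) / 2"
    using pos unfolding exp_minus 1 by (metis inverse_unique)
  show "exp \<theta> - exp (- \<theta>) = u" unfolding 1 2 by (simp add: field_simps)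
  show "0 \<le> \<theta>" using s assms by (simp add: \<theta>_def)
qed

text \<open>\<open>ell\<close> at e^\<theta> is \<theta> e^\<theta> - e^\<theta> + 1, and likewise
  at e^-\<theta>; the terms with \<theta> combine to \<theta> eps / T. The right-hand side is the
  optimised Chernoff exponent, the form in which both bounds arrive.\<close>

lemma rate_function_eq:
  fixes eps T :: real
  assumes "0 < eps" "0 < T"
  defines "\<theta> \<equiv> ln ((eps / T + sqrt (4 + (eps / T)\<^sup>2)) / 2)"
  shows "- T * ell ((eps / T + sqrt (4 + (eps / T)\<^sup>2)) / 2) - T * ell ((- (eps / T) + sqrt (4 + (eps / T)\<^sup>2)) / 2) =
    T * (exp \<theta> + exp (- \<theta>) - 2) - \<theta> * eps"
proof -
  have u: "0 < eps / T" using assms by simp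
  note e = exponents[OF u, folded \<theta>_def]
  have "T * (exp \<theta> - exp (- \<theta>)) = eps" unfolding e(3) using assms by simp
  then have "- T * ell (exp \<theta>) - T * ell (exp (- \<theta>)) = T * (exp \<theta> + exp (- \<theta>) - 2) - \<theta> * eps"
    by (simp add: ell_def algebra_simps)
  then show ?thesis unfolding e(1,2) .
qed

text \<open>For large T, \<theta> is about eps / (2 T), so the exponent is about T \<theta>^2 -
  \<theta> eps = - eps^2 / (4 T).\<close>

lemma rate_function_limit:
  fixes eps :: real
  assumes "0 < eps"
  shows "((\<lambda>T. T * (- T * ell ((eps / T + sqrt (4 + (eps / T)\<^sup>2)) / 2)
      - T * ell ((- (eps / T) + sqrt (4 + (eps / T)\<^sup>2)) / 2))) \<longlongrightarrow> - (eps\<^sup>2 / 4)) at_top"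
  unfolding ell_def using assms by real_asymp (simp add: power2_eq_square)

text \<open>With E = e^(\<theta> \<beta>) the leading part is E + 1 / E - 2. Since E + 1 / E
  increases for E at least 1, it is at most e^\<theta> + e^-\<theta> - 2. The rest is collected in
  \<open>err\<close>, which does not depend on \<beta> and tends to 2 \<delta>.\<close>

lemma drift_eventually:
  fixes lam :: "nat \<Rightarrow> real" and d b :: "nat \<Rightarrow> nat" and \<theta> \<eta> \<delta> :: real
  assumes lam: "lam \<longlonglongrightarrow> 1" "\<forall>n\<ge>1. 0 < lam n" and d: "filterlim d at_top sequentially"
    and \<theta>: "0 \<le> \<theta>" and \<delta>: "0 < \<delta>" "\<delta> \<le> 1 / 4" "2 * \<delta> < \<eta>"
  defines "b \<equiv> \<lambda>n. nat \<lfloor>\<delta> * real n\<rfloor>"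
  shows "eventually (\<lambda>n. 0 < b n \<and> 2 * b n \<le> n \<and> \<delta> / 2 * real n < real (b n) \<and>
     (\<forall>\<beta>. 0 \<le> \<beta> \<longrightarrow> \<beta> \<le> 1 \<longrightarrow>
      real n * lam n * (exp (\<theta> * (\<beta> + 1 / real (b n))) - 1) + real n * lam n * (1 - real (b n) / real n) ^ d n * exp \<theta> +
        (real n - 2 * real (b n)) * (exp (- \<theta> * \<beta>) - 1) \<le> real n * (exp \<theta> + exp (- \<theta>) - 2 + \<eta>))) sequentially"
proof -
  \<comment> \<open>In order: the step width 1 / b of \<open>slope\<close>, the deviation of
    \<open>lam n\<close> from 1, samples that miss all idle servers, and departures lost at up to
    \<open>2 * b\<close> idle servers.\<close>
  define err where "err n = lam n * exp \<theta> * (exp (\<theta> * (1 / real (b n))) - 1) + \<bar>lam n - 1\<bar> * exp \<theta> +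
      lam n * (1 - \<delta> / 2) ^ d n * exp \<theta> + 2 * \<delta>" for n
  have "filterlim (\<lambda>n. real (b n)) at_top sequentially"
    unfolding b_def using \<delta>(1) by real_asymp
  then have "(\<lambda>n. 1 / real (b n)) \<longlonglongrightarrow> 0"
    by (intro tendsto_divide_0[OF tendsto_const] filterlim_at_top_imp_at_infinity)
  moreover have "(\<lambda>n. (1 - \<delta> / 2) ^ d n) \<longlonglongrightarrow> 0"
    using \<delta> by (intro filterlim_compose[OF LIMSEQ_power_zero d]) simp
  ultimately have "err \<longlonglongrightarrow> 1 * exp \<theta> * (exp (\<theta> * 0) - 1) + \<bar>1 - 1\<bar> * exp \<theta> + 1 * 0 * exp \<theta> + 2 * \<delta>"
    unfolding err_def[abs_def] using lam(1) by (intro tendsto_intros)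
  then have "err \<longlonglongrightarrow> 2 * \<delta>" by simp
  then have err: "eventually (\<lambda>n. err n < \<eta>) sequentially" using order_tendstoD(2) \<delta>(3) by blast
  \<comment> \<open>The factor 1 / 2 leaves room for the floor. The same bound later keeps the
    initial number of idle servers at most \<open>b\<close>.\<close>
  have half: "eventually (\<lambda>n. \<delta> / 2 * real n < real (b n)) sequentially"
    unfolding b_def using \<delta>(1) by real_asymp
  show ?thesis
    using err half eventually_gt_at_top[of "0::nat"]
  proof eventually_elim
    case (elim n)
    have n: "0 < real n" and lm: "0 < lam n" using elim lam(2) by auto
    have b_pos: "0 < real (b n)" using elim n \<delta>(1) by (meson less_trans mult_pos_pos half_gt_zero)
    have b_le: "real (b n) \<le> \<delta> * real n" unfolding b_def using \<delta>(1) n by (simp add: of_nat_nat)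
    have "\<delta> * real n \<le> 1 / 4 * real n" using \<delta>(2) n by (intro mult_right_mono) auto
    then have b4: "2 * real (b n) \<le> real n" using b_le n by linarith
    have main: "real n * lam n * (exp (\<theta> * (\<beta> + 1 / real (b n))) - 1) + real n * lam n * (1 - real (b n) / real n) ^ d n * exp \<theta> +
        (real n - 2 * real (b n)) * (exp (- \<theta> * \<beta>) - 1) \<le> real n * (exp \<theta> + exp (- \<theta>) - 2 + \<eta>)"
      if \<beta>: "0 \<le> \<beta>" "\<beta> \<le> 1" for \<beta>
    proof -
      define E where "E = exp (\<theta> * \<beta>)"
      have E: "1 \<le> E" "E \<le> exp \<theta>" using \<beta> \<theta> mult_left_mono[OF \<beta>(2) \<theta>] by (auto simp: E_def)
      have i: "exp (- \<theta> * \<beta>) = 1 / E" by (simp add: E_def exp_minus inverse_eq_divide)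
      have "lam n * (exp (\<theta> * (\<beta> + 1 / real (b n))) - 1) = lam n * (E * (exp (\<theta> * (1 / real (b n))) - 1)) + (lam n - 1) * (E - 1) + (E - 1)"
        unfolding distrib_left exp_add E_def by (simp add: algebra_simps)
      also have "lam n * (E * (exp (\<theta> * (1 / real (b n))) - 1)) \<le> lam n * (exp \<theta> * (exp (\<theta> * (1 / real (b n))) - 1))"
        using lm E \<theta> b_pos by (intro mult_left_mono mult_right_mono) auto
      also have "(lam n - 1) * (E - 1) \<le> \<bar>lam n - 1\<bar> * exp \<theta>"
      proof -
        have "(lam n - 1) * (E - 1) \<le> \<bar>lam n - 1\<bar> * (E - 1)" using E by (intro mult_right_mono) auto
        also have "\<dots> \<le> \<bar>lam n - 1\<bar> * exp \<theta>" using E by (intro mult_left_mono) auto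
        finally show ?thesis .
      qed
      finally have 1: "lam n * (exp (\<theta> * (\<beta> + 1 / real (b n))) - 1) \<le>
          lam n * exp \<theta> * (exp (\<theta> * (1 / real (b n))) - 1) + \<bar>lam n - 1\<bar> * exp \<theta> + (E - 1)"
        by (simp add: mult.assoc)
      have "1 - real (b n) / real n \<le> 1 - \<delta> / 2" using elim n by (simp add: field_simps)
      moreover have "0 \<le> 1 - real (b n) / real n" using b4 n b_pos by (simp add: field_simps)
      ultimately have "(1 - real (b n) / real n) ^ d n \<le> (1 - \<delta> / 2) ^ d n"
        by (intro power_mono)
      then have 2: "lam n * (1 - real (b n) / real n) ^ d n * exp \<theta> \<le> lam n * (1 - \<delta> / 2) ^ d n * exp \<theta>"
        using lm by (intro mult_right_mono mult_left_mono) auto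
      have "2 * real (b n) / real n * (1 - 1 / E) \<le> 2 * \<delta> * 1"
        using b_le n E \<delta>(1) by (intro mult_mono) (auto simp: field_simps)
      then have 3: "(1 - 2 * real (b n) / real n) * (1 / E - 1) \<le> (1 / E - 1) + 2 * \<delta>"
      proof -
        have "(1 - z) * (w - 1) = (w - 1) + z * (1 - w)" for z w :: real by (simp add: algebra_simps)
        then show ?thesis using \<open>2 * real (b n) / real n * (1 - 1 / E) \<le> 2 * \<delta> * 1\<close> by simp
      qed
      \<comment> \<open>Monotonicity of E + 1 / E in factored form.\<close>
      have "0 \<le> (exp \<theta> - E) * (1 - 1 / (exp \<theta> * E))"
        using E \<theta> mult_mono[of 1 "exp \<theta>" 1 E] by (intro mult_nonneg_nonneg) (auto simp: field_simps)
      also have "\<dots> = (exp \<theta> + exp (- \<theta>)) - (E + 1 / E)"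
        using E by (simp add: exp_minus field_simps)
      finally have 4: "E + 1 / E \<le> exp \<theta> + exp (- \<theta>)" by simp
      have "lam n * (exp (\<theta> * (\<beta> + 1 / real (b n))) - 1) + lam n * (1 - real (b n) / real n) ^ d n * exp \<theta> +
          (1 - 2 * real (b n) / real n) * (1 / E - 1) \<le> exp \<theta> + exp (- \<theta>) - 2 + \<eta>"
        using 1 2 3 4 elim(1) unfolding err_def by linarith
      then have "real n * (lam n * (exp (\<theta> * (\<beta> + 1 / real (b n))) - 1) + lam n * (1 - real (b n) / real n) ^ d n * exp \<theta> +
          (1 - 2 * real (b n) / real n) * (1 / E - 1)) \<le> real n * (exp \<theta> + exp (- \<theta>) - 2 + \<eta>)"
        using n by (intro mult_left_mono) auto
      moreover have "real n * ((1 - 2 * real (b n) / real n) * (1 / E - 1)) = (real n - 2 * real (b n)) * (1 / E - 1)"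
        using n by (simp add: field_simps)
      ultimately show ?thesis unfolding i by (simp add: distrib_left mult.assoc)
    qed
    have "2 * b n \<le> n" using b4 by linarith
    then show ?case using b_pos elim main by auto
  qed
qed

section \<open>Integer levels and their exponential rate\<close>

definition level_event :: "'a measure \<Rightarrow> nat \<Rightarrow> ('a \<Rightarrow> jsq_data) \<Rightarrow> nat \<Rightarrow> real \<Rightarrow> 'a set" where
  "level_event M n W K T = {\<omega> \<in> space M. \<exists>t\<in>{0..T}. K \<le> total_jobs n (W \<omega>) t}"

context jsq
begin

lemma F_event_eq:
  "F_event M n W x0 eps T = level_event M n W (nat \<lceil>real n * l1_norm x0 + real n * eps\<rceil>) T"
proof -
  have "l1_norm (occupancy n w t) \<ge> l1_norm x0 + eps \<longleftrightarrow> nat \<lceil>real n * l1_norm x0 + real n * eps\<rceil> \<le> total_jobs n w t" for w t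
  proof -
    have "l1_norm (occupancy n w t) \<ge> l1_norm x0 + eps \<longleftrightarrow> real n * l1_norm x0 + real n * eps \<le> real (total_jobs n w t)"
      using n by (simp add: l1_norm_occupancy field_simps)
    then show ?thesis by (simp add: nat_le_iff ceiling_le_iff)
  qed
  then show ?thesis by (simp add: F_event_def level_event_def)
qed

text \<open>The number of jobs is an integer, so the strict bound amounts to one more than the
  floor, as the weak one amounts to the ceiling. Both events become crossings of integer levels
  within 1 of the same real threshold.\<close>

lemma G_event_eq:
  assumes "0 \<le> real n * l1_norm x0 + real n * eps"
  shows "G_event M n W x0 eps T = level_event M n W (Suc (nat \<lfloor>real n * l1_norm x0 + real n * eps\<rfloor>)) T"
proof -
  have "l1_norm (occupancy n w t) > l1_norm x0 + eps \<longleftrightarrow> Suc (nat \<lfloor>real n * l1_norm x0 + real n * eps\<rfloor>) \<le> total_jobs n w t" for w t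
  proof -
    have "l1_norm (occupancy n w t) > l1_norm x0 + eps \<longleftrightarrow> real n * l1_norm x0 + real n * eps < real (total_jobs n w t)"
      using n by (simp add: l1_norm_occupancy field_simps)
    also have "\<dots> \<longleftrightarrow> \<lfloor>real n * l1_norm x0 + real n * eps\<rfloor> < int (total_jobs n w t)"
      by (simp add: floor_less_iff)
    also have "\<dots> \<longleftrightarrow> Suc (nat \<lfloor>real n * l1_norm x0 + real n * eps\<rfloor>) \<le> total_jobs n w t"
      using assms by (simp add: Suc_le_eq nat_less_iff)
    finally show ?thesis .
  qed
  then show ?thesis by (simp add: G_event_def level_event_def)
qed

lemma prob_level_lower:
  assumes "AE \<omega> in M. \<forall>i\<ge>1. occupancy n (W \<omega>) 0 i = x0 i" and "0 \<le> T"
    and "real K + real b \<le> real n * l1_norm x0 + real a"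
  shows "poisson_mass (real n * lam * T) a * poisson_mass (real n * T) b
    \<le> measure (completion M) (level_event M n W K T)"
proof -
  obtain N I where N: "real N = real n * l1_norm x0"
    "AE \<omega> in C.\<mu>. length (dec_list (\<omega> Init)) = n \<and> sum_list (dec_list (\<omega> Init)) = N \<and> card (idle (dec_list (\<omega> Init))) = I"
    by (rule initial_state[OF assms(1)])
  then have "AE \<omega> in C.\<mu>. length (dec_list (\<omega> Init)) = n \<and> sum_list (dec_list (\<omega> Init)) = N" by auto
  moreover have "K + b \<le> N + a" using assms(3) N(1) by linarith
  ultimately show ?thesis
    unfolding level_event_def overload_event[OF assms(2)] by (intro C.overload_lower assms(2))
qed

lemma prob_level_upper:
  assumes init: "AE \<omega> in M. \<forall>i\<ge>1. occupancy n (W \<omega>) 0 i = x0 i" and T: "0 \<le> T"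
    and \<theta>: "0 \<le> \<theta>" and C: "0 \<le> C" and b: "0 < b" "2 * b \<le> n"
    and idle: "real n * (1 - x0 1) \<le> real b"
    and drift: "\<And>\<beta>. 0 \<le> \<beta> \<Longrightarrow> \<beta> \<le> 1 \<Longrightarrow>
      real n * lam * (exp (\<theta> * (\<beta> + 1 / real b)) - 1) + real n * lam * (1 - real b / real n) ^ d * exp \<theta> +
        (real n - 2 * real b) * (exp (- \<theta> * \<beta>) - 1) \<le> C"
  shows "measure (completion M) (level_event M n W K T) \<le> exp (\<theta> * (real n * l1_norm x0 - real K) + C * T)"
proof -
  obtain N I where N: "real N = real n * l1_norm x0" "real I = real n * (1 - x0 1)"
    "AE \<omega> in C.\<mu>. length (dec_list (\<omega> Init)) = n \<and> sum_list (dec_list (\<omega> Init)) = N \<and> card (idle (dec_list (\<omega> Init))) = I"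
    by (rule initial_state[OF init])
  have I: "I \<le> b" using idle N(2) by linarith
  have "emeasure C.\<mu> (C.overload K T) \<le> ennreal (exp (\<theta> * (real N - real K) + C * T))"
  proof (rule C.overload_bound[where Q = "\<lambda>c. sum_list c = N \<and> card (idle c) = I"])
    fix c k assume "length c = n" "sum_list c = N \<and> card (idle c) = I"
    then show "emeasure C.\<mu> {\<omega> \<in> space C.\<mu>. reach (hit K) k c \<omega> T} \<le> ennreal (exp (\<theta> * (real N - real K) + C * T))"
      using I b by (intro C.overload_upper[where p = "(1 - real b / real n) ^ d", OF \<theta> b _ T C miss_probability drift]) auto
  qed (use T N(3) in auto)
  then have "C.mu.prob (C.overload K T) \<le> exp (\<theta> * (real N - real K) + C * T)"
    by (simp add: C.mu.emeasure_eq_measure)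
  then show ?thesis
    unfolding level_event_def overload_event[OF T] N(1) .
qed

end

text \<open>The upper bound keeps a positive error for each fixed \<delta>, which must not shrink
  with n because \<open>b\<close> has to grow. Hence it comes with a slack \<open>e\<close> instead
  of a convergent majorant.\<close>

lemma tendsto_sandwich_slack:
  fixes f l :: "nat \<Rightarrow> real"
  assumes l: "l \<longlonglongrightarrow> L" "eventually (\<lambda>n. l n \<le> f n) sequentially"
    and u: "\<And>e. 0 < e \<Longrightarrow> eventually (\<lambda>n. f n \<le> L + e) sequentially"
  shows "f \<longlonglongrightarrow> L"
proof (rule order_tendstoI)
  fix a assume "a < L"
  from order_tendstoD(1)[OF l(1) this] l(2) show "eventually (\<lambda>n. a < f n) sequentially"
    by eventually_elim linarith
next
  fix a assume "L < a"
  then have "eventually (\<lambda>n. f n \<le> L + (a - L) / 2) sequentially" by (intro u) simp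
  then show "eventually (\<lambda>n. f n < a) sequentially"
    by eventually_elim (use \<open>L < a\<close> in \<open>simp add: field_simps\<close>)
qed

text \<open>\<open>K\<close> is any integer level between the threshold and one more, so that one
  statement serves both events.\<close>

lemma level_rate:
  fixes M :: "nat \<Rightarrow> 'a measure" and lam :: "nat \<Rightarrow> real" and K :: "nat \<Rightarrow> nat"
  assumes system: "\<And>n. n \<ge> 1 \<Longrightarrow> jsq (M n) n (lam n) (d n) (W n)"
    and d: "filterlim d at_top sequentially" and lam: "lam \<longlonglongrightarrow> 1"
    and initial: "\<And>n. n \<ge> 1 \<Longrightarrow> AE \<omega> in M n. \<forall>i\<ge>1. occupancy n (W n \<omega>) 0 i = xn n i"
    and busy: "(\<lambda>n. xn n 1) \<longlonglongrightarrow> 1"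
    and K: "\<And>n. n \<ge> 1 \<Longrightarrow> real n * l1_norm (xn n) + real n * eps \<le> real (K n)"
      "\<And>n. n \<ge> 1 \<Longrightarrow> real (K n) \<le> real n * l1_norm (xn n) + real n * eps + 1"
    and eps: "0 < eps" and T: "0 < T"
  shows "(\<lambda>n. 1 / real n * log_prob (M n) (level_event (M n) n (W n) (K n) T)) \<longlonglongrightarrow>
    - T * ell ((eps / T + sqrt (4 + (eps / T)\<^sup>2)) / 2) - T * ell ((- (eps / T) + sqrt (4 + (eps / T)\<^sup>2)) / 2)"
proof -
  define \<theta> where "\<theta> = ln ((eps / T + sqrt (4 + (eps / T)\<^sup>2)) / 2)"
  define L where "L = T * (exp \<theta> + exp (- \<theta>) - 2) - \<theta> * eps"
  define P where "P n = measure (completion (M n)) (level_event (M n) n (W n) (K n) T)" for n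
  have u: "0 < eps / T" using eps T by simp
  note e = exponents[OF u, folded \<theta>_def]
  have diff: "T * exp \<theta> - T * exp (- \<theta>) = eps"
    using arg_cong[OF e(3), of "(*) T"] T by (simp add: right_diff_distrib)
  have lam_pos: "0 < lam n" if "n \<ge> 1" for n using system[OF that] by (simp add: jsq_def)
  \<comment> \<open>The arrivals at the optimal tilt. Of the added 2, one makes up for the floor and
    one for the rounding of \<open>K\<close>.\<close>
  define a where "a n = nat \<lfloor>T * exp \<theta> * real n\<rfloor> + 2" for n
  define b where "b n = nat \<lfloor>T * exp (- \<theta>) * real n\<rfloor>" for n
  have Te: "0 < T * exp \<theta>" "0 < T * exp (- \<theta>)" using T by simp_all
  have alim: "(\<lambda>n. real (a n) / real n) \<longlonglongrightarrow> T * exp \<theta>"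
    unfolding a_def using Te(1) by real_asymp
  have blim: "(\<lambda>n. real (b n) / real n) \<longlonglongrightarrow> T * exp (- \<theta>)"
    unfolding b_def using Te(2) by real_asymp
  have "(\<lambda>n. lam n * T) \<longlonglongrightarrow> 1 * T" by (intro tendsto_intros lam)
  from poisson_mass_rate[OF this _ alim Te(1)] T obtain l1 where l1:
    "l1 \<longlonglongrightarrow> T * exp \<theta> * (ln T - ln (T * exp \<theta>) + 1) - T"
    "eventually (\<lambda>n. l1 n \<le> ln (poisson_mass (real n * (lam n * T)) (a n)) / real n) sequentially"
    by auto
  from poisson_mass_rate[OF tendsto_const T blim Te(2)] obtain l2 where l2:
    "l2 \<longlonglongrightarrow> T * exp (- \<theta>) * (ln T - ln (T * exp (- \<theta>)) + 1) - T"
    "eventually (\<lambda>n. l2 n \<le> ln (poisson_mass (real n * T) (b n)) / real n) sequentially"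
    by auto
  have "(T * exp \<theta> * (ln T - ln (T * exp \<theta>) + 1) - T) + (T * exp (- \<theta>) * (ln T - ln (T * exp (- \<theta>)) + 1) - T) = T * (exp \<theta> + exp (- \<theta>) - 2) - \<theta> * (T * exp \<theta> - T * exp (- \<theta>))"
    using T by (simp add: ln_mult algebra_simps)
  also have "\<dots> = L" by (simp add: diff L_def)
  finally have low: "(\<lambda>n. l1 n + l2 n) \<longlonglongrightarrow> L"
    using tendsto_add[OF l1(1) l2(1)] by simp
  have lower: "poisson_mass (real n * (lam n * T)) (a n) * poisson_mass (real n * T) (b n) \<le> P n" if n: "n \<ge> 1" for n
  proof -
    interpret jsq "M n" n "lam n" "d n" "W n" by (rule system[OF n])
    have "T * exp \<theta> * real n + 1 \<le> real (a n)" unfolding a_def by linarith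
    moreover have "real (b n) \<le> T * exp (- \<theta>) * real n"
      unfolding b_def using Te(2) by (simp add: of_nat_nat)
    moreover have "real n * eps = T * exp \<theta> * real n - T * exp (- \<theta>) * real n"
      unfolding diff[symmetric] by (simp add: algebra_simps)
    ultimately have "real (K n) + real (b n) \<le> real n * l1_norm (xn n) + real (a n)"
      using K(2)[OF n] by linarith
    from prob_level_lower[OF initial[OF n] _ this] T show ?thesis
      by (simp add: P_def mult.assoc)
  qed
  \<comment> \<open>At probability 0 the convention \<open>ln 0 = 0\<close> would break the upper
    bound on \<open>ln (P n)\<close>.\<close>
  have P_pos: "0 < P n" if n: "n \<ge> 1" for n
    using lower[OF n] lam_pos[OF n] T n
    by (intro less_le_trans[OF mult_pos_pos lower[OF n]] poisson_mass_pos) auto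
  have "(\<lambda>n. ln (P n) / real n) \<longlonglongrightarrow> L"
  proof (rule tendsto_sandwich_slack[OF low])
    show "eventually (\<lambda>n. l1 n + l2 n \<le> ln (P n) / real n) sequentially"
      using l1(2) l2(2) eventually_ge_at_top[of 1]
    proof eventually_elim
      case (elim n)
      have p: "0 < poisson_mass (real n * (lam n * T)) (a n)" "0 < poisson_mass (real n * T) (b n)"
        using lam_pos[of n] T elim(3) by (auto intro!: poisson_mass_pos)
      have "ln (poisson_mass (real n * (lam n * T)) (a n)) + ln (poisson_mass (real n * T) (b n)) =
          ln (poisson_mass (real n * (lam n * T)) (a n) * poisson_mass (real n * T) (b n))"
        using p by (simp add: ln_mult)
      also have "\<dots> \<le> ln (P n)"
        using p lower[OF elim(3)] by (intro ln_mono) (auto intro: mult_pos_pos less_le_trans)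
      finally have "ln (poisson_mass (real n * (lam n * T)) (a n)) / real n + ln (poisson_mass (real n * T) (b n)) / real n \<le> ln (P n) / real n"
        unfolding add_divide_distrib[symmetric] by (rule divide_right_mono) simp
      then show ?case using elim by linarith
    qed
    fix \<eta>' :: real assume "0 < \<eta>'"
    \<comment> \<open>The drift error acts throughout the time T, hence the division. \<delta> is at
      most \<eta> / 4 so that the limit 2 \<delta> of the error stays below \<eta>.\<close>
    define \<eta> where "\<eta> = \<eta>' / T"
    have \<eta>: "0 < \<eta>" using \<open>0 < \<eta>'\<close> T by (simp add: \<eta>_def)
    define \<delta> where "\<delta> = min (1 / 4) (\<eta> / 4)"
    have \<delta>: "0 < \<delta>" "\<delta> \<le> 1 / 4" "2 * \<delta> < \<eta>" using \<eta> by (auto simp: \<delta>_def min_def)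
    have "\<forall>n\<ge>1. 0 < lam n" using lam_pos by blast
    note drift = drift_eventually[OF lam this d e(4) \<delta>]
    have "eventually (\<lambda>n. 1 - \<delta> / 2 < xn n 1) sequentially"
      using order_tendstoD(1)[OF busy, of "1 - \<delta> / 2"] \<delta> by simp
    with drift eventually_ge_at_top[of 1]
    show "eventually (\<lambda>n. ln (P n) / real n \<le> L + \<eta>') sequentially"
    proof eventually_elim
      case (elim n)
      interpret jsq "M n" n "lam n" "d n" "W n" by (rule system[OF elim(2)])
      let ?b = "nat \<lfloor>\<delta> * real n\<rfloor>"
      have "real n * (1 - xn n 1) \<le> real n * (\<delta> / 2)"
        using elim(3) by (intro mult_left_mono) auto
      also have "\<dots> = \<delta> / 2 * real n" by (rule mult.commute)
      also have "\<dots> \<le> real ?b" using elim(1) by (intro less_imp_le) blast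
      finally have idle: "real n * (1 - xn n 1) \<le> real ?b" .
      have "0 \<le> exp \<theta> + exp (- \<theta>) - 2"
      proof -
        have "0 \<le> (exp (\<theta> / 2) - exp (- \<theta> / 2))\<^sup>2" by simp
        also have "\<dots> = exp \<theta> + exp (- \<theta>) - 2"
          by (simp add: power2_eq_square algebra_simps exp_add[symmetric])
        finally show ?thesis .
      qed
      then have C: "0 \<le> real n * (exp \<theta> + exp (- \<theta>) - 2 + \<eta>)" using \<eta> by simp
      have "P n \<le> exp (\<theta> * (real n * l1_norm (xn n) - real (K n)) + real n * (exp \<theta> + exp (- \<theta>) - 2 + \<eta>) * T)"
        unfolding P_def using elim(1) T
        by (intro prob_level_upper[OF initial[OF elim(2)] _ e(4) C _ _ idle]) auto
      then have "ln (P n) \<le> \<theta> * (real n * l1_norm (xn n) - real (K n)) + real n * (exp \<theta> + exp (- \<theta>) - 2 + \<eta>) * T"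
        using P_pos[OF elim(2)] by (metis exp_gt_zero ln_exp ln_le_cancel_iff)
      also have "\<theta> * (real n * l1_norm (xn n) - real (K n)) \<le> \<theta> * (- (real n * eps))"
        using K(1)[OF elim(2)] e(4) by (intro mult_left_mono) auto
      also have "\<theta> * (- (real n * eps)) + real n * (exp \<theta> + exp (- \<theta>) - 2 + \<eta>) * T = real n * (L + \<eta>')"
        using T by (simp add: L_def \<eta>_def algebra_simps)
      finally show ?case using elim(2) by (simp add: divide_le_eq mult.commute)
    qed
  qed
  then show ?thesis
    unfolding rate_function_eq[OF eps T] by (simp add: log_prob_def P_def L_def \<theta>_def)
qed

lemma l1_norm_component_le:
  assumes "y \<in> l1_space" "z \<in> l1_space" "1 \<le> i"
  shows "\<bar>y i - z i\<bar> \<le> l1_norm (\<lambda>i. y i - z i)"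
proof -
  have "(\<lambda>i. \<bar>y i\<bar> + \<bar>z i\<bar>) summable_on {1..}"
    using assms by (intro summable_on_add) (auto simp: l1_space_def)
  then have "(\<lambda>i. \<bar>y i - z i\<bar>) summable_on {1..}"
    by (rule summable_on_comparison_test) auto
  then have "infsum (\<lambda>i. \<bar>y i - z i\<bar>) {i} \<le> infsum (\<lambda>i. \<bar>y i - z i\<bar>) {1..}"
    using assms(3) by (intro infsum_mono_neutral) auto
  then show ?thesis by (simp add: l1_norm_def)
qed

theorem theorem2p2:
  fixes M :: "nat \<Rightarrow> 'a measure"
    and W :: "nat \<Rightarrow> 'a \<Rightarrow> jsq_data"
    and d :: "nat \<Rightarrow> nat"
    and lam :: "nat \<Rightarrow> real"
    and lambda eps :: real
    and xn :: "nat \<Rightarrow> nat \<Rightarrow> real"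
    and x :: "nat \<Rightarrow> real"
  assumes system: "\<And>n. n \<ge> 1 \<Longrightarrow> jsq_system (M n) n (lam n) (d n) (W n)"
    and d_range: "\<And>n. n \<ge> 1 \<Longrightarrow> d n \<in> {1..n}"
    and d_lim: "filterlim d at_top sequentially"
    and lam_pos: "\<And>n. n \<ge> 1 \<Longrightarrow> lam n > 0"
    and lam_lim: "lam \<longlonglongrightarrow> lambda"
    and xn_space: "\<And>n. n \<ge> 1 \<Longrightarrow> xn n \<in> l1_down"
    and xn_nat: "\<And>n i. n \<ge> 1 \<Longrightarrow> i \<ge> 1 \<Longrightarrow> real n * xn n i \<in> \<nat>"
    and x_space: "x \<in> l1_down"
    and xn_lim: "(\<lambda>n. l1_norm (\<lambda>i. xn n i - x i)) \<longlonglongrightarrow> 0"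
    and initial: "\<And>n. n \<ge> 1 \<Longrightarrow> AE \<omega> in M n. \<forall>i\<ge>1. occupancy n (W n \<omega>) 0 i = xn n i"
    and lambda_1: "lambda = 1"
    and x_1: "x 1 = 1"
    and eps_pos: "eps > 0"
  shows "(\<forall>T>0.
            let L = - T * ell ((eps / T + sqrt (4 + (eps / T)\<^sup>2)) / 2)
                    - T * ell ((- (eps / T) + sqrt (4 + (eps / T)\<^sup>2)) / 2)
            in (\<lambda>n. 1 / real n * log_prob (M n) (G_event (M n) n (W n) (xn n) eps T)) \<longlonglongrightarrow> L
             \<and> (\<lambda>n. 1 / real n * log_prob (M n) (F_event (M n) n (W n) (xn n) eps T)) \<longlonglongrightarrow> L)
       \<and> ((\<lambda>T. lim (\<lambda>n. T / real n * log_prob (M n) (G_event (M n) n (W n) (xn n) eps T)))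
            \<longlongrightarrow> - (eps\<^sup>2 / 4)) at_top
       \<and> ((\<lambda>T. lim (\<lambda>n. T / real n * log_prob (M n) (F_event (M n) n (W n) (xn n) eps T)))
            \<longlongrightarrow> - (eps\<^sup>2 / 4)) at_top"
proof -
  have l1: "xn n \<in> l1_space" if "n \<ge> 1" for n
    using xn_space[OF that] by (simp add: l1_down_def)
  have l1x: "x \<in> l1_space" using x_space by (simp add: l1_down_def)
  have sys: "jsq (M n) n (lam n) (d n) (W n)" if "n \<ge> 1" for n
    using system[OF that] d_range[OF that] lam_pos[OF that] that by (simp add: jsq_def)
  have lam: "lam \<longlonglongrightarrow> 1" using lam_lim lambda_1 by simp
  have "(\<lambda>n. xn n 1 - x 1) \<longlonglongrightarrow> 0"
  proof (rule Lim_null_comparison[OF _ xn_lim])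
    show "eventually (\<lambda>n. norm (xn n 1 - x 1) \<le> l1_norm (\<lambda>i. xn n i - x i)) sequentially"
      using eventually_ge_at_top[of 1] by eventually_elim (simp add: l1_norm_component_le[OF l1 l1x])
  qed
  then have busy: "(\<lambda>n. xn n 1) \<longlonglongrightarrow> 1"
    using x_1 by (simp add: LIM_zero_iff)
  define L where "L T = - T * ell ((eps / T + sqrt (4 + (eps / T)\<^sup>2)) / 2)
      - T * ell ((- (eps / T) + sqrt (4 + (eps / T)\<^sup>2)) / 2)" for T
  define s where "s n = real n * l1_norm (xn n) + real n * eps" for n
  have s: "0 \<le> s n" for n
    using eps_pos by (simp add: s_def l1_norm_def infsum_nonneg)
  have F: "(\<lambda>n. 1 / real n * log_prob (M n) (F_event (M n) n (W n) (xn n) eps T)) \<longlonglongrightarrow> L T" if "0 < T" for T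
  proof -
    have "(\<lambda>n. 1 / real n * log_prob (M n) (level_event (M n) n (W n) (nat \<lceil>s n\<rceil>) T)) \<longlonglongrightarrow> L T"
      unfolding L_def
    proof (rule level_rate[OF sys d_lim lam initial busy _ _ eps_pos that])
      fix n :: nat
      show "real n * l1_norm (xn n) + real n * eps \<le> real (nat \<lceil>s n\<rceil>)" unfolding s_def by linarith
      show "real (nat \<lceil>s n\<rceil>) \<le> real n * l1_norm (xn n) + real n * eps + 1" using s[of n] unfolding s_def by linarith
    qed
    then show ?thesis
      by (rule Lim_transform_eventually)
         (use eventually_ge_at_top[of 1] in eventually_elim, simp add: jsq.F_event_eq[OF sys] s_def)
  qed
  have G: "(\<lambda>n. 1 / real n * log_prob (M n) (G_event (M n) n (W n) (xn n) eps T)) \<longlonglongrightarrow> L T" if "0 < T" for T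
  proof -
    have "(\<lambda>n. 1 / real n * log_prob (M n) (level_event (M n) n (W n) (Suc (nat \<lfloor>s n\<rfloor>)) T)) \<longlonglongrightarrow> L T"
      unfolding L_def
    proof (rule level_rate[OF sys d_lim lam initial busy _ _ eps_pos that])
      fix n :: nat
      show "real n * l1_norm (xn n) + real n * eps \<le> real (Suc (nat \<lfloor>s n\<rfloor>))" unfolding s_def by linarith
      show "real (Suc (nat \<lfloor>s n\<rfloor>)) \<le> real n * l1_norm (xn n) + real n * eps + 1" using s[of n] unfolding s_def by linarith
    qed
    then show ?thesis
      by (rule Lim_transform_eventually)
         (use eventually_ge_at_top[of 1] in eventually_elim, use s in \<open>simp add: jsq.G_event_eq[OF sys] s_def\<close>)
  qed
  have scaled: "((\<lambda>T. lim (\<lambda>n. T / real n * log_prob (M n) (A T n))) \<longlongrightarrow> - (eps\<^sup>2 / 4)) at_top"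
    if A: "\<And>T. 0 < T \<Longrightarrow> (\<lambda>n. 1 / real n * log_prob (M n) (A T n)) \<longlonglongrightarrow> L T" for A
  proof (rule Lim_transform_eventually)
    show "((\<lambda>T. T * L T) \<longlongrightarrow> - (eps\<^sup>2 / 4)) at_top"
      unfolding L_def by (rule rate_function_limit[OF eps_pos])
    show "eventually (\<lambda>T. T * L T = lim (\<lambda>n. T / real n * log_prob (M n) (A T n))) at_top"
      using eventually_gt_at_top[of "0::real"]
    proof eventually_elim
      case (elim T)
      \<comment> \<open>\<open>lim\<close> is a definite description, so its value is obtained from
        a proved convergence.\<close>
      have "(\<lambda>n. T * (1 / real n * log_prob (M n) (A T n))) \<longlonglongrightarrow> T * L T"
        by (intro tendsto_mult tendsto_const A elim)
      then show ?case by (simp add: limI)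
    qed
  qed
  show ?thesis
    using F G scaled[OF F] scaled[OF G] by (simp add: Let_def L_def)
qed

end
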